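(* Suppose that for the family $f_c(z)=z^2+c$ all non-constant polynomials $\Delta_{n,m}\in\mathbb{Z}[c]$ (positive integers $m\mid n$) are irreducible over $\mathbb{Q}$. Then each parabolic parameter for $f_c(z)=z^2+c$ of degree $4$ over $\mathbb{Q}$ is a root of one of the following polynomials: $$\begin{aligned} &256c^4+64c^3+16c^2-36c+31,\\ &256c^4+32c^2-64c+17,\\ &256c^4-192c^3+144c^2-68c+11,\\ &256c^4+128c^3-16c^2-56c+13,\\ &256c^4+1088c^3+1744c^2+1252c+341,\\ &256c^4+1024c^3+1536c^2+1024c+257,\\ &256c^4+960c^3+1360c^2+860c+205,\\ &256c^4+1024c^3+1520c^2+992c+241. \end{aligned}$$
   Context: $\gamma\in\mathbb{C}$ is a parabolic parameter if $f_\gamma(z)=z^2+\gamma$ has a parabolic periodic point in $\mathbb{C}$, i.e. a point $\alpha$ of some period $m$ whose multiplier $(f_\gamma^{\circ m})'(\alpha)$ is a root of unity. Definition of $\Delta_{n,m}$: with $c$ an indeterminate and $f(z)=z^2+c$, let $\Phi_n^*(z)=\prod_{k\mid n}(f^{\circ k}(z)-z)^{\mu(n/k)}$ ($\mu$ the Möbius function), and let $\delta_n(x)\in\mathbb{Z}[c][x]$ be the monic polynomial in $x$ with $\delta_n(x)^n=\prod_{\Phi_n^*(\alpha)=0}(x-(f^{\circ n})'(\alpha))$ (roots in $\overline{\mathbb{Q}(c)}$ with multiplicity). For $m\mid n$, $m<n$, put $\Delta_{n,m}=\mathrm{Res}_x(\Phi^{\mathrm{cyc}}_{n/m}(x),\delta_m(x))$,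 where $\Phi^{\mathrm{cyc}}_i$ is the $i$-th cyclotomic polynomial, and define $\Delta_{n,n}$ by $\delta_n(1)=\Delta_{n,n}\prod_{m\mid n,\,m\ne n}\Delta_{n,m}$. All $\Delta_{n,m}$ are polynomials in $\mathbb{Z}[c]$. *)

theory Defs
  imports
    Complex_Main
    "HOL-Algebra.Algebraic_Closure_Type"
    "Subresultants.Resultant_Prelim"
begin

definition quad_iter :: "'a::comm_ring_1 \<Rightarrow> nat \<Rightarrow> 'a poly" where
  "quad_iter c n = ((\<lambda>p. pcompose [:c, 0, 1:] p) ^^ n) [:0, 1:]"

definition multiplier :: "'a::idom \<Rightarrow> nat \<Rightarrow> 'a \<Rightarrow> 'a" where
  "multiplier c n \<alpha> = poly (pderiv (quad_iter c n)) \<alpha>"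

definition parabolic_parameter :: "complex \<Rightarrow> bool" where
  "parabolic_parameter \<gamma> \<longleftrightarrow>
     (\<exists>\<alpha> m. m > 0 \<and> poly (quad_iter \<gamma> m) \<alpha> = \<alpha> \<and>
        (\<forall>k. 0 < k \<and> k < m \<longrightarrow> poly (quad_iter \<gamma> k) \<alpha> \<noteq> \<alpha>) \<and>
        (\<exists>r>0. multiplier \<gamma> m \<alpha> ^ r = 1))"

text \<open>The degree over the rationals is the degree of the minimal polynomial.\<close>

definition has_degree_over_rat :: "complex \<Rightarrow> nat \<Rightarrow> bool" where
  "has_degree_over_rat \<gamma> d \<longleftrightarrow>
     (\<exists>p :: rat poly. Polynomial.lead_coeff p = 1 \<and> Factorial_Ring.irreducible p \<and>
        Polynomial.degree p = d \<and> poly (map_poly of_rat p) \<gamma> = 0)"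

definition moebius :: "nat \<Rightarrow> int" where
  "moebius n = (if squarefree n then (-1) ^ card (prime_factors n) else 0)"

definition cyclotomic :: "nat \<Rightarrow> int poly" where
  "cyclotomic n =
     (THE p. map_poly complex_of_int p =
        (\<Prod>\<zeta> \<in> {\<zeta>. \<zeta> ^ n = 1 \<and> (\<forall>k. 0 < k \<and> k < n \<longrightarrow> \<zeta> ^ k \<noteq> 1)}. [:-\<zeta>, 1:]))"

text \<open>
  In what follows, an element of \<open>int poly\<close> is a polynomial in the indeterminate \<open>c\<close>, so
  \<open>int poly poly\<close> is the ring of polynomials in \<open>z\<close> (or \<open>x\<close>) over the integral polynomials
  in \<open>c\<close>, and \<open>int poly fract\<close> is the field of rational functions in \<open>c\<close> over the rationals.

  The product defining the dynatomic polynomial has negative exponents and is formed in the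
  fraction field of \<open>int poly poly\<close>; it is a classical fact that its value is a polynomial,
  and that polynomial is unique because \<open>to_fract\<close> is injective.
\<close>

definition indet_c :: "int poly" where
  "indet_c = [:0, 1:]"

definition dynatomic :: "nat \<Rightarrow> int poly poly" where
  "dynatomic n =
     (THE p. to_fract p =
        (\<Prod>k | k dvd n. to_fract (quad_iter indet_c k - [:0, 1:]) powi moebius (n div k)))"

type_synonym Qc_closure = "int poly fract alg_closure"

definition to_Qc_closure :: "int poly \<Rightarrow> Qc_closure" where
  "to_Qc_closure a = to_ac (to_fract a)"

text \<open>
  \<open>proots\<close> is the multiset of roots, so the product below counts multiplicities. Existence of
  the root \<open>delta n\<close> with coefficients in \<open>int poly\<close> is a classical fact, uniqueness follows
  from monicity.
\<close>

definition delta :: "nat \<Rightarrow> int poly poly" where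
  "delta n =
     (THE d. Polynomial.lead_coeff d = 1 \<and>
        map_poly to_Qc_closure d ^ n =
          (\<Prod>\<alpha> \<in># proots (map_poly to_Qc_closure (dynatomic n)).
             [:- multiplier (to_Qc_closure indet_c) n \<alpha>, 1:]))"

definition Delta_proper :: "nat \<Rightarrow> nat \<Rightarrow> int poly" where
  "Delta_proper n m =
     resultant (map_poly (\<lambda>a. [:a:]) (cyclotomic (n div m))) (delta m)"

text \<open>
  \<open>Delta n m\<close> is meaningful for positive \<open>n\<close> and \<open>m dvd n\<close> only. For \<open>m = n\<close> it is the cofactor
  in \<open>int poly\<close> of the (nonzero) product of all \<open>Delta n m\<close> with \<open>m \<noteq> n\<close>.
\<close>

definition Delta :: "nat \<Rightarrow> nat \<Rightarrow> int poly" where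
  "Delta n m =
     (if m = n
      then (THE d. poly (delta n) 1 = d * (\<Prod>k | k dvd n \<and> k \<noteq> n. Delta_proper n k))
      else Delta_proper n m)"

end

theory Submission
  imports Defs "Subresultants.Subresultant" "HOL-Number_Theory.Totient"
begin

text \<open>
  Write \<open>f\<close> for the map \<open>z \<mapsto> z\<^sup>2 + c\<close>, \<open>N k\<close> for the degree of \<open>dynatomic k\<close>, that is, the number of points of
  exact period \<open>k\<close> for generic \<open>c\<close>, and \<open>\<phi>\<close> for the totient function.

  Let \<open>\<gamma>\<close> be a parabolic parameter, with a cycle of exact period \<open>m\<close> whose multiplier is a primitive
  \<open>r\<close>-th root of unity. If \<open>r > 1\<close>, then \<open>\<gamma>\<close> is a root of \<open>Delta (m * r) m\<close>. If \<open>r = 1\<close>, then \<open>\<gamma>\<close> is a root of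
  the value of \<open>delta m\<close> at \<open>1\<close>, which is the product of the \<open>Delta m k\<close> with \<open>k dvd m\<close>. In both cases irreducibility
  forces the degree of \<open>\<gamma>\<close> to be the degree of a polynomial \<open>Delta n k\<close>, and only degrees have to be compared.

  For large \<open>c\<close> the points of a given period satisfy \<open>\<bar>z\<bar>\<^sup>2 \<sim> \<bar>c\<bar>\<close>, so that all multipliers of period \<open>n\<close> grow like
  \<open>(4 \<bar>c\<bar>)\<close> to the power \<open>n / 2\<close>. Consequently \<open>delta n\<close> at a root of unity has degree \<open>N n / 2\<close> in \<open>c\<close>
  (\<open>delta_val_degree\<close>), and \<open>Delta n k\<close> has degree \<open>\<phi> (n / k) N k / 2\<close> for \<open>k \<noteq> n\<close>. The degree of \<open>Delta n n\<close> is
  the difference between \<open>N n / 2\<close> and the sum of these degrees; it is at most \<open>3\<close> for \<open>n \<le> 4\<close> and much larger than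
  \<open>4\<close> for \<open>n \<ge> 5\<close> (\<open>diagonal_degree_neq_4\<close>). For \<open>k \<noteq> n\<close> the degree is \<open>4\<close> only if \<open>k\<close> is \<open>1\<close> or \<open>2\<close> and
  \<open>\<phi> (n / k) = 4\<close>, so \<open>n / k\<close> is \<open>5\<close>, \<open>8\<close>, \<open>10\<close> or \<open>12\<close>. The multiplier \<open>\<zeta>\<close> of a fixed point satisfies
  \<open>4 \<gamma> = 2 \<zeta> - \<zeta>\<^sup>2\<close>, that of a cycle of length \<open>2\<close> satisfies \<open>\<zeta> = 4 \<gamma> + 4\<close>, and the four cyclotomic equations
  for \<open>\<zeta>\<close> turn into the eight quartics.

  The polynomials involved are given by definite descriptions, so their existence is part of the proof.
  For \<open>dynatomic\<close> it follows from the simplicity of the periodic points of the generic map, for \<open>delta\<close> from the fact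
  that a monic root of a monic integral polynomial is integral. The delicate case is \<open>Delta n n\<close>: the product of
  the \<open>Delta n k\<close> with \<open>k \<noteq> n\<close> has to divide \<open>delta n\<close> at \<open>1\<close> (\<open>delta_1_factorization\<close>). Irreducibility makes the
  roots of each \<open>Delta n k\<close> simple, but several of these polynomials might share a root. If \<open>s\<close> of them
  vanish at some parameter, this parameter has \<open>s\<close> cycles of different lengths \<open>k\<close> with primitive \<open>(n / k)\<close>-th roots
  of unity as multipliers. Each of the \<open>k\<close> points of such a cycle is a root of multiplicity at least \<open>n / k\<close> of
  the dynatomic polynomial of \<open>n\<close>, since \<open>f^k\<close> commutes with its own iterate \<open>f^n\<close> (\<open>parabolic_order\<close>). So the
  dynatomic polynomial and \<open>1 - (f^n)'\<close> have a common factor of degree \<open>s n\<close>. Their resultant, which is the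
  \<open>n\<close>-th power of \<open>delta n\<close> at \<open>1\<close>, vanishes to at least that order by \<open>power_dvd_resultant\<close>.
\<close>

section \<open>Sylvester matrices by rows\<close>

text \<open>
  The rows are coefficient vectors of the polynomials \<open>s i\<close>, from exponent \<open>n - 1\<close> down to \<open>0\<close>. Multiplying
  such a matrix from the left forms linear combinations of the polynomials, so that row operations
  on a Sylvester matrix become polynomial identities.
\<close>

definition rows_mat :: "nat \<Rightarrow> (nat \<Rightarrow> 'a::comm_ring_1 poly) \<Rightarrow> 'a mat" where
  "rows_mat n s = mat n n (\<lambda>(i, j). coeff (s i) (n - 1 - j))"

lemma rows_mat_carrier [simp]: "rows_mat n s \<in> carrier_mat n n"
  by (simp add: rows_mat_def)

lemma rows_mat_cong:
  assumes "\<And>i. i < n \<Longrightarrow> s i = t i"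
  shows "rows_mat n s = rows_mat n t"
  using assms by (auto simp: rows_mat_def)

lemma sylvester_mat_eq_rows_mat:
  fixes p q :: "'a::comm_ring_1 poly"
  shows "sylvester_mat p q = rows_mat (degree p + degree q)
     (\<lambda>i. if i < degree q then monom 1 (degree q - 1 - i) * p
          else monom 1 (degree p + degree q - 1 - i) * q)"
proof (rule eq_matI, goal_cases)
  case (1 i j)
  then have ij: "i < degree p + degree q" "j < degree p + degree q"
    by (auto simp: rows_mat_def)
  show ?case
    unfolding sylvester_index_mat2[OF ij]
    using ij by (auto simp: rows_mat_def coeff_monom_mult diff_le_mono2 intro!: arg_cong[of _ _ "coeff _"])
qed (auto simp: rows_mat_def)

lemma mult_rows_mat:
  assumes "M \<in> carrier_mat n n"
  shows "M * rows_mat n s = rows_mat n (\<lambda>i. \<Sum>j<n. smult (M $$ (i, j)) (s j))"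
  using assms by (intro eq_matI)
    (auto simp: rows_mat_def scalar_prod_def coeff_sum atLeast0LessThan)

lemma det_rows_mat_smult:
  fixes a :: "nat \<Rightarrow> 'a::idom"
  shows "det (rows_mat n (\<lambda>i. smult (a i) (s i))) = (\<Prod>i<n. a i) * det (rows_mat n s)"
proof -
  define D where "D = mat n n (\<lambda>(i, j). if i = j then a i else 0)"
  have D: "D \<in> carrier_mat n n" by (simp add: D_def)
  have "rows_mat n (\<lambda>i. smult (a i) (s i)) = D * rows_mat n s"
    unfolding mult_rows_mat[OF D]
    by (rule rows_mat_cong) (simp add: D_def if_distrib[of "\<lambda>x. smult x _"] sum.delta cong: if_cong)
  moreover have "det D = (\<Prod>i<n. a i)"
  proof -
    have "upper_triangular D" by (auto simp: D_def upper_triangular_def)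
    then have "det D = prod_list (diag_mat D)" using D by (rule det_upper_triangular)
    also have "diag_mat D = map a [0..<n]" by (auto simp: D_def diag_mat_def)
    also have "prod_list \<dots> = (\<Prod>i<n. a i)" by (induction n) (simp_all add: mult.commute)
    finally show ?thesis .
  qed
  ultimately show ?thesis using det_mult[OF D rows_mat_carrier] by simp
qed

lemma det_rows_mat_upper_op:
  fixes s t :: "nat \<Rightarrow> 'a::idom poly"
  assumes "\<And>i. i < n \<Longrightarrow> t i = s i + (\<Sum>j\<in>{i<..<n}. smult (u i j) (s j))"
  shows "det (rows_mat n t) = det (rows_mat n s)"
proof -
  define U where "U = mat n n (\<lambda>(i, j). if i = j then 1 else if i < j then u i j else 0)"
  have U: "U \<in> carrier_mat n n" by (simp add: U_def)
  have "rows_mat n t = U * rows_mat n s"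
    unfolding mult_rows_mat[OF U]
  proof (rule rows_mat_cong)
    fix i assume i: "i < n"
    have "(\<Sum>j<n. smult (U $$ (i, j)) (s j)) =
      (\<Sum>j<n. (if j = i then s j else 0) + (if j \<in> {i<..<n} then smult (u i j) (s j) else 0))"
      using i by (intro sum.cong) (auto simp: U_def)
    also have "\<dots> = s i + (\<Sum>j\<in>{i<..<n}. smult (u i j) (s j))"
      using i by (subst sum.distrib, subst sum.inter_restrict[symmetric])
        (auto intro!: sum.cong)
    finally show "t i = (\<Sum>j<n. smult (U $$ (i, j)) (s j))" using assms[OF i] by simp
  qed
  moreover have "det U = 1"
  proof -
    have "upper_triangular U" by (auto simp: U_def upper_triangular_def)
    then have "det U = prod_list (diag_mat U)" using U by (rule det_upper_triangular)
    also have "diag_mat U = map (\<lambda>_. 1) [0..<n]" by (auto simp: U_def diag_mat_def)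
    finally show ?thesis by (simp add: prod.distinct_set_conv_list map_replicate_const)
  qed
  ultimately show ?thesis using det_mult[OF U rows_mat_carrier] by simp
qed

lemma det_rows_mat_lower_op:
  fixes s t :: "nat \<Rightarrow> 'a::idom poly"
  assumes "\<And>i. i < n \<Longrightarrow> t i = s i + (\<Sum>j<i. smult (u i j) (s j))"
  shows "det (rows_mat n t) = det (rows_mat n s)"
proof -
  define U where "U = mat n n (\<lambda>(i, j). if i = j then 1 else if j < i then u i j else 0)"
  have U: "U \<in> carrier_mat n n" by (simp add: U_def)
  have "rows_mat n t = U * rows_mat n s"
    unfolding mult_rows_mat[OF U]
  proof (rule rows_mat_cong)
    fix i assume i: "i < n"
    have "(\<Sum>j<n. smult (U $$ (i, j)) (s j)) =
      (\<Sum>j<n. (if j = i then s j else 0) + (if j \<in> {..<i} then smult (u i j) (s j) else 0))"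
      using i by (intro sum.cong) (auto simp: U_def)
    also have "\<dots> = s i + (\<Sum>j<i. smult (u i j) (s j))"
      using i by (subst sum.distrib, subst sum.inter_restrict[symmetric])
        (auto intro!: sum.cong)
    finally show "t i = (\<Sum>j<n. smult (U $$ (i, j)) (s j))" using assms[OF i] by simp
  qed
  moreover have "det U = 1"
  proof -
    have "det U = prod_list (diag_mat U)" using U 
      by (intro det_lower_triangular[of n]) (auto simp: U_def)
    also have "diag_mat U = map (\<lambda>_. 1) [0..<n]" by (auto simp: U_def diag_mat_def)
    finally show ?thesis by (simp add: prod.distinct_set_conv_list map_replicate_const)
  qed
  ultimately show ?thesis using det_mult[OF U rows_mat_carrier] by simp
qed

lemma poly_eq_sum_smult_monom:
  fixes p :: "'a::comm_ring_1 poly"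
  assumes "degree p < n \<or> p = 0"
  shows "(\<Sum>j<n. smult (coeff p (n - 1 - j)) (monom 1 (n - 1 - j))) = p"
proof -
  have "(\<Sum>j<n. smult (coeff p (n - 1 - j)) (monom 1 (n - 1 - j))) = (\<Sum>j<n. monom (coeff p j) j)"
    by (rule sum.reindex_bij_witness[of _ "\<lambda>j. n - 1 - j" "\<lambda>j. n - 1 - j"])
      (auto simp: smult_monom)
  also have "\<dots> = p"
  proof (rule poly_eqI)
    fix k
    show "coeff (\<Sum>j<n. monom (coeff p j) j) k = coeff p k"
      using assms by (auto simp: coeff_sum coeff_monom sum.delta' coeff_eq_0 not_less)
  qed
  finally show ?thesis .
qed

text \<open>
  Put \<open>F = (x - b) P\<close>. Subtracting \<open>b\<close> times the next row from each row \<open>x^j G\<close> with \<open>j > 0\<close> makes every row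
  except the last one, \<open>G\<close>, a multiple of \<open>x - b\<close>; the quotients are the rows of the Sylvester
  matrix of \<open>P\<close> and \<open>G\<close>. Expanding in the basis \<open>(x - b) x^i, 1\<close> instead of the monomials, which is a
  unipotent change of coordinates, exhibits a block triangular matrix with the corner entry \<open>G(b)\<close>.
\<close>

lemma resultant_linear_factor_mult:
  fixes P G :: "'a::idom poly"
  assumes P: "P \<noteq> 0"
  shows "resultant ([:-b, 1:] * P) G = poly G b * resultant P G"
proof -
  define p q n where "p = degree P" and "q = degree G" and "n = Suc (p + q)"
  let ?l = "[:-b, 1:]"
  define s where "s i = (if i < q then monom 1 (q - 1 - i) * (?l * P) else monom 1 (n - 1 - i) * G)" for i
  define r where "r i = (if i < q then monom 1 (q - 1 - i) * P else monom 1 (p + q - 1 - i) * G)" for i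
  define t where "t i = (if i < n - 1 then ?l * r i else G)" for i
  define c where "c i = (if i < n - 1 then ?l * monom 1 (n - 2 - i) else 1)" for i
  have deg: "degree (?l * P) = Suc p"
    using P by (subst degree_mult_eq) (auto simp: p_def)
  have "resultant (?l * P) G = det (rows_mat n s)"
    unfolding resultant_def sylvester_mat_eq_rows_mat deg q_def[symmetric] s_def[abs_def] n_def add_Suc ..
  also have "\<dots> = det (rows_mat n t)"
  proof (rule det_rows_mat_upper_op[symmetric, where u = "\<lambda>i j. if i \<ge> q \<and> j = Suc i then -b else 0"])
    fix i assume i: "i < n"
    show "t i = s i + (\<Sum>j\<in>{i<..<n}. smult (if i \<ge> q \<and> j = Suc i then -b else 0) (s j))"
    proof (cases "i < q")
      case True
      then show ?thesis by (simp add: t_def s_def r_def n_def algebra_simps)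
    next
      case iq: False
      show ?thesis
      proof (cases "i = n - 1")
        case True
        then show ?thesis using iq i by (simp add: t_def s_def n_def)
      next
        case False
        with i have i': "Suc i < n" by auto
        obtain k where k: "p + q - i = Suc k" using i' by (cases "p + q - i") (auto simp: n_def)
        have k': "p + q - Suc i = k" using k by simp
        have "(\<Sum>j\<in>{i<..<n}. smult (if i \<ge> q \<and> j = Suc i then -b else 0) (s j)) =
          (\<Sum>j\<in>{i<..<n}. if j = Suc i then smult (-b) (s j) else 0)"
          using iq by (intro sum.cong) auto
        also have "\<dots> = smult (-b) (s (Suc i))" using i' by (simp add: sum.delta)
        finally show ?thesis using iq i' k k'
          by (simp add: t_def s_def r_def n_def monom_Suc algebra_simps)
      qed
    qed
  qed
  also have "\<dots> = poly G b * det (rows_mat (n - 1) r)"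
  proof -
    obtain Q where Q: "G = ?l * Q + [:poly G b:]"
    proof -
      have "?l dvd G - [:poly G b:]" by (subst poly_eq_0_iff_dvd[symmetric]) simp
      then obtain Q where "G - [:poly G b:] = ?l * Q" by (elim dvdE)
      then show ?thesis by (intro that[of Q]) (simp add: diff_eq_eq)
    qed
    \<comment> \<open>the last row of the block matrix: division of \<open>G\<close> by \<open>x - b\<close> with the remainder \<open>G(b)\<close>\<close>
    define A3 where "A3 = mat 1 (n - 1) (\<lambda>(i, j). coeff Q (n - 2 - j))"
    define A4 where "A4 = mat 1 1 (\<lambda>(i, j). poly G b)"
    define B where "B = four_block_mat (rows_mat (n - 1) r) (0\<^sub>m (n - 1) 1) A3 A4"
    have A3: "A3 \<in> carrier_mat 1 (n - 1)" and A4: "A4 \<in> carrier_mat 1 1"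
      by (simp_all add: A3_def A4_def)
    have nn: "n = n - 1 + 1" by (simp add: n_def)
    have B: "B \<in> carrier_mat n n"
      unfolding B_def by (subst nn, subst (2) nn) (rule four_block_carrier_mat[OF rows_mat_carrier A4])
    have "rows_mat n t = B * rows_mat n c"
      unfolding mult_rows_mat[OF B]
    proof (rule rows_mat_cong)
      fix i assume i: "i < n"
      have split: "(\<Sum>j<n. smult (B $$ (i, j)) (c j)) =
         (\<Sum>j<n - 1. smult (B $$ (i, j)) (?l * monom 1 (n - 2 - j))) + smult (B $$ (i, n - 1)) 1"
        by (subst nn) (simp add: c_def)
      show "t i = (\<Sum>j<n. smult (B $$ (i, j)) (c j))"
      proof (cases "i < n - 1")
        case True
        have "r i = 0 \<or> degree (r i) < n - 1"
        proof -
          have "degree (r i) \<le> (if i < q then q - 1 - i + p else p + q - 1 - i + q)"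
            by (auto simp: r_def degree_monom_eq p_def q_def intro!: order.trans[OF degree_mult_le])
          then show ?thesis using True by (auto simp: n_def split: if_splits)
        qed
        then have ri: "(\<Sum>j<n-1. smult (coeff (r i) (n - 1 - 1 - j)) (monom 1 (n - 1 - 1 - j))) = r i"
          by (intro poly_eq_sum_smult_monom) auto
        have "(\<Sum>j<n. smult (B $$ (i, j)) (c j)) = 
          ?l * (\<Sum>j<n-1. smult (coeff (r i) (n - 1 - 1 - j)) (monom 1 (n - 1 - 1 - j)))"
          unfolding split sum_distrib_left using True
          by (auto simp: B_def rows_mat_def A4_def n_def intro!: sum.cong)
        then show ?thesis unfolding ri using True by (simp add: t_def)
      next
        case False
        then have i: "i = n - 1" using i by simp
        have "degree Q < n - 1 \<or> Q = 0"
        proof (cases "Q = 0")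
          case False
          have "degree (?l * Q) = Suc (degree Q)"
            using False by (subst degree_mult_eq) auto
          moreover have "?l * Q = G - [:poly G b:]" using Q by (simp add: eq_diff_eq)
          moreover have "degree (G - [:poly G b:]) \<le> q"
            by (rule degree_diff_le) (auto simp: q_def)
          ultimately show ?thesis by (simp add: n_def)
        qed auto
        then have ri: "(\<Sum>j<n-1. smult (coeff Q (n - 1 - 1 - j)) (monom 1 (n - 1 - 1 - j))) = Q"
          by (intro poly_eq_sum_smult_monom)
        have "(\<Sum>j<n. smult (B $$ (i, j)) (c j)) = 
          ?l * (\<Sum>j<n-1. smult (coeff Q (n - 1 - 1 - j)) (monom 1 (n - 1 - 1 - j))) + [:poly G b:]"
          unfolding split sum_distrib_left using i
          by (auto simp: B_def rows_mat_def A3_def A4_def n_def numeral_2_eq_2 intro!: sum.cong)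
        then show ?thesis unfolding ri Q[symmetric] using i by (simp add: t_def)
      qed
    qed
    moreover have "det B = det (rows_mat (n - 1) r) * poly G b"
      unfolding B_def
      by (subst det_four_block_mat_upper_right_zero_col[OF rows_mat_carrier _ A3 A4])
        (auto simp: A4_def det_single)
    moreover have "det (rows_mat n c) = 1"
    proof -
      have "det (rows_mat n c) = det (rows_mat n (\<lambda>i. monom 1 (n - 1 - i) :: 'a poly))"
      proof (rule det_rows_mat_upper_op[where u = "\<lambda>i j. if j = Suc i then -b else 0"])
        fix i assume i: "i < n"
        have "(\<Sum>j\<in>{i<..<n}. smult (if j = Suc i then -b else 0) (monom 1 (n - 1 - j))) =
          (\<Sum>j\<in>{i<..<n}. if j = Suc i then smult (-b) (monom 1 (n - 1 - j)) else 0)"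
          by (intro sum.cong) auto
        also have "\<dots> = (if Suc i < n then smult (-b) (monom 1 (n - 1 - Suc i)) else 0)"
          by (simp add: sum.delta)
        finally show "c i = monom 1 (n - 1 - i) +
           (\<Sum>j\<in>{i<..<n}. smult (if j = Suc i then -b else 0) (monom 1 (n - 1 - j)))"
          using i by (auto simp: c_def n_def numeral_2_eq_2 Suc_diff_Suc monom_Suc[symmetric]
             le_less_Suc_eq not_less simp flip: monom_Suc)
      qed
      also have "rows_mat n (\<lambda>i. monom 1 (n - 1 - i) :: 'a poly) = 1\<^sub>m n"
        by (intro eq_matI) (auto simp: rows_mat_def coeff_monom)
      finally show ?thesis by simp
    qed
    ultimately show ?thesis using det_mult[OF B rows_mat_carrier, of c] by simp
  qed
  also have "det (rows_mat (n - 1) r) = resultant P G"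
    unfolding resultant_def sylvester_mat_eq_rows_mat r_def[abs_def] n_def p_def q_def by simp
  finally show ?thesis .
qed

lemma resultant_prod_linear_factors:
  fixes G :: "'a::idom poly"
  shows "resultant (\<Prod>b\<in>#B. [:-b, 1:]) G = (\<Prod>b\<in>#B. poly G b)"
proof (induction B)
  case (add b B)
  have "(\<Prod>b\<in>#B. [:-b, 1:]) \<noteq> 0" by (auto simp: prod_mset_zero_iff)
  then show ?case
    using resultant_linear_factor_mult[of "\<Prod>b\<in>#B. [:-b, 1:]" b G] add.IH by simp
qed simp


text \<open>
  If \<open>F\<close> and \<open>G\<close> get a common factor \<open>D\<close> of degree \<open>d\<close> modulo \<open>t\<close>, say \<open>F = D E\<close> and \<open>G = D H\<close>
  modulo \<open>t\<close>, then \<open>E G - H F\<close> vanishes modulo \<open>t\<close>. Its first \<open>d\<close> monomial multiples can replace \<open>d\<close> of the rows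
  \<open>x^j G\<close> of the Sylvester matrix without changing the determinant, because \<open>E\<close> is monic, and a
  factor \<open>t\<close> comes out of each of them.
\<close>

lemma power_dvd_resultant:
  fixes F G E H Y :: "'a::idom poly"
  assumes E: "lead_coeff E = 1" "degree E + d = degree F"
    and H: "degree H + d \<le> degree G"
    and eq: "E * G - H * F = smult t Y"
  shows "t ^ d dvd resultant F G"
proof -
  define N M n where "N = degree F" and "M = degree G" and "n = N + M"
  define s where "s i = (if i < M then monom 1 (M - 1 - i) * F else monom 1 (n - 1 - i) * G)" for i
  define r where "r i = (if M \<le> i \<and> i < M + d then monom 1 (M + d - 1 - i) * E * G else s i)" for i
  define y where "y i = (if M \<le> i \<and> i < M + d then monom 1 (M + d - 1 - i) * (E * G - H * F) else s i)" for i
  define x where "x i = (if M \<le> i \<and> i < M + d then monom 1 (M + d - 1 - i) * Y else s i)" for i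
  have dN: "d \<le> N" using E by (simp add: N_def)
  have Esum: "monom 1 (M + d - 1 - i) * E = monom 1 (n - 1 - i) +
     (\<Sum>j\<in>{i<..<n}. smult (coeff (monom 1 (M + d - 1 - i) * E) (n - 1 - j)) (monom 1 (n - 1 - j)))"
    if i: "M \<le> i" "i < M + d" for i
  proof -
    let ?p = "monom 1 (M + d - 1 - i) * E"
    have E0: "E \<noteq> 0" using E by auto
    have k: "M + d - 1 - i + degree E = n - 1 - i" using i E by (simp add: n_def N_def)
    have in_: "i < n" using i dN by (simp add: n_def)
    have degp: "degree ?p = n - 1 - i"
      using E0 k by (subst degree_mult_eq) (auto simp: degree_monom_eq)
    have lc: "coeff ?p (n - 1 - i) = 1"
      unfolding k[symmetric] coeff_monom_mult using E(1) by simp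
    have "?p = (\<Sum>j<n. smult (coeff ?p (n - 1 - j)) (monom 1 (n - 1 - j)))"
      using degp in_ by (intro poly_eq_sum_smult_monom[symmetric]) auto
    also have "{..<n} = {..<i} \<union> {i} \<union> {i<..<n}" using in_ by auto
    also have "(\<Sum>j\<in>{..<i} \<union> {i} \<union> {i<..<n}. smult (coeff ?p (n - 1 - j)) (monom 1 (n - 1 - j))) =
      (\<Sum>j<i. smult (coeff ?p (n - 1 - j)) (monom 1 (n - 1 - j))) + monom 1 (n - 1 - i) +
      (\<Sum>j\<in>{i<..<n}. smult (coeff ?p (n - 1 - j)) (monom 1 (n - 1 - j)))"
      using lc by (subst sum.union_disjoint, simp, simp, force, subst sum.union_disjoint) auto
    also have "(\<Sum>j<i. smult (coeff ?p (n - 1 - j)) (monom 1 (n - 1 - j))) = 0"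
      using degp in_ by (intro sum.neutral) (auto simp: coeff_eq_0)
    finally show ?thesis by simp
  qed
  have Hsum: "monom 1 (M + d - 1 - i) * H =
     (\<Sum>j<M. smult (coeff (monom 1 (M + d - 1 - i) * H) (M - 1 - j)) (monom 1 (M - 1 - j)))"
    if i: "M \<le> i" "i < M + d" for i
  proof -
    let ?p = "monom 1 (M + d - 1 - i) * H"
    have "degree ?p \<le> M + d - 1 - i + degree H"
      by (rule order.trans[OF degree_mult_le]) (simp add: degree_monom_le)
    then have "degree ?p < M" using i H by (simp add: M_def)
    then show ?thesis by (intro poly_eq_sum_smult_monom[symmetric]) auto
  qed
  \<comment> \<open>the passage from \<open>s\<close> to \<open>r\<close> uses that \<open>E\<close> is monic, that from \<open>r\<close> to \<open>y\<close> subtracts multiples of the rows of \<open>F\<close>\<close>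
  have "resultant F G = det (rows_mat n s)"
    unfolding resultant_def sylvester_mat_eq_rows_mat s_def[abs_def] n_def N_def M_def ..
  also have "\<dots> = det (rows_mat n r)"
  proof (rule det_rows_mat_upper_op[symmetric, where
      u = "\<lambda>i j. if M \<le> i \<and> i < M + d then coeff (monom 1 (M + d - 1 - i) * E) (n - 1 - j) else 0"])
    fix i assume i: "i < n"
    show "r i = s i + (\<Sum>j\<in>{i<..<n}. smult (if M \<le> i \<and> i < M + d 
       then coeff (monom 1 (M + d - 1 - i) * E) (n - 1 - j) else 0) (s j))"
    proof (cases "M \<le> i \<and> i < M + d")
      case True
      have "r i = (monom 1 (M + d - 1 - i) * E) * G" using True by (simp add: r_def)
      also have "\<dots> = s i + (\<Sum>j\<in>{i<..<n}. smult (coeff (monom 1 (M + d - 1 - i) * E) (n - 1 - j)) (s j))"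
        using True
        by (subst Esum) (auto simp: s_def distrib_right sum_distrib_right intro!: sum.cong)
      finally show ?thesis using True by simp
    qed (auto simp: r_def)
  qed
  also have "\<dots> = det (rows_mat n y)"
  proof (rule det_rows_mat_lower_op[symmetric, where
      u = "\<lambda>i j. if M \<le> i \<and> i < M + d \<and> j < M then - coeff (monom 1 (M + d - 1 - i) * H) (M - 1 - j) else 0"])
    fix i assume i: "i < n"
    show "y i = r i + (\<Sum>j<i. smult (if M \<le> i \<and> i < M + d \<and> j < M 
       then - coeff (monom 1 (M + d - 1 - i) * H) (M - 1 - j) else 0) (r j))"
    proof (cases "M \<le> i \<and> i < M + d")
      case True
      have "y i = r i - (monom 1 (M + d - 1 - i) * H) * F"
        using True by (simp add: y_def r_def algebra_simps)
      also have "(monom 1 (M + d - 1 - i) * H) * F =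
         (\<Sum>j<M. smult (coeff (monom 1 (M + d - 1 - i) * H) (M - 1 - j)) (r j))"
        using True by (subst Hsum) (auto simp: s_def r_def sum_distrib_right intro!: sum.cong)
      also have "r i - \<dots> = r i + (\<Sum>j<M. smult (- coeff (monom 1 (M + d - 1 - i) * H) (M - 1 - j)) (r j))"
        by (simp add: sum_negf)
      also have "(\<Sum>j<M. smult (- coeff (monom 1 (M + d - 1 - i) * H) (M - 1 - j)) (r j)) =
         (\<Sum>j<i. smult (if M \<le> i \<and> i < M + d \<and> j < M 
       then - coeff (monom 1 (M + d - 1 - i) * H) (M - 1 - j) else 0) (r j))"
        using True by (intro sum.mono_neutral_cong_left) auto
      finally show ?thesis .
    qed (auto simp: r_def y_def)
  qed
  also have "rows_mat n y = rows_mat n (\<lambda>i. smult (if M \<le> i \<and> i < M + d then t else 1) (x i))"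
    by (rule rows_mat_cong) (simp add: y_def x_def eq)
  also have "det \<dots> = (\<Prod>i<n. if M \<le> i \<and> i < M + d then t else 1) * det (rows_mat n x)"
    by (rule det_rows_mat_smult)
  also have "(\<Prod>i<n. if M \<le> i \<and> i < M + d then t else 1) = (\<Prod>i\<in>{M..<M+d}. t)"
    using dN by (intro prod.mono_neutral_cong_right) (auto simp: n_def)
  also have "\<dots> = t ^ d" by simp
  finally show ?thesis by simp
qed

section \<open>Descent of monic roots and cofactors\<close>

lemma coeff_mult_bounded_degrees:
  fixes p q :: "'a::comm_ring_1 poly"
  assumes "degree p \<le> a" "degree q \<le> b"
  shows "coeff (p * q) (a + b) = coeff p a * coeff q b"
proof -
  have "coeff (p * q) (a + b) = (\<Sum>i\<le>a + b. coeff p i * coeff q (a + b - i))"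
    by (rule coeff_mult)
  also have "\<dots> = (\<Sum>i\<in>{a}. coeff p i * coeff q (a + b - i))"
  proof (rule sum.mono_neutral_right)
    show "\<forall>i\<in>{..a + b} - {a}. coeff p i * coeff q (a + b - i) = 0"
    proof
      fix i assume "i \<in> {..a + b} - {a}"
      then show "coeff p i * coeff q (a + b - i) = 0"
        using assms by (cases "i < a") (auto simp: coeff_eq_0)
    qed
  qed auto
  finally show ?thesis by simp
qed

text \<open>
  The cofactor in \<open>p ^ n - q ^ n = (p - q) * (\<Sum>i<n. q ^ (n - Suc i) * p ^ i)\<close> is a sum of \<open>n\<close> monic
  polynomials of the same degree; in characteristic \<open>0\<close> its top coefficient therefore survives.
\<close>

lemma monic_power_cofactor:
  fixes p q :: "'a::idom poly"
  assumes "lead_coeff p = 1" "lead_coeff q = 1" "degree p = degree q"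
  shows "degree (\<Sum>i<n. q ^ (n - Suc i) * p ^ i) \<le> degree q * (n - 1)"
    and "coeff (\<Sum>i<n. q ^ (n - Suc i) * p ^ i) (degree q * (n - 1)) = of_nat n"
proof -
  have *: "degree (q ^ (n - Suc i) * p ^ i) = degree q * (n - 1)"
    "coeff (q ^ (n - Suc i) * p ^ i) (degree q * (n - 1)) = 1" if "i < n" for i
  proof -
    have m: "lead_coeff (q ^ (n - Suc i) * p ^ i) = 1"
      using assms by (simp add: lead_coeff_mult lead_coeff_power)
    have [simp]: "p \<noteq> 0" "q \<noteq> 0" using assms by auto
    have "n - 1 = (n - Suc i) + i" using that by simp
    then show d: "degree (q ^ (n - Suc i) * p ^ i) = degree q * (n - 1)"
      using assms(3) by (simp add: degree_mult_eq degree_power_eq algebra_simps)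
    show "coeff (q ^ (n - Suc i) * p ^ i) (degree q * (n - 1)) = 1" using m d by simp
  qed
  show "degree (\<Sum>i<n. q ^ (n - Suc i) * p ^ i) \<le> degree q * (n - 1)"
    by (intro degree_sum_le) (auto simp: *)
  show "coeff (\<Sum>i<n. q ^ (n - Suc i) * p ^ i) (degree q * (n - 1)) = of_nat n"
    unfolding coeff_sum by (subst sum.cong[OF refl *(2)]) simp_all
qed

lemma monic_power_eq_imp_eq:
  fixes p q :: "'a::idom poly"
  assumes "p ^ n = q ^ n" "of_nat n \<noteq> (0::'a)" "lead_coeff p = 1" "lead_coeff q = 1"
  shows "p = q"
proof -
  have n: "n > 0" using assms(2) by (cases n) auto
  have "n * degree p = n * degree q"
    using arg_cong[OF assms(1), of degree] assms(3,4)
    by (simp add: degree_power_eq leading_coeff_0_iff[symmetric] del: leading_coeff_0_iff)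
  then have d: "degree p = degree q" using n by simp
  have "(p - q) * (\<Sum>i<n. q ^ (n - Suc i) * p ^ i) = 0"
    using power_diff_sumr2[of p n q] assms(1) by simp
  moreover have "(\<Sum>i<n. q ^ (n - Suc i) * p ^ i) \<noteq> 0"
    using monic_power_cofactor(2)[OF assms(3,4) d, of n] assms(2) by (auto simp: coeff_0)
  ultimately show ?thesis by simp
qed

text \<open>
  The coefficients of a monic \<open>n\<close>-th root are determined from the top downwards: if \<open>A\<close> collects the
  terms of \<open>P\<close> above the exponent \<open>j\<close>, then the coefficient of \<open>P ^ n - A ^ n\<close> at
  \<open>j + degree P * (n - 1)\<close> is \<open>n\<close> times the coefficient of \<open>P\<close> at \<open>j\<close>. So every coefficient lies in the
  smaller field, by induction.
\<close>

lemma (in field_hom) monic_root_descends: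
  fixes P :: "'b poly"
  assumes P: "lead_coeff P = 1" and pow: "P ^ n = map_poly hom N" and n: "of_nat n \<noteq> (0::'b)"
  shows "\<exists>Q. P = map_poly hom Q"
proof -
  interpret map_poly_hom: map_poly_comm_ring_hom hom ..
  define D where "D = degree P"
  have rng: "coeff P j \<in> range hom" for j
  proof (induction "D - j" arbitrary: j rule: less_induct)
    case less
    consider "j > D" | "j = D" | "j < D" by linarith
    then show ?case
    proof cases
      case 1
      then show ?thesis by (auto simp: D_def coeff_eq_0 intro: range_eqI[of _ _ 0])
    next
      case 2
      then show ?thesis using P by (auto simp: D_def intro: range_eqI[of _ _ 1])
    next
      case 3
      define A where "A = (\<Sum>i\<in>{j<..D}. monom (coeff P i) i)"
      have cA: "coeff A i = (if j < i \<and> i \<le> D then coeff P i else 0)" for i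
        by (simp add: A_def coeff_sum coeff_monom sum.delta' cong: if_cong)
      have dA: "degree A = D"
      proof (rule antisym)
        show "degree A \<le> D" by (rule degree_le) (simp add: cA)
        show "D \<le> degree A" using 3 P by (intro le_degree) (simp add: cA D_def)
      qed
      have lA: "lead_coeff A = 1" using 3 P by (simp add: dA cA D_def)
      have "\<forall>i\<in>{j<..D}. \<exists>a. coeff P i = hom a" using less 3 by (auto simp: image_iff)
      then obtain a where a: "\<And>i. i \<in> {j<..D} \<Longrightarrow> coeff P i = hom (a i)" by metis
      define A' where "A' = (\<Sum>i\<in>{j<..D}. monom (a i) i)"
      have A': "A = map_poly hom A'"
        by (simp add: A_def A'_def a hom_distribs)
      define S where "S = (\<Sum>i<n. A ^ (n - Suc i) * P ^ i)"
      have S: "degree S \<le> D * (n - 1)" "coeff S (D * (n - 1)) = of_nat n"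
        using monic_power_cofactor[OF P lA, of n] by (simp_all add: S_def dA D_def)
      have "degree (P - A) \<le> j"
        by (rule degree_le) (auto simp: cA D_def coeff_eq_0)
      then have "coeff ((P - A) * S) (j + D * (n - 1)) = coeff (P - A) j * of_nat n"
        using S by (simp add: coeff_mult_bounded_degrees)
      then have "coeff P j * of_nat n = coeff (P ^ n - A ^ n) (j + D * (n - 1))"
        by (simp add: power_diff_sumr2 S_def cA)
      also have "\<dots> = hom (coeff (N - A' ^ n) (j + D * (n - 1)))"
        unfolding pow A' by (simp add: hom_distribs flip: map_poly_hom.hom_power)
      finally have "coeff P j = hom (coeff (N - A' ^ n) (j + D * (n - 1)) / of_nat n)"
        using n by (simp add: hom_distribs field_simps)
      then show ?thesis by blast
    qed
  qed
  then have "\<forall>j. \<exists>b. coeff P j = hom b" by (auto simp: image_iff)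
  then obtain b where b: "\<And>j. coeff P j = hom (b j)" by metis
  have "P = map_poly hom (\<Sum>i\<le>D. monom (b i) i)"
    unfolding D_def by (subst poly_as_sum_of_monoms[of P, symmetric]) (simp add: b hom_distribs)
  then show ?thesis by blast
qed

text \<open>
  Gauss: write \<open>P = c p\<close> with \<open>p\<close> primitive. Comparing contents in \<open>N = c ^ n p ^ n\<close> shows that the leading
  coefficient of \<open>p\<close>, which is the inverse of \<open>c\<close>, is a unit.
\<close>

lemma monic_root_of_fract_poly:
  fixes P :: "'a::{factorial_ring_gcd, semiring_gcd_mult_normalize} fract poly"
  assumes P: "lead_coeff P = 1" and N: "lead_coeff N = 1" and pow: "P ^ n = map_poly to_fract N"
    and n: "n > 0"
  shows "\<exists>Q. P = map_poly to_fract Q"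
proof -
  obtain c p where c: "P = smult c (map_poly to_fract p)" "content p = 1"
    by (rule content_decompose_fract)
  have powp: "(map_poly to_fract p) ^ n = map_poly to_fract (p ^ n)" 
    by (induction n) simp_all
  have "map_poly to_fract N = smult (c ^ n) (map_poly to_fract (p ^ n))"
    unfolding pow[symmetric] c(1) by (simp add: smult_power powp)
  then obtain a b where ab: "c ^ n = to_fract b / to_fract a" "smult a N = smult b (p ^ n)" "coprime a b"
    by (rule fract_poly_smult_eqE)
  have cN: "content N = 1"
    using content_dvd_coeff[of N "degree N"] N is_unit_normalize[of "content N"] by simp
  have cp: "content (p ^ n) = 1" using c(2) by (induction n) (simp_all add: content_mult)
  have nab: "normalize a = normalize b" using arg_cong[OF ab(2), of content] cN cp by simp
  define l where "l = lead_coeff p"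
  have abl: "a = b * l ^ n"
    using arg_cong[OF ab(2), of lead_coeff] N unfolding lead_coeff_smult lead_coeff_power l_def by simp
  have one: "1 = c * to_fract l" 
    using P unfolding c(1) lead_coeff_smult l_def by (simp add: to_fract_hom.degree_map_poly_hom)
  have "is_unit b" "is_unit a"

    using nab ab(3) by (auto simp: associated_iff_dvd coprime_absorb_left coprime_absorb_right)
  then have "is_unit (l ^ n)" using abl by simp
  then have "is_unit l" using n by (simp add: is_unit_power_iff)
  then obtain u where "1 = l * u" by (rule dvdE)
  then have lu: "to_fract l * to_fract u = 1" by (simp flip: to_fract_mult)
  have "c = c * (to_fract l * to_fract u)" using lu by simp
  also have "\<dots> = to_fract u" using one by (simp flip: mult.assoc)
  finally have "c = to_fract u" .
  then have "P = map_poly to_fract (smult u p)" using c(1) by simp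
  then show ?thesis by blast
qed

text \<open>
  Division by the monic \<open>q\<close> is possible over the smaller ring, and its result is unique over the larger
  one.
\<close>

lemma (in inj_idom_hom) monic_cofactor_descends:
  assumes q: "lead_coeff q = 1" and eq: "map_poly hom p = map_poly hom q * r"
  shows "\<exists>s. r = map_poly hom s"
proof -
  interpret map_poly_hom: map_poly_inj_idom_hom hom ..
  obtain s t where st: "pseudo_divmod p q = (s, t)" by (cases "pseudo_divmod p q")
  have q0: "q \<noteq> 0" using q by auto
  have p: "p = q * s + t" and t: "t = 0 \<or> degree t < degree q"
    using pseudo_divmod[OF q0 st] q by auto
  have *: "map_poly hom q * (r - map_poly hom s) = map_poly hom t"
    using eq unfolding p by (simp add: hom_distribs algebra_simps)
  have "r - map_poly hom s = 0"
  proof (rule ccontr)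
    assume ne: "r - map_poly hom s \<noteq> 0"
    then have "degree (map_poly hom t) = degree q + degree (r - map_poly hom s)"
      unfolding *[symmetric] using q0 by (subst degree_mult_eq) auto
    with t ne * q0 show False by auto
  qed
  then show ?thesis by auto
qed

interpretation to_Qc: inj_idom_hom to_Qc_closure
  by unfold_locales (auto simp: to_Qc_closure_def)

interpretation to_ac_hom: field_hom "to_ac :: 'a::field \<Rightarrow> 'a alg_closure"
  by unfold_locales auto

lemma monic_root_in_Qc_closure_descends:
  fixes P :: "Qc_closure poly"
  assumes P: "lead_coeff P = 1" and N: "lead_coeff N = 1"
    and pow: "P ^ n = map_poly to_Qc_closure N" and n: "n > 0"
  shows "\<exists>Q. lead_coeff Q = 1 \<and> P = map_poly to_Qc_closure Q"
proof -
  have comp: "map_poly to_Qc_closure M = map_poly to_ac (map_poly to_fract M)" for M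
    by (rule poly_eqI) (simp add: coeff_map_poly to_Qc_closure_def)
  have "to_Qc_closure (of_nat n) \<noteq> 0" using n by (subst to_Qc.hom_0_iff) simp
  then have "of_nat n \<noteq> (0 :: Qc_closure)" by (simp add: to_Qc.hom_of_nat)
  then obtain Q1 where Q1: "P = map_poly to_ac Q1"
    using to_ac_hom.monic_root_descends[OF P pow[unfolded comp]] by blast
  have l1: "lead_coeff Q1 = 1" using P unfolding Q1 by (simp add: to_ac_hom.hom_1_iff)
  interpret mh: map_poly_inj_idom_hom "to_ac :: int poly fract \<Rightarrow> _" ..
  have "Q1 ^ n = map_poly to_fract N"
    using pow unfolding comp Q1 by (simp flip: mh.hom_power)
  then obtain Q where Q: "Q1 = map_poly to_fract Q"
    using monic_root_of_fract_poly[OF l1 N _ n] by blast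
  have "lead_coeff Q = 1" using P unfolding Q1 Q comp[symmetric] by (simp add: to_Qc.hom_1_iff)
  then show ?thesis using Q Q1 comp by auto
qed

section \<open>Moebius inversion\<close>

lemma moebius_prime_mult:
  assumes p: "prime p" and d: "squarefree d" "\<not> p dvd d"
  shows "moebius (p * d) = - moebius d"
proof -
  have d0: "d \<noteq> 0" using d(2) by (intro notI) auto
  have cop: "coprime p d" using p d(2) by (simp add: prime_imp_coprime)
  have sf: "squarefree (p * d)"
    by (rule squarefree_mult_coprime[OF cop _ d(1)]) (use p in \<open>auto intro: squarefree_prime\<close>)
  have pf: "prime_factors (p * d) = insert p (prime_factors d)"
    using p d0 by (subst prime_factors_product) (auto simp: prime_factorization_prime)
  have "p \<notin> prime_factors d" using d(2) by auto
  then show ?thesis using sf d(1) by (simp add: moebius_def pf)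
qed

text \<open>
  Only squarefree divisors count. Those divisible by a fixed prime factor \<open>p\<close> of \<open>n\<close> are the products of \<open>p\<close>
  with the others, and the two groups cancel.
\<close>

lemma sum_moebius_divisors:
  assumes "n > 0"
  shows "(\<Sum>d | d dvd n. moebius d) = (if n = 1 then 1 else 0)"
proof (cases "n = 1")
  case True
  then show ?thesis by (simp add: moebius_def)
next
  case False
  then obtain p where p: "prime p" "p dvd n" using prime_factor_nat by blast
  define S where "S = {d. d dvd n \<and> squarefree d \<and> \<not> p dvd d}"
  have fin: "finite {d. d dvd n}" using assms by simp
  have finS: "finite S" by (rule finite_subset[OF _ fin]) (auto simp: S_def)
  have img: "(*) p ` S = {d. d dvd n \<and> squarefree d \<and> p dvd d}"
  proof (intro equalityI subsetI)
    fix x assume "x \<in> (*) p ` S"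
    then obtain d where d: "d dvd n" "squarefree d" "\<not> p dvd d" "x = p * d" by (auto simp: S_def)
    have cop: "coprime p d" using p d(3) by (simp add: prime_imp_coprime)
    moreover have "squarefree p" using p by (auto intro: squarefree_prime)
    ultimately show "x \<in> {d. d dvd n \<and> squarefree d \<and> p dvd d}"
      using p d by (auto intro!: divides_mult squarefree_mult_coprime)
  next
    fix x assume "x \<in> {d. d dvd n \<and> squarefree d \<and> p dvd d}"
    then have x: "x dvd n" "squarefree x" "p dvd x" by auto
    then obtain d where d: "x = p * d" by (elim dvdE)
    have "\<not> p dvd d"
    proof
      assume "p dvd d"
      then have "p ^ 2 dvd x" unfolding d by (simp add: power2_eq_square)
      with x(2) p(1) show False by (metis squarefree_def not_prime_unit)
    qed
    then show "x \<in> (*) p ` S"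
      using x p squarefree_multD(2)[of p d] unfolding d S_def
      by (intro imageI) (auto dest: dvd_mult_right)
  qed
  have "(\<Sum>d | d dvd n. moebius d) = (\<Sum>d\<in>S \<union> (*) p ` S. moebius d)"
    unfolding img using fin by (intro sum.mono_neutral_right) (auto simp: S_def moebius_def)
  also have "\<dots> = (\<Sum>d\<in>S. moebius d) + (\<Sum>d\<in>(*) p ` S. moebius d)"
    using finS by (intro sum.union_disjoint) (auto simp: S_def)
  also have "(\<Sum>d\<in>(*) p ` S. moebius d) = (\<Sum>d\<in>S. moebius (p * d))"
    using p(1) by (subst sum.reindex) (auto simp: inj_on_def prime_gt_0_nat)
  also have "\<dots> = (\<Sum>d\<in>S. - moebius d)"
    using p by (intro sum.cong) (auto simp: S_def moebius_prime_mult)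
  finally show ?thesis using False by (simp add: sum_negf)
qed

lemma prod_power_int_sum:
  fixes x :: "'a::field"
  assumes "x \<noteq> 0"
  shows "(\<Prod>i\<in>A. x powi f i) = x powi (\<Sum>i\<in>A. f i)"
  using assms by (induction A rule: infinite_finite_induct) (auto simp: power_int_add)

lemma power_int_prod:
  fixes f :: "'b \<Rightarrow> 'a::field"
  shows "(\<Prod>i\<in>A. f i) powi k = (\<Prod>i\<in>A. f i powi k)"
  by (induction A rule: infinite_finite_induct) (auto simp: power_int_mult_distrib)

lemma moebius_inversion_prod:
  fixes F \<Phi> :: "nat \<Rightarrow> 'a::field"
  assumes n: "n > 0" and F: "\<And>k. k dvd n \<Longrightarrow> F k = (\<Prod>d | d dvd k. \<Phi> d)"
    and nz: "\<And>d. d dvd n \<Longrightarrow> \<Phi> d \<noteq> 0"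
  shows "(\<Prod>k | k dvd n. F k powi moebius (n div k)) = \<Phi> n"
proof -
  have fin: "finite {d. d dvd n}" using n by simp
  have "(\<Prod>k | k dvd n. F k powi moebius (n div k)) =
     (\<Prod>k | k dvd n. \<Prod>d | d dvd n. if d dvd k then \<Phi> d powi moebius (n div k) else 1)"
  proof (rule prod.cong[OF refl])
    fix k assume k: "k \<in> {k. k dvd n}"
    have "F k powi moebius (n div k) = (\<Prod>d | d dvd k. \<Phi> d powi moebius (n div k))"
      using k by (simp add: F power_int_prod)
    also have "{d. d dvd k} = {d \<in> {d. d dvd n}. d dvd k}" using k by (auto intro: dvd_trans)
    also have "(\<Prod>d\<in>\<dots>. \<Phi> d powi moebius (n div k)) =
       (\<Prod>d | d dvd n. if d dvd k then \<Phi> d powi moebius (n div k) else 1)"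
      using fin by (subst prod.inter_filter) auto
    finally show "F k powi moebius (n div k) = \<dots>" .
  qed
  also have "\<dots> = (\<Prod>d | d dvd n. \<Prod>k | k dvd n. if d dvd k then \<Phi> d powi moebius (n div k) else 1)"
    by (rule prod.swap)
  also have "\<dots> = (\<Prod>d | d dvd n. if d = n then \<Phi> d else 1)"
  proof (rule prod.cong[OF refl])
    fix d assume d: "d \<in> {d. d dvd n}"
    then obtain e where e: "n = d * e" by (auto elim: dvdE)
    have d0: "d > 0" "e > 0" using n e by auto
    have "(\<Prod>k | k dvd n. if d dvd k then \<Phi> d powi moebius (n div k) else 1) =
       (\<Prod>k\<in>{k. k dvd n \<and> d dvd k}. \<Phi> d powi moebius (n div k))"
      using fin by (subst prod.inter_filter[symmetric]) (auto intro!: prod.cong)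
    also have "\<dots> = \<Phi> d powi (\<Sum>k\<in>{k. k dvd n \<and> d dvd k}. moebius (n div k))"
      using d nz by (intro prod_power_int_sum) auto
    also have "(\<Sum>k\<in>{k. k dvd n \<and> d dvd k}. moebius (n div k)) = (\<Sum>j | j dvd e. moebius j)"
      by (rule sum.reindex_bij_witness[of _ "\<lambda>j. n div j" "\<lambda>k. n div k"])
        (use d0 in \<open>auto simp: e elim!: dvdE\<close>)
    also have "\<dots> = (if e = 1 then 1 else 0)" using d0(2) by (rule sum_moebius_divisors)
    also have "e = 1 \<longleftrightarrow> d = n" using d0 e by auto
    finally show "(\<Prod>k | k dvd n. if d dvd k then \<Phi> d powi moebius (n div k) else 1) =
      (if d = n then \<Phi> d else 1)" by simp
  qed
  also have "\<dots> = \<Phi> n" using fin by (simp add: prod.delta)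
  finally show ?thesis .
qed

section \<open>Iterates of the quadratic map\<close>

definition quad :: "'a::comm_ring_1 \<Rightarrow> 'a \<Rightarrow> 'a" where
  "quad c z = z ^ 2 + c"

lemma quad_iter_0 [simp]: "quad_iter c 0 = [:0, 1:]"
  by (simp add: quad_iter_def)

lemma quad_iter_Suc: "quad_iter c (Suc n) = (quad_iter c n) ^ 2 + [:c:]"
  by (simp add: quad_iter_def pcompose_pCons power2_eq_square algebra_simps)

lemma poly_quad_iter: "poly (quad_iter c n) a = (quad c ^^ n) a"
  by (induction n) (simp_all add: quad_iter_Suc quad_def)

lemma degree_quad_iter: "degree (quad_iter (c::'a::idom) n) = 2 ^ n"
  and lead_coeff_quad_iter: "lead_coeff (quad_iter (c::'a::idom) n) = 1"
proof -
  have "degree (quad_iter c n) = 2 ^ n \<and> lead_coeff (quad_iter c n) = 1"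
  proof (induction n)
    case (Suc n)
    have ne: "quad_iter c n \<noteq> 0" using Suc by auto
    have d: "degree ((quad_iter c n) ^ 2) = 2 * 2 ^ n" using Suc ne by (simp add: degree_power_eq)
    have dd: "degree ((quad_iter c n) ^ 2 + [:c:]) = 2 * 2 ^ n"
      unfolding d[symmetric] by (rule degree_add_eq_left) (simp add: d)
    have "lead_coeff ((quad_iter c n) ^ 2) = 1" 
      using conjunct2[OF Suc] unfolding lead_coeff_power by (simp only: power_one)
    then show ?case using d dd by (simp add: quad_iter_Suc coeff_eq_0 coeff_pCons split: nat.split)
  qed simp
  then show "degree (quad_iter c n) = 2 ^ n" "lead_coeff (quad_iter c n) = 1" by auto
qed

lemma (in comm_ring_hom) map_poly_quad_iter: "map_poly hom (quad_iter c n) = quad_iter (hom c) n"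
proof -
  interpret mh: map_poly_comm_ring_hom hom ..
  show ?thesis by (induction n) (simp_all add: quad_iter_Suc hom_distribs)
qed

lemma quad_iter_zero_param: "quad_iter (0::'a::comm_ring_1) n = monom 1 (2 ^ n)"
proof (induction n)
  case 0
  show ?case by (simp only: quad_iter_0 x_as_monom power_0)
next
  case (Suc n)
  then show ?case by (simp add: quad_iter_Suc monom_power mult.commute)
qed

lemma pderiv_quad_iter_Suc:
  "pderiv (quad_iter (c::'a::idom) (Suc n)) = smult 2 (quad_iter c n) * pderiv (quad_iter c n)"
proof -
  have "smult 2 p = p + p" for p :: "'a poly"
    using smult_add_left[of 1 1 p] by simp
  then show ?thesis
    by (simp add: quad_iter_Suc pderiv_add power2_eq_square pderiv_mult pderiv_pCons distrib_right)
qed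

lemma degree_pderiv_quad_iter:
  fixes c :: "'a::idom"
  assumes "(2::'a) \<noteq> 0"
  shows "degree (pderiv (quad_iter c n)) = 2 ^ n - 1"
    and "lead_coeff (pderiv (quad_iter c n)) = 2 ^ n"
proof -
  have "degree (pderiv (quad_iter c n)) = 2 ^ n - 1 \<and> lead_coeff (pderiv (quad_iter c n)) = 2 ^ n"
  proof (induction n)
    case 0
    show ?case by (simp add: pderiv_pCons)
  next
    case (Suc n)
    have "pderiv (quad_iter c n) \<noteq> 0" using Suc assms by auto
    moreover have "quad_iter c n \<noteq> 0" using lead_coeff_quad_iter[of c n] by auto
    ultimately have "degree (pderiv (quad_iter c (Suc n))) = 2 ^ n + (2 ^ n - 1)"
      using assms Suc unfolding pderiv_quad_iter_Suc
      by (subst degree_mult_eq) (auto simp: degree_quad_iter)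
    moreover have "lead_coeff (pderiv (quad_iter c (Suc n))) = 2 ^ Suc n"
      using conjunct2[OF Suc]
      unfolding pderiv_quad_iter_Suc lead_coeff_mult lead_coeff_smult lead_coeff_quad_iter
      by (simp only: mult.right_neutral power_Suc)
    ultimately show ?case by simp
  qed
  then show "degree (pderiv (quad_iter c n)) = 2 ^ n - 1" "lead_coeff (pderiv (quad_iter c n)) = 2 ^ n"
    by auto
qed

lemma multiplier_zero_param: "multiplier (0::'a::idom) n a = 2 ^ n * a ^ (2 ^ n - 1)"
  by (simp add: multiplier_def quad_iter_zero_param pderiv_monom poly_monom)

lemma multiplier_eq_prod:
  "multiplier (c::'a::idom) n \<alpha> = 2 ^ n * (\<Prod>i<n. (quad c ^^ i) \<alpha>)"
proof (induction n)
  case (Suc n)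
  have "multiplier c (Suc n) \<alpha> = 2 * (quad c ^^ n) \<alpha> * multiplier c n \<alpha>"
    by (simp add: multiplier_def pderiv_quad_iter_Suc poly_quad_iter)
  then show ?case using Suc by simp
qed (simp add: multiplier_def pderiv_pCons)

lemma multiplier_add:
  "multiplier (c::'a::idom) (m + n) \<alpha> = multiplier c m ((quad c ^^ n) \<alpha>) * multiplier c n \<alpha>"
proof (induction m)
  case (Suc m)
  have "multiplier c (Suc k) x = 2 * (quad c ^^ k) x * multiplier c k x" for k x
    by (simp add: multiplier_eq_prod)
  then show ?case using Suc by (simp add: funpow_add)
qed (simp add: multiplier_eq_prod)

lemma multiplier_mult:
  assumes "(quad c ^^ k) \<alpha> = (\<alpha>::'a::idom)"
  shows "multiplier c (k * r) \<alpha> = multiplier c k \<alpha> ^ r"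
proof (induction r)
  case (Suc r)
  have "multiplier c (k * Suc r) \<alpha> = multiplier c (k * r + k) \<alpha>" by (simp add: add.commute)
  then show ?case using Suc assms by (simp add: multiplier_add mult.commute)
qed (simp add: multiplier_eq_prod)

lemma multiplier_shift:
  assumes "(quad c ^^ n) \<alpha> = (\<alpha>::'a::idom)"
  shows "multiplier c n (quad c \<alpha>) = multiplier c n \<alpha>"
proof (cases n)
  case (Suc m)
  have "(\<Prod>i<n. (quad c ^^ i) (quad c \<alpha>)) = (\<Prod>i<n. (quad c ^^ Suc i) \<alpha>)"
    by (simp add: funpow_swap1)
  also have "\<dots> = (\<Prod>i<n. (quad c ^^ i) \<alpha>)"
  proof -
    have "(\<Prod>i<n. (quad c ^^ Suc i) \<alpha>) = (\<Prod>i<m. (quad c ^^ Suc i) \<alpha>) * \<alpha>"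
      using assms unfolding Suc by simp
    also have "\<dots> = (\<Prod>i<Suc m. (quad c ^^ i) \<alpha>)"
      by (subst prod.lessThan_Suc_shift) simp
    finally show ?thesis unfolding Suc .
  qed
  finally show ?thesis by (simp add: multiplier_eq_prod)
qed (simp add: multiplier_eq_prod)

section \<open>Periods\<close>

definition exact_points :: "('a \<Rightarrow> 'a) \<Rightarrow> nat \<Rightarrow> 'a set" where
  "exact_points f n = {x. (f ^^ n) x = x \<and> (\<forall>k. 0 < k \<and> k < n \<longrightarrow> (f ^^ k) x \<noteq> x)}"

lemma funpow_mult_fixed: "(f ^^ d) x = x \<Longrightarrow> (f ^^ (d * q)) x = x"
  by (induction q) (simp_all add: funpow_add)

lemma funpow_dvd_fixed: "(f ^^ d) x = x \<Longrightarrow> d dvd n \<Longrightarrow> (f ^^ n) x = x"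
  by (auto elim!: dvdE simp: funpow_mult_fixed)

lemma exact_period_dvd:
  assumes x: "x \<in> exact_points f d" and d: "d > 0" and n: "(f ^^ n) x = x"
  shows "d dvd n"
proof -
  have "(f ^^ n) x = (f ^^ (n mod d + d * (n div d))) x" by simp
  also have "\<dots> = (f ^^ (n mod d)) x"
    using x by (subst funpow_add) (simp add: funpow_mult_fixed exact_points_def)
  finally have "(f ^^ (n mod d)) x = x" using n by simp
  then have "n mod d = 0" using x d by (auto simp: exact_points_def)
  then show ?thesis by auto
qed

lemma ex_exact_period:
  assumes n: "n > 0" "(f ^^ n) x = x"
  obtains d where "d > 0" "d dvd n" "x \<in> exact_points f d"
proof -
  define d where "d = (LEAST d. d > 0 \<and> (f ^^ d) x = x)"
  have d: "d > 0" "(f ^^ d) x = x"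
    using LeastI[of "\<lambda>d. d > 0 \<and> (f ^^ d) x = x" n] n by (auto simp: d_def)
  moreover have "x \<in> exact_points f d"
    using d not_less_Least[of _ "\<lambda>d. d > 0 \<and> (f ^^ d) x = x"] by (auto simp: exact_points_def d_def)
  moreover have "d dvd n" using exact_period_dvd[OF \<open>x \<in> exact_points f d\<close> d(1) n(2)] .
  ultimately show ?thesis using that by blast
qed

lemma exact_period_unique:
  assumes "x \<in> exact_points f d" "x \<in> exact_points f e" "d > 0" "e > 0"
  shows "d = e"
  using assms exact_period_dvd[of x f d e] exact_period_dvd[of x f e d]
  by (auto simp: exact_points_def intro: dvd_antisym)

lemma fixed_points_eq_Union:
  assumes "n > 0"
  shows "{x. (f ^^ n) x = x} = (\<Union>d\<in>{d. d dvd n}. exact_points f d)"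
proof (intro equalityI subsetI)
  fix x assume "x \<in> {x. (f ^^ n) x = x}"
  then show "x \<in> (\<Union>d\<in>{d. d dvd n}. exact_points f d)"
    using ex_exact_period[of n f x] assms by auto
qed (auto simp: exact_points_def intro: funpow_dvd_fixed)

lemma exact_points_iterate:
  assumes x: "x \<in> exact_points f n"
  shows "(f ^^ i) x \<in> exact_points f n"
proof -
  have ret: "(f ^^ n) ((f ^^ i) x) = (f ^^ i) x" for i
  proof -
    have "(f ^^ n) ((f ^^ i) x) = (f ^^ i) ((f ^^ n) x)"
      using fun_cong[OF funpow_add[of n i f]] fun_cong[OF funpow_add[of i n f]]
      by (simp add: add.commute)
    then show ?thesis using x by (simp add: exact_points_def)
  qed
  have "(f ^^ k) ((f ^^ i) x) \<noteq> (f ^^ i) x" if k: "0 < k" "k < n" for k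
  proof
    assume eq: "(f ^^ k) ((f ^^ i) x) = (f ^^ i) x"
    define j where "j = n * i - i"
    have ni: "j + i = n * i" using k by (cases n) (simp_all add: j_def)
    have "(f ^^ j) ((f ^^ i) x) = x"
      using x unfolding o_apply[symmetric, of "f ^^ j"] funpow_add[symmetric] ni
      by (simp add: exact_points_def funpow_mult_fixed)
    moreover have "(f ^^ k) ((f ^^ j) ((f ^^ i) x)) = (f ^^ j) ((f ^^ i) x)"
    proof -
      have "(f ^^ k) ((f ^^ j) ((f ^^ i) x)) = (f ^^ j) ((f ^^ k) ((f ^^ i) x))"
        using fun_cong[OF funpow_add[of k j f]] fun_cong[OF funpow_add[of j k f]]
        by (simp add: add.commute)
      then show ?thesis by (simp add: eq)
    qed
    ultimately show False using x k by (auto simp: exact_points_def)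
  qed
  then show ?thesis using ret by (auto simp: exact_points_def)
qed

lemma exact_orbit_inj:
  assumes x: "x \<in> exact_points f n"
  shows "inj_on (\<lambda>i. (f ^^ i) x) {..<n}"
proof -
  have *: False if "i < j" "j < n" "(f ^^ i) x = (f ^^ j) x" for i j
  proof -
    have "(f ^^ (j - i)) ((f ^^ i) x) = (f ^^ i) x"
      using that unfolding o_apply[symmetric, of "f ^^ (j - i)"] funpow_add[symmetric] by simp
    then show False using exact_points_iterate[OF x, of i] that by (auto simp: exact_points_def)
  qed
  show ?thesis 
  proof (rule inj_onI)
    fix i j assume "i \<in> {..<n}" "j \<in> {..<n}" "(f ^^ i) x = (f ^^ j) x"
    then show "i = j" using *[of i j] *[of j i] by (cases i j rule: linorder_cases) auto
  qed
qed

text \<open>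
  A finite invariant set of points of exact period \<open>n\<close> is a disjoint union of orbits of length \<open>n\<close>;
  the induction removes one orbit at a time.
\<close>

lemma exact_period_dvd_card:
  assumes "finite B" "f ` B \<subseteq> B" "B \<subseteq> exact_points f n" "n > 0"
  shows "n dvd card B"
  using assms
proof (induction "card B" arbitrary: B rule: less_induct)
  case less
  show ?case
  proof (cases "B = {}")
    case False
    then obtain x where x: "x \<in> B" by auto
    define O' where "O' = (\<lambda>i. (f ^^ i) x) ` {..<n}"
    have xe: "x \<in> exact_points f n" using x less by auto
    have "(f ^^ i) x \<in> B" for i by (induction i) (use x less in auto)
    then have sub: "O' \<subseteq> B" by (auto simp: O'_def)
    have card: "card O' = n" using exact_orbit_inj[OF xe] by (simp add: O'_def card_image)
    have "f ` (B - O') \<subseteq> B - O'"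
    proof
      fix y assume "y \<in> f ` (B - O')"
      then obtain z where z: "z \<in> B" "z \<notin> O'" "y = f z" by auto
      have "y \<notin> O'"
      proof
        assume "y \<in> O'"
        then obtain i where i: "i < n" "f z = (f ^^ i) x" using z by (auto simp: O'_def)
        have "z = (f ^^ n) z" using z less by (auto simp: exact_points_def)
        also have "\<dots> = (f ^^ (n - 1)) (f z)" using less by (metis One_nat_def Suc_pred comp_apply funpow_Suc_right)
        also have "\<dots> = (f ^^ (n - 1 + i)) x" by (simp add: i funpow_add)
        also have "\<dots> = (f ^^ ((n - 1 + i) mod n + n * ((n - 1 + i) div n))) x" by simp
        also have "\<dots> = (f ^^ ((n - 1 + i) mod n)) x"
          using xe by (subst funpow_add) (simp add: exact_points_def funpow_mult_fixed)
        finally have "z \<in> O'" using less unfolding O'_def by auto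
        with z show False by simp
      qed
      then show "y \<in> B - O'" using z less by auto
    qed
    moreover have "card (B - O') < card B"
      using card sub less by (simp add: card_Diff_subset finite_subset card_gt_0_iff \<open>B \<noteq> {}\<close>)
    ultimately have "n dvd card (B - O')" using less by (intro less) auto
    moreover have "card B = card (B - O') + n"
      using card sub less by (metis card_Diff_subset card_mono finite_subset le_add_diff_inverse2)
    ultimately show ?thesis by simp
  qed simp
qed

section \<open>Evaluation at a complex parameter\<close>

definition specialise :: "complex \<Rightarrow> int poly \<Rightarrow> complex" where
  "specialise \<gamma> p = poly (map_poly of_int p) \<gamma>"

interpretation specialise: idom_hom "specialise \<gamma>" for \<gamma>
  by unfold_locales (auto simp: specialise_def of_int_poly_hom.hom_add of_int_poly_hom.hom_mult)

lemma specialise_indet_c [simp]: "specialise \<gamma> indet_c = \<gamma>"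
  by (simp add: specialise_def indet_c_def)

section \<open>Splitting of monic polynomials\<close>

lemma lead_coeff_prod_mset_linear: "lead_coeff (\<Prod>b\<in>#B. [:- f b, 1::'a::idom:]) = 1"
proof (induction B)
  case (add b B)
  have "lead_coeff [:- f b, 1::'a:] = 1" by simp
  then show ?case using add unfolding image_mset_add_mset prod_mset.add_mset lead_coeff_mult
    by (simp only: mult_1)
qed simp

lemma lead_coeff_prod_linear: "lead_coeff (\<Prod>b\<in>B. [:- f b, 1::'a::idom:]) = 1"
  by (simp add: lead_coeff_prod)

lemma proots_prod_mset_linear: "proots (\<Prod>b\<in>#B. [:-b, 1::'a::idom:]) = B"
proof (induction B)
  case (add b B)
  have "proots [:-b, 1:] = {#b#}" using proots_linear_factor[of "-b"] by simp
  moreover have "[:-b, 1:] * (\<Prod>b\<in>#B. [:-b, 1:]) \<noteq> 0"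
    using lead_coeff_prod_mset_linear[of "\<lambda>x. x" "add_mset b B"] by auto
  ultimately show ?case using add
    unfolding image_mset_add_mset prod_mset.add_mset by (subst proots_mult) auto
qed simp

lemma alg_closed_monic_split:
  fixes F :: "'a::alg_closed_field poly"
  assumes "lead_coeff F = 1"
  shows "F = (\<Prod>b\<in>#proots F. [:-b, 1:])"
proof -
  have "F \<noteq> 0" using assms by auto
  then obtain B where "F = smult (lead_coeff F) (\<Prod>b\<in>#B. [:-b, 1:])"
    using alg_closed_imp_factorization by blast
  then have B: "F = (\<Prod>b\<in>#B. [:-b, 1:])" using assms by simp
  have "proots F = B" unfolding B by (rule proots_prod_mset_linear)
  then show ?thesis using B by simp
qed

lemma resultant_monic_alg_closed:
  fixes F :: "'a::alg_closed_field poly"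
  assumes "lead_coeff F = 1"
  shows "resultant F G = (\<Prod>b\<in>#proots F. poly G b)"
  by (subst alg_closed_monic_split[OF assms]) (rule resultant_prod_linear_factors)

lemma order_simple_root:
  fixes F :: "'a::idom poly"
  assumes F0: "F \<noteq> 0" and a: "poly F a = 0" and simple: "poly (pderiv F) a \<noteq> 0"
  shows "order a F = 1"
proof -
  have "order a F \<noteq> 0" using a F0 by (simp add: order_root)
  moreover have "\<not> 2 \<le> order a F"
  proof
    define l where "l = [:-a, 1:]"
    have l: "poly l a = 0" by (simp add: l_def)
    assume "2 \<le> order a F"
    then have "l ^ 2 dvd F" unfolding l_def by (subst order_divides) auto
    then obtain q where "F = l * l * q" by (auto simp: power2_eq_square dvd_def)
    then have "poly (pderiv F) a = 0" by (simp add: pderiv_mult l)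
    then show False using simple by simp
  qed
  ultimately show ?thesis by linarith
qed

lemma monic_split_simple_roots:
  fixes F :: "'a::alg_closed_field poly"
  assumes F: "lead_coeff F = 1" and simple: "\<And>a. poly F a = 0 \<Longrightarrow> poly (pderiv F) a \<noteq> 0"
  shows "F = (\<Prod>a | poly F a = 0. [:-a, 1:])"
proof -
  have F0: "F \<noteq> 0" using F by auto
  have ord: "order a F = 1" if "poly F a = 0" for a
    using order_simple_root[OF F0 that simple[OF that]] .
  have "proots F = mset_set {a. poly F a = 0}"
  proof (rule multiset_eqI)
    fix a
    show "count (proots F) a = count (mset_set {a. poly F a = 0}) a"
      using F0 ord[of a] order_root[of F a] poly_roots_finite[OF F0]
      by (cases "poly F a = 0") (auto simp: count_mset_set)
  qed
  then show ?thesis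
    using alg_closed_monic_split[OF F] by (simp add: prod_unfold_prod_mset)
qed

lemma proots_prod_linear:
  fixes A :: "'a::idom set"
  shows "proots (\<Prod>a\<in>A. [:-a, 1:]) = mset_set A"
  unfolding prod_unfold_prod_mset by (rule proots_prod_mset_linear)

definition periodic_poly :: "'a::comm_ring_1 \<Rightarrow> nat \<Rightarrow> 'a poly" where
  "periodic_poly c n = quad_iter c n - [:0, 1:]"

lemma poly_periodic_poly [simp]: "poly (periodic_poly c n) a = (quad c ^^ n) a - a"
  by (simp add: periodic_poly_def poly_quad_iter)

lemma pderiv_periodic_poly:
  "pderiv (periodic_poly (c::'a::idom) n) = pderiv (quad_iter c n) - 1"
  by (simp add: periodic_poly_def pderiv_diff pderiv_pCons)

section \<open>The generic parameter\<close>

abbreviation generic_c :: Qc_closure where "generic_c \<equiv> to_Qc_closure indet_c"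

lemma degree_periodic_poly:
  assumes "n > 0"
  shows "degree (periodic_poly (c::'a::idom) n) = 2 ^ n"
    and "lead_coeff (periodic_poly c n) = 1"
proof -
  have "(2::nat) ^ 1 \<le> 2 ^ n" using assms by (intro power_increasing) auto
  moreover have "degree (- [:0, 1::'a:]) = 1" by simp
  ultimately have lt: "degree (- [:0, 1::'a:]) < degree (quad_iter c n)"
    unfolding degree_quad_iter by simp
  have eq: "periodic_poly c n = quad_iter c n + - [:0, 1:]" by (simp add: periodic_poly_def)
  show "degree (periodic_poly c n) = 2 ^ n"
    unfolding eq using degree_add_eq_left[OF lt] degree_quad_iter[of c n] by (simp only:)
  show "lead_coeff (periodic_poly c n) = 1"
    unfolding eq using lead_coeff_add_le[OF lt] lead_coeff_quad_iter[of c n]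
    by (simp only: add.commute)
qed

lemma (in idom_hom) map_poly_periodic_poly:
  "map_poly hom (periodic_poly c n) = periodic_poly (hom c) n"
proof -
  interpret mh: map_poly_comm_ring_hom hom ..
  have "map_poly hom [:0, 1:] = [:0, 1:]" by simp
  then show ?thesis unfolding periodic_poly_def mh.hom_minus map_poly_quad_iter by simp
qed

text \<open>
  For the generic parameter all periodic points are simple. It suffices that the resultant of
  \<open>f^n(z) - z\<close> and its derivative is a nonzero polynomial in \<open>c\<close>, and its value at \<open>c = 0\<close> is nonzero: a root of
  \<open>z ^ (2 ^ n) - z\<close> is \<open>0\<close> or a root of unity, where the derivative is \<open>- 1\<close> or \<open>2 ^ n - 1\<close>,
  respectively.
\<close>

lemma generic_multiplier_neq_1:
  assumes n: "n > 0" and \<alpha>: "(quad generic_c ^^ n) \<alpha> = \<alpha>"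
  shows "multiplier generic_c n \<alpha> \<noteq> 1"
proof -
  define R where "R = resultant (periodic_poly indet_c n) (pderiv (quad_iter indet_c n) - 1)"
  have deg: "degree (pderiv (quad_iter c n) - 1) = 2 ^ n - 1" if "(2::'c::idom) \<noteq> 0" for c :: "'c::idom"
  proof -
    have "(2::nat) ^ 1 \<le> 2 ^ n" using n by (intro power_increasing) auto
    then have "degree (- (1::'c poly)) < degree (pderiv (quad_iter c n))"
      using degree_pderiv_quad_iter(1)[OF that, of c n] by simp
    from degree_add_eq_left[OF this] show ?thesis
      using degree_pderiv_quad_iter(1)[OF that, of c n] by simp
  qed
  have two: "(2::int poly) \<noteq> 0" "(2::complex) \<noteq> 0" by auto
  have "to_Qc_closure 2 = 2" using to_Qc.hom_of_nat[of 2] by simp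
  then have two': "(2::Qc_closure) \<noteq> 0" by (metis to_Qc.hom_0_iff two(1))
  have map: "map_poly h (periodic_poly indet_c n) = periodic_poly (h indet_c) n"
       "map_poly h (pderiv (quad_iter indet_c n) - 1) = pderiv (quad_iter (h indet_c) n) - 1"
       if "idom_hom h" for h :: "int poly \<Rightarrow> 'd::idom"
  proof -
    interpret idom_hom h by fact
    show "map_poly h (periodic_poly indet_c n) = periodic_poly (h indet_c) n"
      by (rule map_poly_periodic_poly)
    show "map_poly h (pderiv (quad_iter indet_c n) - 1) = pderiv (quad_iter (h indet_c) n) - 1"
    proof -
      interpret mh: map_poly_comm_ring_hom h ..
      show ?thesis unfolding mh.hom_minus map_poly_pderiv map_poly_quad_iter by simp
    qed
  qed
  have "specialise 0 R = resultant (periodic_poly (0::complex) n) (pderiv (quad_iter 0 n) - 1)"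
    unfolding R_def
    using specialise.resultant_map_poly[of 0 "periodic_poly indet_c n" "pderiv (quad_iter indet_c n) - 1"]
    by (simp add: map[OF specialise.idom_hom_axioms] degree_periodic_poly[OF n] deg two )
  also have "\<dots> \<noteq> 0"
  proof -
    have lt: "(2::nat) ^ n \<ge> 2" using power_increasing[of 1 n "2::nat"] n by simp
    have "poly (pderiv (quad_iter 0 n) - 1) b \<noteq> 0"
      if b: "poly (periodic_poly 0 n) b = 0" for b :: complex
    proof -
      have b': "b ^ (2 ^ n) = b"
        using b poly_quad_iter[of 0 n b] by (simp add: quad_iter_zero_param poly_monom)
      have "2 ^ n * b ^ (2 ^ n - 1) \<noteq> 1"
      proof (cases "b = 0")
        case True
        then show ?thesis using lt by (simp add: power_0_left)
      next
        case False
        have "b * b ^ (2 ^ n - 1) = b * 1" using b' lt by (simp flip: power_Suc)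
        then have "b ^ (2 ^ n - 1) = 1" using False by simp
        moreover have "(2::complex) ^ n \<noteq> 1"
        proof
          assume "(2::complex) ^ n = 1"
          then have "of_nat (2 ^ n) = (of_nat 1 :: complex)" by simp
          then have "(2::nat) ^ n = 1" using of_nat_eq_iff by blast
          then show False using lt by simp
        qed
        ultimately show ?thesis by simp
      qed
      then show ?thesis using multiplier_zero_param[of n b] by (simp add: multiplier_def)
    qed
    moreover have "periodic_poly (0::complex) n \<noteq> 0"
      using degree_periodic_poly(2)[OF n, of "0::complex"] by auto
    ultimately show ?thesis
      by (subst resultant_monic_alg_closed)
        (auto simp: degree_periodic_poly(2)[OF n] prod_mset_zero_iff)
  qed
  finally have "R \<noteq> 0" by auto
  then have "to_Qc_closure R \<noteq> 0" by simp
  also have "to_Qc_closure R = resultant (periodic_poly generic_c n) (pderiv (quad_iter generic_c n) - 1)"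
    unfolding R_def
    using to_Qc.resultant_map_poly[of "periodic_poly indet_c n" "pderiv (quad_iter indet_c n) - 1"]
    by (simp add: map[OF to_Qc.idom_hom_axioms] degree_periodic_poly[OF n] deg two two' )
  also have "\<dots> = (\<Prod>b\<in>#proots (periodic_poly generic_c n). poly (pderiv (quad_iter generic_c n) - 1) b)"
    by (rule resultant_monic_alg_closed) (rule degree_periodic_poly(2)[OF n])
  finally have nz: "\<forall>b\<in>#proots (periodic_poly generic_c n). poly (pderiv (quad_iter generic_c n) - 1) b \<noteq> 0"
    by (auto simp: prod_mset_zero_iff)
  have "periodic_poly generic_c n \<noteq> 0" using degree_periodic_poly(2)[OF n, of generic_c] by auto
  then have "\<alpha> \<in># proots (periodic_poly generic_c n)"
    using \<alpha> by (simp add: poly_quad_iter)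
  then show ?thesis using nz by (auto simp: multiplier_def)
qed

lemma generic_periodic_poly_split:
  assumes n: "n > 0"
  shows "finite {\<alpha>. (quad generic_c ^^ n) \<alpha> = \<alpha>}"
    and "periodic_poly generic_c n = (\<Prod>\<alpha> | (quad generic_c ^^ n) \<alpha> = \<alpha>. [:-\<alpha>, 1:])"
proof -
  let ?F = "periodic_poly generic_c n"
  have F0: "?F \<noteq> 0" using degree_periodic_poly(2)[OF n, of generic_c] by auto
  have roots: "{\<alpha>. poly ?F \<alpha> = 0} = {\<alpha>. (quad generic_c ^^ n) \<alpha> = \<alpha>}" by (simp add: poly_quad_iter)
  show "finite {\<alpha>. (quad generic_c ^^ n) \<alpha> = \<alpha>}" using poly_roots_finite[OF F0] unfolding roots .
  have "?F = (\<Prod>a | poly ?F a = 0. [:-a, 1:])"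
  proof (rule monic_split_simple_roots)
    show "lead_coeff ?F = 1" by (rule degree_periodic_poly(2)[OF n])
    fix a assume "poly ?F a = 0"
    then have "(quad generic_c ^^ n) a = a" by (simp add: poly_quad_iter)
    then show "poly (pderiv ?F) a \<noteq> 0"
      using generic_multiplier_neq_1[OF n, of a] by (simp add: pderiv_periodic_poly multiplier_def)
  qed
  then show "?F = (\<Prod>\<alpha> | (quad generic_c ^^ n) \<alpha> = \<alpha>. [:-\<alpha>, 1:])" unfolding roots .
qed

lemma finite_generic_exact_points: "n > 0 \<Longrightarrow> finite (exact_points (quad generic_c) n)"
  by (rule finite_subset[OF _ generic_periodic_poly_split(1)]) (auto simp: exact_points_def)

lemma generic_periodic_poly_split_exact:
  assumes n: "n > 0"
  shows "periodic_poly generic_c n = (\<Prod>d | d dvd n. \<Prod>\<alpha>\<in>exact_points (quad generic_c) d. [:-\<alpha>, 1:])"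
proof -
  have d0: "d > 0" if "d dvd n" for d using that n by (auto intro: Nat.gr0I)
  have "periodic_poly generic_c n = (\<Prod>\<alpha>\<in>(\<Union>d\<in>{d. d dvd n}. exact_points (quad generic_c) d). [:-\<alpha>, 1:])"
    unfolding generic_periodic_poly_split(2)[OF n] fixed_points_eq_Union[OF n] ..
  also have "\<dots> = (\<Prod>d | d dvd n. \<Prod>\<alpha>\<in>exact_points (quad generic_c) d. [:-\<alpha>, 1:])"
  proof (rule prod.UNION_disjoint)
    show "finite {d. d dvd n}" using n by simp
    show "\<forall>d\<in>{d. d dvd n}. finite (exact_points (quad generic_c) d)"
      using d0 finite_generic_exact_points by blast
    show "\<forall>i\<in>{d. d dvd n}. \<forall>j\<in>{d. d dvd n}. i \<noteq> j \<longrightarrow>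
        exact_points (quad generic_c) i \<inter> exact_points (quad generic_c) j = {}"
      using d0 exact_period_unique by fastforce
  qed
  finally show ?thesis .
qed

lemma proper_divisors_split:
  assumes "n > (0::nat)"
  shows "(\<Prod>d | d dvd n. f d) = f n * (\<Prod>d | d dvd n \<and> d \<noteq> n. (f d :: 'a::comm_monoid_mult))"
proof -
  have "{d. d dvd n} = insert n {d. d dvd n \<and> d \<noteq> n}" by auto
  moreover have "finite {d. d dvd n \<and> d \<noteq> n}" using assms by simp
  ultimately show ?thesis by simp
qed

text \<open>
  If the products of the \<open>L d\<close> over the divisors of any \<open>n\<close> come from the smaller ring, so do the \<open>L n\<close>,
  by division. This yields both dynatomic and cyclotomic polynomials with integral coefficients.
\<close>

lemma (in inj_idom_hom) divisor_product_descends: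
  assumes q: "\<And>n. n > 0 \<Longrightarrow> map_poly hom (q n) = (\<Prod>d | d dvd n. L d)"
    and L: "\<And>n. lead_coeff (L n) = 1" and n: "n > (0::nat)"
  shows "\<exists>\<Phi>. map_poly hom \<Phi> = L n"
  using n
proof (induction n rule: less_induct)
  case (less n)
  interpret mh: map_poly_inj_idom_hom hom ..
  have "\<forall>d. d dvd n \<and> d \<noteq> n \<longrightarrow> (\<exists>\<Phi>. map_poly hom \<Phi> = L d)"
  proof (intro allI impI)
    fix d assume d: "d dvd n \<and> d \<noteq> n"
    then have "d > 0" "d < n" using less.prems by (auto intro: Nat.gr0I dest: dvd_imp_le)
    then show "\<exists>\<Phi>. map_poly hom \<Phi> = L d" using less.IH by blast
  qed
  then obtain \<Phi> where \<Phi>: "\<And>d. d dvd n \<and> d \<noteq> n \<Longrightarrow> map_poly hom (\<Phi> d) = L d" by metis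
  define p where "p = (\<Prod>d | d dvd n \<and> d \<noteq> n. \<Phi> d)"
  have p: "map_poly hom p = (\<Prod>d | d dvd n \<and> d \<noteq> n. L d)"
    unfolding p_def mh.hom_prod by (rule prod.cong) (auto simp: \<Phi>)
  have "hom (lead_coeff p) = lead_coeff (\<Prod>d | d dvd n \<and> d \<noteq> n. L d)"
    unfolding p[symmetric] by simp
  also have "\<dots> = 1" unfolding lead_coeff_prod by (simp add: L)
  finally have lp: "lead_coeff p = 1" by simp
  have "map_poly hom (q n) = map_poly hom p * L n"
    unfolding p q[OF less.prems]
    by (subst proper_divisors_split[OF less.prems]) (simp add: mult.commute)
  from monic_cofactor_descends[OF lp this] show ?case by metis
qed

lemma ex_dynatomic:
  assumes "n > 0"
  shows "\<exists>\<Phi>. map_poly to_Qc_closure \<Phi> = (\<Prod>\<alpha>\<in>exact_points (quad generic_c) n. [:-\<alpha>, 1:])"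
proof (rule to_Qc.divisor_product_descends[OF _ _ assms])
  fix n :: nat assume "n > 0"
  then show "map_poly to_Qc_closure (periodic_poly indet_c n) =
      (\<Prod>d | d dvd n. \<Prod>\<alpha>\<in>exact_points (quad generic_c) d. [:-\<alpha>, 1:])"
    unfolding to_Qc.map_poly_periodic_poly by (rule generic_periodic_poly_split_exact)
qed (rule lead_coeff_prod_linear)

text \<open>
  The definite description is justified: the integral polynomials that split into the points of exact
  period \<open>d\<close> multiply up to \<open>f^n(z) - z\<close>, so Moebius inversion recovers them from these products.
\<close>

lemma dynatomic:
  assumes n: "n > 0"
  shows map_poly_dynatomic:
      "map_poly to_Qc_closure (dynatomic n) = (\<Prod>\<alpha>\<in>exact_points (quad generic_c) n. [:-\<alpha>, 1:])"
    and lead_coeff_dynatomic: "lead_coeff (dynatomic n) = 1"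
proof -
  interpret mh: map_poly_inj_idom_hom to_Qc_closure ..
  let ?L = "\<lambda>d. \<Prod>\<alpha>\<in>exact_points (quad generic_c) d. [:-\<alpha>, 1:]"
  have "\<forall>d. d > 0 \<longrightarrow> (\<exists>\<Phi>. map_poly to_Qc_closure \<Phi> = ?L d)"
    using ex_dynatomic by blast
  then obtain \<Phi> where \<Phi>: "\<And>d. d > 0 \<Longrightarrow> map_poly to_Qc_closure (\<Phi> d) = ?L d" by metis
  have d0: "d > 0" if "d dvd k" "k > 0" for d k :: nat using that by (auto intro: Nat.gr0I)
  have prod: "periodic_poly indet_c k = (\<Prod>d | d dvd k. \<Phi> d)" if k: "k > 0" for k
  proof -
    have "map_poly to_Qc_closure (periodic_poly indet_c k) = map_poly to_Qc_closure (\<Prod>d | d dvd k. \<Phi> d)"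
      unfolding to_Qc.map_poly_periodic_poly generic_periodic_poly_split_exact[OF k] mh.hom_prod
      by (intro prod.cong) (auto simp: \<Phi> d0[OF _ k])
    then show ?thesis by simp
  qed
  have eq: "to_fract (\<Phi> n) = (\<Prod>k | k dvd n. to_fract (periodic_poly indet_c k) powi moebius (n div k))"
  proof (rule moebius_inversion_prod[symmetric, OF n])
    fix k assume k: "k dvd n"
    show "to_fract (periodic_poly indet_c k) = (\<Prod>d | d dvd k. to_fract (\<Phi> d))"
      unfolding prod[OF d0[OF k n]] by (rule to_fract_hom.hom_prod)
    have "?L k \<noteq> 0" using lead_coeff_prod_linear[of "\<lambda>x. x"  "exact_points (quad generic_c) k"] by auto
    then show "to_fract (\<Phi> k) \<noteq> 0" using \<Phi>[OF d0[OF k n]] by auto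
  qed
  have dyn: "dynatomic n = \<Phi> n"
    unfolding dynatomic_def periodic_poly_def[symmetric] eq[symmetric] by simp
  show *: "map_poly to_Qc_closure (dynatomic n) = ?L n" unfolding dyn by (rule \<Phi>[OF n])
  have "to_Qc_closure (lead_coeff (dynatomic n)) = 1"
    using lead_coeff_prod_linear[of "\<lambda>x. x" "exact_points (quad generic_c) n"] 
    unfolding *[symmetric] by simp
  then show "lead_coeff (dynatomic n) = 1" by simp
qed

lemma prod_dynatomic:
  assumes n: "n > 0"
  shows "periodic_poly indet_c n = (\<Prod>d | d dvd n. dynatomic d)"
proof -
  interpret mh: map_poly_inj_idom_hom to_Qc_closure ..
  have d0: "d > 0" if "d dvd n" for d using that n by (auto intro: Nat.gr0I)
  have "map_poly to_Qc_closure (periodic_poly indet_c n) = map_poly to_Qc_closure (\<Prod>d | d dvd n. dynatomic d)"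
    unfolding to_Qc.map_poly_periodic_poly generic_periodic_poly_split_exact[OF n] mh.hom_prod
    by (intro prod.cong) (auto simp: map_poly_dynatomic d0)
  then show ?thesis by simp
qed

lemma sum_degree_dynatomic:
  assumes n: "n > 0"
  shows "(\<Sum>d | d dvd n. degree (dynatomic d)) = 2 ^ n"
proof -
  have d0: "d > 0" if "d dvd n" for d using that n by (auto intro: Nat.gr0I)
  have "2 ^ n = degree (\<Prod>d | d dvd n. dynatomic d)"
    unfolding prod_dynatomic[OF n, symmetric] by (rule degree_periodic_poly(1)[OF n, symmetric])
  also have "\<dots> = (\<Sum>d | d dvd n. degree (dynatomic d))"
    using lead_coeff_dynatomic d0 by (intro degree_prod_eq_sum_degree) (metis (mono_tags) leading_coeff_0_iff mem_Collect_eq zero_neq_one)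
  finally show ?thesis by simp
qed

section \<open>The multiplier polynomials\<close>

text \<open>
  For monic \<open>F\<close> this is the characteristic polynomial of the multiplication by \<open>G\<close> modulo \<open>F\<close>: the resultant
  eliminates \<open>z\<close> from \<open>F(z)\<close> and \<open>x - G(z)\<close>, so its roots are the values of \<open>G\<close> at the roots of \<open>F\<close>. In
  contrast to the product over these roots it makes sense without a splitting field and commutes
  with specialisation.
\<close>

definition image_charpoly :: "'a::comm_ring_1 poly \<Rightarrow> 'a poly \<Rightarrow> 'a poly" where
  "image_charpoly F G = resultant (map_poly (\<lambda>a. [:a:]) F) ([:[:0, 1:]:] - map_poly (\<lambda>a. [:a:]) G)"

lemma degree_indet_minus:
  fixes G :: "'a::idom poly"
  assumes "degree G > 0"
  shows "degree ([:[:0, 1:]:] - map_poly (\<lambda>a. [:a:]) G) = degree G"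
proof -
  have "degree [:[:0, 1::'a:]:] < degree (- map_poly (\<lambda>a. [:a:]) G)"
    using assms by simp
  from degree_add_eq_right[OF this] show ?thesis by simp
qed

lemma (in idom_hom) map_poly_lift:
  "map_poly (map_poly hom) (map_poly (\<lambda>a. [:a:]) p) = map_poly (\<lambda>a. [:a:]) (map_poly hom p)"
  by (rule poly_eqI) (simp add: coeff_map_poly hom_distribs)

lemma (in idom_hom) map_poly_image_charpoly:
  assumes "degree (map_poly hom F) = degree F" "degree (map_poly hom G) = degree G" "degree G > 0"
  shows "map_poly hom (image_charpoly F G) = image_charpoly (map_poly hom F) (map_poly hom G)"
proof -
  interpret mh: map_poly_idom_hom hom ..
  note lift = map_poly_lift
  interpret mmh: map_poly_comm_ring_hom "map_poly hom" ..
  have 2: "map_poly (map_poly hom) ([:[:0, 1:]:] - map_poly (\<lambda>a. [:a:]) G) =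
    [:[:0, 1:]:] - map_poly (\<lambda>a. [:a:]) (map_poly hom G)"
    unfolding mmh.hom_minus lift by (simp add: hom_distribs)
  have "resultant (map_poly (map_poly hom) (map_poly (\<lambda>a. [:a:]) F))
      (map_poly (map_poly hom) ([:[:0, 1:]:] - map_poly (\<lambda>a. [:a:]) G)) =
    map_poly hom (resultant (map_poly (\<lambda>a. [:a:]) F) ([:[:0, 1:]:] - map_poly (\<lambda>a. [:a:]) G))"
  proof (rule mh.resultant_map_poly)
    show "degree (map_poly (map_poly hom) (map_poly (\<lambda>a. [:a:]) F)) = degree (map_poly (\<lambda>a. [:a:]) F)"
      using assms by (simp add: lift)
    show "degree (map_poly (map_poly hom) ([:[:0, 1:]:] - map_poly (\<lambda>a. [:a:]) G)) =
        degree ([:[:0, 1:]:] - map_poly (\<lambda>a. [:a:]) G)"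
      unfolding 2 using assms degree_indet_minus[of G] degree_indet_minus[of "map_poly hom G"]
      by (simp only:)
  qed
  then show ?thesis unfolding image_charpoly_def 2 lift by simp
qed

lemma map_poly_const_prod_linear:
  fixes B :: "'a::idom multiset"
  shows "map_poly (\<lambda>a. [:a:]) (\<Prod>b\<in>#B. [:-b, 1:]) = (\<Prod>b\<in>#image_mset (\<lambda>a. [:a:]) B. [:-b, 1:])"
proof -
  interpret mh: map_poly_comm_ring_hom "\<lambda>a::'a. [:a:]" ..
  show ?thesis by (simp add: mh.hom_prod_mset image_mset.compositionality o_def)
qed

lemma image_charpoly_split:
  fixes G :: "'a::idom poly"
  shows "image_charpoly (\<Prod>b\<in>#B. [:-b, 1:]) G = (\<Prod>b\<in>#B. [:- poly G b, 1:])"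
proof -
  have "image_charpoly (\<Prod>b\<in>#B. [:-b, 1:]) G =
      resultant (\<Prod>b\<in>#image_mset (\<lambda>a. [:a:]) B. [:-b, 1:]) ([:[:0, 1:]:] - map_poly (\<lambda>a. [:a:]) G)"
    unfolding image_charpoly_def map_poly_const_prod_linear ..
  also have "\<dots> = (\<Prod>b\<in>#B. poly ([:[:0, 1:]:] - map_poly (\<lambda>a. [:a:]) G) [:b:])"
    unfolding resultant_prod_linear_factors by (simp only: image_mset.compositionality o_def)
  also have "\<dots> = (\<Prod>b\<in>#B. [:- poly G b, 1:])"
  proof -
    have "poly ([:[:0, 1:]:] - map_poly (\<lambda>a. [:a:]) G) [:b:] = [:- poly G b, 1:]" for b
      by simp
    then show ?thesis by (simp only:)
  qed
  finally show ?thesis .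
qed

text \<open>
  An invariant function takes each of its values on a union of orbits of length \<open>n\<close>, hence a multiple of \<open>n\<close>
  times.
\<close>

lemma invariant_prod_is_power:
  fixes g :: "'b \<Rightarrow> 'a::idom"
  assumes fin: "finite A" and A: "A \<subseteq> exact_points f n" "f ` A \<subseteq> A" and n: "n > 0"
    and inv: "\<And>x. x \<in> A \<Longrightarrow> g (f x) = g x"
  shows "\<exists>P. lead_coeff P = 1 \<and> (\<Prod>x\<in>A. [:- g x, 1:]) = P ^ n"
proof -
  define P where "P = (\<Prod>l\<in>g ` A. [:-l, 1:] ^ (card {x\<in>A. g x = l} div n))"
  have dv: "n dvd card {x\<in>A. g x = l}" for l
    by (rule exact_period_dvd_card[of _ f]) (use fin A n inv in auto)
  have "(\<Prod>x\<in>A. [:- g x, 1:]) = (\<Prod>l\<in>g ` A. \<Prod>x\<in>{x\<in>A. g x = l}. [:- g x, 1:])"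
    by (rule prod.image_gen[OF fin])
  also have "\<dots> = (\<Prod>l\<in>g ` A. ([:-l, 1:] ^ (card {x\<in>A. g x = l} div n)) ^ n)"
  proof (rule prod.cong[OF refl])
    fix l
    have "(\<Prod>x\<in>{x\<in>A. g x = l}. [:- g x, 1:]) = (\<Prod>x\<in>{x\<in>A. g x = l}. [:- l, 1:])"
      by (rule prod.cong) auto
    also have "\<dots> = [:-l, 1:] ^ (card {x\<in>A. g x = l} div n * n)"
      using dv[of l] by simp
    finally show "(\<Prod>x\<in>{x\<in>A. g x = l}. [:- g x, 1:]) = ([:-l, 1:] ^ (card {x\<in>A. g x = l} div n)) ^ n"
      unfolding power_mult .
  qed
  also have "\<dots> = P ^ n" unfolding P_def by (rule prod_power_distrib[symmetric])
  finally have "(\<Prod>x\<in>A. [:- g x, 1:]) = P ^ n" .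
  moreover have "lead_coeff P = 1" unfolding P_def lead_coeff_prod lead_coeff_power by simp
  ultimately show ?thesis by blast
qed

lemma degree_pderiv_quad_iter_pos:
  assumes "n > 0" "(2::'a::idom) \<noteq> 0"
  shows "degree (pderiv (quad_iter (c::'a) n)) > 0"
  using degree_pderiv_quad_iter(1)[OF assms(2), of c n] power_increasing[of 1 n "2::nat"] assms(1)
  by simp

text \<open>
  Over the algebraic closure the product over the points of exact period \<open>n\<close> is an \<open>n\<close>-th power, as the
  multiplier is constant along cycles. It equals the integral polynomial \<open>image_charpoly\<close>, so the root is
  integral as well and the definite description of \<open>delta\<close> is justified. The resulting identity in \<open>int poly poly\<close>
  can be specialised at any complex parameter.
\<close>

lemma delta:
  assumes n: "n > 0"
  shows lead_coeff_delta: "lead_coeff (delta n) = 1"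
    and delta_power: "delta n ^ n = image_charpoly (dynatomic n) (pderiv (quad_iter indet_c n))"
proof -
  interpret mh: map_poly_inj_idom_hom to_Qc_closure ..
  let ?A = "exact_points (quad generic_c) n"
  let ?N = "image_charpoly (dynatomic n) (pderiv (quad_iter indet_c n))"
  have finA: "finite ?A" using n by (rule finite_generic_exact_points)
  have proots: "proots (map_poly to_Qc_closure (dynatomic n)) = mset_set ?A"
    unfolding map_poly_dynatomic[OF n] by (rule proots_prod_linear)
  have mult: "(\<Prod>\<alpha>\<in>#mset_set ?A. [:- multiplier generic_c n \<alpha>, 1:]) = (\<Prod>\<alpha>\<in>?A. [:- multiplier generic_c n \<alpha>, 1:])"
    by (simp add: prod_unfold_prod_mset)
  have "map_poly to_Qc_closure ?N =
      image_charpoly (map_poly to_Qc_closure (dynatomic n)) (pderiv (quad_iter generic_c n))"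
    using to_Qc.map_poly_image_charpoly[OF to_Qc.degree_map_poly_hom to_Qc.degree_map_poly_hom
        degree_pderiv_quad_iter_pos[OF n, of indet_c]]
    by (simp add: to_Qc.map_poly_pderiv to_Qc.map_poly_quad_iter)
  also have "\<dots> = (\<Prod>\<alpha>\<in>?A. [:- multiplier generic_c n \<alpha>, 1:])"
    unfolding map_poly_dynatomic[OF n] prod_unfold_prod_mset image_charpoly_split multiplier_def ..
  finally have N: "map_poly to_Qc_closure ?N = (\<Prod>\<alpha>\<in>?A. [:- multiplier generic_c n \<alpha>, 1:])" .
  have "to_Qc_closure (lead_coeff ?N) = 1"
    using lead_coeff_prod_linear[of "multiplier generic_c n" ?A] unfolding N[symmetric] by simp
  then have lN: "lead_coeff ?N = 1" by simp
  have "\<exists>P. lead_coeff P = 1 \<and> (\<Prod>\<alpha>\<in>?A. [:- multiplier generic_c n \<alpha>, 1:]) = P ^ n"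
  proof (rule invariant_prod_is_power[OF finA _ _ n])
    show "quad generic_c ` ?A \<subseteq> ?A" using exact_points_iterate[of _ "quad generic_c" n 1] by auto
    fix x assume "x \<in> ?A"
    then show "multiplier generic_c n (quad generic_c x) = multiplier generic_c n x"
      by (intro multiplier_shift) (auto simp: exact_points_def)
  qed auto
  then obtain P where P: "lead_coeff P = 1" "P ^ n = map_poly to_Qc_closure ?N"
    unfolding N by metis
  obtain Q where Q: "lead_coeff Q = 1" "P = map_poly to_Qc_closure Q"
    using monic_root_in_Qc_closure_descends[OF P(1) lN P(2) n] by blast
  have QN: "Q ^ n = ?N"
    using P(2) unfolding Q(2) by (simp flip: mh.hom_power)
  have uniq: "d = Q" if "lead_coeff d = 1" "d ^ n = ?N" for d
    by (rule monic_power_eq_imp_eq[of d n Q]) (use that QN Q n in auto)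
  have "delta n = Q"
    unfolding delta_def proots mult N[symmetric]
  proof (rule the_equality)
    show "lead_coeff Q = 1 \<and> map_poly to_Qc_closure Q ^ n = map_poly to_Qc_closure ?N"
      using Q QN by (simp flip: mh.hom_power)
    fix d assume "lead_coeff d = 1 \<and> map_poly to_Qc_closure d ^ n = map_poly to_Qc_closure ?N"
    then show "d = Q" by (intro uniq) (simp_all flip: mh.hom_power)
  qed
  then show "lead_coeff (delta n) = 1" "delta n ^ n = ?N" using Q(1) QN by auto
qed

section \<open>Specialisation to a complex parameter\<close>

definition dynatomic_at :: "complex \<Rightarrow> nat \<Rightarrow> complex poly" where
  "dynatomic_at c n = map_poly (specialise c) (dynatomic n)"

definition delta_at :: "complex \<Rightarrow> nat \<Rightarrow> complex poly" where
  "delta_at c n = map_poly (specialise c) (delta n)"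

lemma (in idom_hom) map_poly_monic:
  assumes "lead_coeff p = 1"
  shows "degree (map_poly hom p) = degree p" "lead_coeff (map_poly hom p) = 1"
proof -
  have c: "coeff (map_poly hom p) (degree p) = 1" using assms by simp
  then show "degree (map_poly hom p) = degree p"
    using degree_map_poly_le[of hom p] le_degree[of "map_poly hom p" "degree p"] by simp
  then show "lead_coeff (map_poly hom p) = 1" using c by simp
qed

lemma dynatomic_at_monic:
  assumes "n > 0"
  shows "degree (dynatomic_at c n) = degree (dynatomic n)" "lead_coeff (dynatomic_at c n) = 1"
  using specialise.map_poly_monic[OF lead_coeff_dynatomic[OF assms]] by (simp_all add: dynatomic_at_def)

lemma prod_dynatomic_at:
  assumes "n > 0"
  shows "periodic_poly c n = (\<Prod>d | d dvd n. dynatomic_at c d)"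
proof -
  interpret mh: map_poly_idom_hom "specialise c" ..
  have "periodic_poly c n = map_poly (specialise c) (periodic_poly indet_c n)"
    by (simp add: specialise.map_poly_periodic_poly)
  also have "\<dots> = (\<Prod>d | d dvd n. dynatomic_at c d)"
    unfolding prod_dynatomic[OF assms] dynatomic_at_def by (rule mh.hom_prod)
  finally show ?thesis .
qed

lemma delta_at_power:
  assumes n: "n > 0"
  shows "delta_at c n ^ n = (\<Prod>\<alpha>\<in>#proots (dynatomic_at c n). [:- multiplier c n \<alpha>, 1:])"
proof -
  interpret mh: map_poly_idom_hom "specialise c" ..
  have deg: "degree (map_poly (specialise c) (pderiv (quad_iter indet_c n))) = degree (pderiv (quad_iter indet_c n))"
    unfolding specialise.map_poly_pderiv specialise.map_poly_quad_iter by (simp add: degree_pderiv_quad_iter)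
  have "delta_at c n ^ n = map_poly (specialise c) (image_charpoly (dynatomic n) (pderiv (quad_iter indet_c n)))"
    unfolding delta_at_def delta_power[OF n, symmetric] by (simp add: mh.hom_power)
  also have "\<dots> = image_charpoly (dynatomic_at c n) (pderiv (quad_iter c n))"
    using dynatomic_at_monic(1)[OF n, of c] deg degree_pderiv_quad_iter_pos[OF n, of indet_c]
    by (subst specialise.map_poly_image_charpoly) 
      (simp_all add: dynatomic_at_def specialise.map_poly_pderiv specialise.map_poly_quad_iter)
  also have "\<dots> = (\<Prod>\<alpha>\<in>#proots (dynatomic_at c n). [:- multiplier c n \<alpha>, 1:])"
    unfolding multiplier_def
    using arg_cong[OF alg_closed_monic_split[OF dynatomic_at_monic(2)[OF n]],
        of "\<lambda>F. image_charpoly F (pderiv (quad_iter c n))" c]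
    unfolding image_charpoly_split .
  finally show ?thesis .
qed

lemma poly_delta_at_power:
  assumes n: "n > 0"
  shows "poly (delta_at c n) x ^ n = (\<Prod>\<alpha>\<in>#proots (dynatomic_at c n). x - multiplier c n \<alpha>)"
proof -
  have "poly (delta_at c n) x ^ n = poly (\<Prod>\<alpha>\<in>#proots (dynatomic_at c n). [:- multiplier c n \<alpha>, 1:]) x"
    unfolding delta_at_power[OF n, symmetric] by simp
  also have "\<dots> = (\<Prod>\<alpha>\<in>#proots (dynatomic_at c n). x - multiplier c n \<alpha>)"
    by (simp add: poly_hom.hom_prod_mset image_mset.compositionality o_def)
  finally show ?thesis .
qed

lemma poly_delta_at_eq_0_iff:
  assumes n: "n > 0"
  shows "poly (delta_at c n) x = 0 \<longleftrightarrow> (\<exists>\<alpha>. poly (dynatomic_at c n) \<alpha> = 0 \<and> multiplier c n \<alpha> = x)"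
proof -
  have "dynatomic_at c n \<noteq> 0" using dynatomic_at_monic(2)[OF n, of c] by auto
  moreover have "poly (delta_at c n) x = 0 \<longleftrightarrow> poly (delta_at c n) x ^ n = 0" using n by simp
  ultimately show ?thesis
    unfolding poly_delta_at_power[OF n] by (auto simp: prod_mset_zero_iff)
qed

section \<open>Cyclotomic polynomials\<close>

definition prim_roots :: "nat \<Rightarrow> complex set" where
  "prim_roots n = {\<zeta>. \<zeta> ^ n = 1 \<and> (\<forall>k. 0 < k \<and> k < n \<longrightarrow> \<zeta> ^ k \<noteq> 1)}"

text \<open>
  A primitive \<open>n\<close>-th root of unity is one for which \<open>1\<close> has exact period \<open>n\<close> under multiplication, so the
  results on periods apply to orders.
\<close>

lemma prim_roots_iff_exact_points: "\<zeta> \<in> prim_roots n \<longleftrightarrow> 1 \<in> exact_points ((*) \<zeta>) n"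
proof -
  have "((*) \<zeta> ^^ k) 1 = \<zeta> ^ k" for k by (induction k) simp_all
  then show ?thesis by (simp add: prim_roots_def exact_points_def)
qed

lemma funpow_mult_one: "((*) \<zeta> ^^ k) 1 = (\<zeta>::complex) ^ k"
  by (induction k) simp_all

lemma roots_of_unity_eq_Union:
  assumes "n > 0"
  shows "{\<zeta>. \<zeta> ^ n = 1} = (\<Union>d\<in>{d. d dvd n}. prim_roots d)"
proof (intro equalityI subsetI)
  fix \<zeta> :: complex assume "\<zeta> \<in> {\<zeta>. \<zeta> ^ n = 1}"
  then obtain d where "d dvd n" "1 \<in> exact_points ((*) \<zeta>) d"
    using ex_exact_period[OF assms, of "(*) \<zeta>" 1] by (auto simp: funpow_mult_one)
  then show "\<zeta> \<in> (\<Union>d\<in>{d. d dvd n}. prim_roots d)" by (auto simp: prim_roots_iff_exact_points)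
next
  fix \<zeta> assume "\<zeta> \<in> (\<Union>d\<in>{d. d dvd n}. prim_roots d)"
  then show "\<zeta> \<in> {\<zeta>. \<zeta> ^ n = 1}" by (auto simp: prim_roots_def power_mult elim!: dvdE)
qed

lemma prim_roots_order_dvd:
  assumes "\<zeta> \<in> prim_roots d" "d > 0" "\<zeta> ^ n = 1"
  shows "d dvd n"
  using exact_period_dvd[of 1 "(*) \<zeta>" d n] assms
  by (simp add: prim_roots_iff_exact_points funpow_mult_one)

lemma prim_roots_disjoint:
  assumes "d > 0" "e > 0" "d \<noteq> e"
  shows "prim_roots d \<inter> prim_roots e = {}"
proof -
  have False if "\<zeta> \<in> prim_roots d" "\<zeta> \<in> prim_roots e" for \<zeta>
    using exact_period_unique[of 1 "(*) \<zeta>" d e] that assms by (simp add: prim_roots_iff_exact_points)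
  then show ?thesis by blast
qed

lemma finite_prim_roots: "n > 0 \<Longrightarrow> finite (prim_roots n)"
  by (rule finite_subset[OF _ finite_nth_roots[of n 1]]) (auto simp: prim_roots_def)

lemma norm_prim_roots: "\<zeta> \<in> prim_roots n \<Longrightarrow> n > 0 \<Longrightarrow> norm \<zeta> = 1"
  by (auto simp: prim_roots_def dest: power_eq_1_iff)

text \<open>
  Both counting functions sum up to \<open>n\<close> over the divisors of \<open>n\<close>.
\<close>

lemma card_prim_roots:
  assumes "n > 0"
  shows "card (prim_roots n) = totient n"
  using assms
proof (induction n rule: less_induct)
  case (less n)
  have d0: "d > 0" if "d dvd n" for d using that less.prems by (auto intro: Nat.gr0I)
  have fin: "finite {d. d dvd n}" "finite {d. d dvd n \<and> d \<noteq> n}" using less.prems by simp_all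
  have split: "{d. d dvd n} = insert n {d. d dvd n \<and> d \<noteq> n}" by auto
  have "n = card {\<zeta>::complex. \<zeta> ^ n = 1}" using less.prems by (simp add: card_nth_roots)
  also have "\<dots> = (\<Sum>d | d dvd n. card (prim_roots d))"
    unfolding roots_of_unity_eq_Union[OF less.prems]
  proof (rule card_UN_disjoint)
    show "\<forall>d\<in>{d. d dvd n}. finite (prim_roots d)" using d0 finite_prim_roots by blast
    show "\<forall>i\<in>{d. d dvd n}. \<forall>j\<in>{d. d dvd n}. i \<noteq> j \<longrightarrow> prim_roots i \<inter> prim_roots j = {}"
      using d0 prim_roots_disjoint by blast
  qed (rule fin)
  also have "\<dots> = card (prim_roots n) + (\<Sum>d | d dvd n \<and> d \<noteq> n. card (prim_roots d))"
    unfolding split using fin by simp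
  also have "(\<Sum>d | d dvd n \<and> d \<noteq> n. card (prim_roots d)) = (\<Sum>d | d dvd n \<and> d \<noteq> n. totient d)"
    using less.prems by (intro sum.cong less.IH) (auto simp: d0 dest: dvd_imp_le)
  finally have "n = card (prim_roots n) + (\<Sum>d | d dvd n \<and> d \<noteq> n. totient d)" .
  moreover have "n = totient n + (\<Sum>d | d dvd n \<and> d \<noteq> n. totient d)"
    using totient_divisor_sum[of n] fin unfolding split by simp
  ultimately show ?case by simp
qed

lemma unity_poly_split:
  assumes n: "n > 0"
  shows "(monom 1 n - 1 :: complex poly) = (\<Prod>d | d dvd n. \<Prod>\<zeta>\<in>prim_roots d. [:-\<zeta>, 1:])"
proof -
  let ?F = "monom 1 n - 1 :: complex poly"
  have d0: "d > 0" if "d dvd n" for d using that n by (auto intro: Nat.gr0I)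
  have "[:-1:] = - (1::complex poly)" by (simp only: one_pCons minus_pCons minus_zero)
  then have F: "?F = [:-1:] + monom 1 n" by (simp only: diff_conv_add_uminus add.commute)
  have "degree [:-1::complex:] < degree (monom (1::complex) n)" using n by (simp add: degree_monom_eq)
  from lead_coeff_add_le[OF this] have lF: "lead_coeff ?F = 1" unfolding F by (simp only: lead_coeff_monom)
  have "?F = (\<Prod>a | poly ?F a = 0. [:-a, 1:])"
  proof (rule monic_split_simple_roots[OF lF])
    fix a assume "poly ?F a = 0"
    then have "a ^ n = 1" by (simp add: poly_monom)
    then have "a \<noteq> 0" using n by (auto simp: power_0_left)
    then show "poly (pderiv ?F) a \<noteq> 0" using n by (simp add: pderiv_diff pderiv_monom poly_monom)
  qed
  also have "{a. poly ?F a = 0} = (\<Union>d\<in>{d. d dvd n}. prim_roots d)"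
    by (simp add: poly_monom roots_of_unity_eq_Union[OF n])
  also have "(\<Prod>a\<in>\<dots>. [:-a, 1:]) = (\<Prod>d | d dvd n. \<Prod>\<zeta>\<in>prim_roots d. [:-\<zeta>, 1:])"
  proof (rule prod.UNION_disjoint)
    show "finite {d. d dvd n}" using n by simp
    show "\<forall>d\<in>{d. d dvd n}. finite (prim_roots d)" using d0 finite_prim_roots by blast
    show "\<forall>i\<in>{d. d dvd n}. \<forall>j\<in>{d. d dvd n}. i \<noteq> j \<longrightarrow> prim_roots i \<inter> prim_roots j = {}"
      using d0 prim_roots_disjoint by blast
  qed
  finally show ?thesis .
qed

lemma map_poly_of_int_unity_poly: "map_poly of_int (monom 1 n - 1) = (monom 1 n - 1 :: complex poly)"
  unfolding of_int_poly_hom.hom_minus of_int_poly_hom.hom_one of_int_hom.map_poly_hom_monom by simp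

lemma cyclotomic:
  assumes n: "n > 0"
  shows "map_poly of_int (cyclotomic n) = (\<Prod>\<zeta>\<in>prim_roots n. [:-\<zeta>, 1:])"
proof -
  have "\<exists>\<Phi>. map_poly of_int \<Phi> = (\<Prod>\<zeta>\<in>prim_roots n. [:-\<zeta>, 1:])"
  proof (rule of_int_hom.divisor_product_descends[OF _ _ n])
    fix n :: nat assume n: "n > 0"
    show "map_poly of_int (monom 1 n - 1) = (\<Prod>d | d dvd n. \<Prod>\<zeta>\<in>prim_roots d. [:-\<zeta>, 1:])"
      unfolding map_poly_of_int_unity_poly by (rule unity_poly_split[OF n])
  qed (rule lead_coeff_prod_linear)
  then obtain \<Phi> where \<Phi>: "map_poly of_int \<Phi> = (\<Prod>\<zeta>\<in>prim_roots n. [:-\<zeta>, 1:])" by blast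
  have "cyclotomic n = \<Phi>"
    unfolding cyclotomic_def prim_roots_def[symmetric] \<Phi>[symmetric] by simp
  then show ?thesis using \<Phi> by simp
qed

lemma prod_cyclotomic:
  assumes n: "n > 0"
  shows "monom 1 n - 1 = (\<Prod>d | d dvd n. cyclotomic d)"
proof -
  have d0: "d > 0" if "d dvd n" for d using that n by (auto intro: Nat.gr0I)
  have "map_poly complex_of_int (monom 1 n - 1) = map_poly complex_of_int (\<Prod>d | d dvd n. cyclotomic d)"
    unfolding map_poly_of_int_unity_poly unity_poly_split[OF n] of_int_poly_hom.hom_prod
    by (rule prod.cong) (auto simp: cyclotomic d0)
  then show ?thesis by simp
qed

section \<open>The polynomials Delta over the complex numbers\<close>

text \<open>
  The value of \<open>delta m\<close> at the constant \<open>\<zeta>\<close>, as a polynomial in the parameter \<open>c\<close>. The resultants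
  \<open>Delta_proper n m\<close> are products of such values.
\<close>

definition delta_val :: "nat \<Rightarrow> complex \<Rightarrow> complex poly" where
  "delta_val m \<zeta> = poly (map_poly (map_poly of_int) (delta m)) [:\<zeta>:]"

lemma poly_delta_val: "poly (delta_val m \<zeta>) c = poly (delta_at c m) \<zeta>"
proof -
  let ?P = "map_poly (map_poly of_int) (delta m) :: complex poly poly"
  have "map_poly (\<lambda>p. poly p c) ?P = delta_at c m"
    unfolding delta_at_def specialise_def[abs_def] by (subst map_poly_map_poly) (simp_all only: o_def map_poly_0 poly_0)
  note 1 = this
  have 2: "poly [:\<zeta>:] c = \<zeta>" by simp
  have "poly (delta_val m \<zeta>) c = poly (map_poly (\<lambda>p. poly p c) ?P) (poly [:\<zeta>:] c)"
    unfolding delta_val_def by (rule poly_hom.poly_map_poly[symmetric])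
  then show ?thesis unfolding 1 2 .
qed

lemma delta_val_1: "map_poly of_int (poly (delta n) 1) = delta_val n 1"
proof -
  have one: "[:1:] = (1 :: complex poly)" by (rule one_pCons[symmetric])
  show ?thesis unfolding delta_val_def one
    by (rule of_int_poly_hom.poly_map_poly_1[symmetric])
qed

lemma Delta_proper_eq_prod:
  assumes "r > 0" "n = m * r" "m > 0"
  shows "map_poly of_int (Delta_proper n m) = (\<Prod>\<zeta>\<in>prim_roots r. delta_val m \<zeta>)"
proof -
  let ?h = "map_poly of_int :: int poly \<Rightarrow> complex poly"
  have r: "n div m = r" using assms by simp
  have 1: "?h (Delta_proper n m) = resultant (map_poly ?h (map_poly (\<lambda>a. [:a:]) (cyclotomic r))) (map_poly ?h (delta m))"
    unfolding Delta_proper_def r by (rule of_int_poly_hom.resultant_hom[symmetric])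
  note 2 = of_int_hom.map_poly_lift[of "cyclotomic r", where 'a = complex]
  show ?thesis
    unfolding 1 2 cyclotomic[OF assms(1)] prod_unfold_prod_mset map_poly_const_prod_linear
      resultant_prod_linear_factors
    unfolding delta_val_def image_mset.compositionality o_def ..
qed

section \<open>Parabolic cycles\<close>

lemma dynatomic_at_root_fixed:
  assumes "k > 0" "poly (dynatomic_at c k) \<alpha> = 0"
  shows "(quad c ^^ k) \<alpha> = \<alpha>"
proof -
  have "finite {d. d dvd k}" using assms(1) by simp
  then have "poly (periodic_poly c k) \<alpha> = 0"
    unfolding prod_dynatomic_at[OF assms(1)] poly_prod using assms(2)
    by (intro prod_zero bexI[of _ k]) auto
  then show ?thesis by simp
qed

lemma dynatomic_at_exact_root:
  assumes k: "k > 0" and \<alpha>: "\<alpha> \<in> exact_points (quad c) k"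
  shows "poly (dynatomic_at c k) \<alpha> = 0"
proof -
  have "poly (periodic_poly c k) \<alpha> = 0" using \<alpha> by (simp add: exact_points_def)
  then obtain d where d: "d dvd k" "poly (dynatomic_at c d) \<alpha> = 0"
    unfolding prod_dynatomic_at[OF k] poly_prod using k by (auto simp: prod_zero_iff)
  then have "d > 0" using k by (auto intro: Nat.gr0I)
  then have "k dvd d" using exact_period_dvd[OF \<alpha> k] dynatomic_at_root_fixed d(2) by blast
  then show ?thesis using d by (metis dvd_antisym)
qed

lemma pderiv_double_root:
  fixes p q :: "'a::idom poly"
  assumes "poly p a = 0" "poly q a = 0"
  shows "poly (pderiv (p * q * r)) a = 0"
  using assms by (simp add: pderiv_mult)

text \<open>
  A common root of two dynatomic factors is a double root of \<open>f^k(z) - z\<close>, so the derivative vanishes.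
\<close>

lemma common_dynatomic_root_multiplier:
  assumes k: "k > 0" and ij: "i dvd k" "j dvd k" "i \<noteq> j"
    and roots: "poly (dynatomic_at c i) \<alpha> = 0" "poly (dynatomic_at c j) \<alpha> = 0"
  shows "multiplier c k \<alpha> = 1"
proof -
  let ?R = "\<Prod>d\<in>{d. d dvd k} - {i} - {j}. dynatomic_at c d"
  have fin: "finite {d. d dvd k}" using k by simp
  have "periodic_poly c k = dynatomic_at c i * (\<Prod>d\<in>{d. d dvd k} - {i}. dynatomic_at c d)"
    unfolding prod_dynatomic_at[OF k] using fin ij by (intro prod.remove) auto
  also have "(\<Prod>d\<in>{d. d dvd k} - {i}. dynatomic_at c d) = dynatomic_at c j * ?R"
    using fin ij by (intro prod.remove) auto
  finally have "periodic_poly c k = dynatomic_at c i * dynatomic_at c j * ?R"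
    by (simp only: mult.assoc)
  then have "poly (pderiv (periodic_poly c k)) \<alpha> = 0"
    using pderiv_double_root[OF roots] by metis
  then show ?thesis by (simp add: pderiv_periodic_poly multiplier_def)
qed

lemma dynatomic_at_root_exact:
  assumes k: "k > 0" and \<alpha>: "poly (dynatomic_at c k) \<alpha> = 0" and mult: "multiplier c k \<alpha> \<noteq> 1"
  shows "\<alpha> \<in> exact_points (quad c) k"
proof -
  obtain j where j: "j > 0" "j dvd k" "\<alpha> \<in> exact_points (quad c) j"
    using ex_exact_period[OF k dynatomic_at_root_fixed[OF k \<alpha>]] .
  have "poly (dynatomic_at c j) \<alpha> = 0" using dynatomic_at_exact_root[OF j(1) j(3)] .
  then have "j = k"
    using common_dynatomic_root_multiplier[OF k j(2) dvd_refl _ _ \<alpha>] mult by blast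
  then show ?thesis using j by simp
qed

lemma pcompose_difference:
  fixes g h :: "'a::idom poly"
  shows "\<exists>Q. pcompose g h - g = (h - [:0, 1:]) * Q \<and> (\<forall>a. poly h a = a \<longrightarrow> poly Q a = poly (pderiv g) a)"
proof (induction g)
  case 0
  show ?case by (intro exI[of _ 0]) simp
next
  case (pCons b g)
  then obtain Q where Q: "pcompose g h - g = (h - [:0, 1:]) * Q"
    "\<And>a. poly h a = a \<Longrightarrow> poly Q a = poly (pderiv g) a" by blast
  have "pcompose (pCons b g) h - pCons b g = h * pcompose g h - [:0, 1:] * g"
    by (simp add: pcompose_pCons)
  also have "\<dots> = h * (pcompose g h - g) + (h - [:0, 1:]) * g"
  proof -
    have "h * p - x * g = h * (p - g) + (h - x) * g" for p x :: "'a poly"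
      by (simp add: algebra_simps)
    then show ?thesis .
  qed
  also have "\<dots> = (h - [:0, 1:]) * (h * Q + g)"
    unfolding Q(1) by (simp only: distrib_left mult.left_commute)
  finally show ?case
    using Q(2) by (intro exI[of _ "h * Q + g"]) (simp add: pderiv_pCons add.commute)
qed

lemma pcompose_quad_iter:
  "pcompose (quad_iter c m) (quad_iter c n) = (quad_iter c (m + n) :: complex poly)"
  by (rule poly_eq_poly_eq_iff[THEN iffD1]) (auto simp: fun_eq_iff poly_pcompose poly_quad_iter funpow_add)

lemma order_ge_2_iff:
  fixes p :: "'a::field_char_0 poly"
  assumes "p \<noteq> 0" "poly p a = 0" "poly (pderiv p) a = 0"
  shows "order a p \<ge> 2"
proof -
  have o: "order a p \<noteq> 0" using assms by (simp add: order_root)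
  have "pderiv p \<noteq> 0"
  proof
    assume "pderiv p = 0"
    then have "degree p = 0" by (simp add: pderiv_eq_0_iff)
    then show False using assms(1,2) by (auto elim: degree_eq_zeroE)
  qed
  then show ?thesis using order_pderiv[of p a] o assms order_root[of "pderiv p" a] by auto
qed

text \<open>
  Let \<open>g = f^k\<close> and \<open>h = g^r\<close>, and let \<open>h(z) - z\<close> have order \<open>M\<close> at \<open>\<alpha>\<close>, with leading coefficient \<open>a\<close>. As \<open>g\<close>
  and \<open>h\<close> commute, \<open>h(g(z)) - g(z)\<close>, which starts with \<open>a \<zeta>^M (z - \<alpha>)^M\<close>, equals \<open>g(h(z)) - g(z)\<close>, which starts with
  \<open>\<zeta> a (z - \<alpha>)^M\<close>. Hence \<open>\<zeta>^(M - 1) = 1\<close> and \<open>r\<close> divides \<open>M - 1\<close>, which is positive because the multiplier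
  of \<open>h\<close> is \<open>1\<close>.
\<close>

lemma parabolic_order:
  assumes k: "k > 0" and r: "r > 0" and \<alpha>: "(quad c ^^ k) \<alpha> = \<alpha>"
    and \<zeta>: "multiplier c k \<alpha> \<in> prim_roots r"
  shows "order \<alpha> (periodic_poly c (k * r)) \<ge> r + 1"
proof -
  define g h F where "g = quad_iter c k" and "h = quad_iter c (k * r)" and "F = periodic_poly c (k * r)"
  define M where "M = order \<alpha> F"
  define \<zeta> where "\<zeta> = multiplier c k \<alpha>"
  define l where "l = [:-\<alpha>, 1:]"
  have \<zeta>1: "\<zeta> ^ r = 1" "\<zeta> \<noteq> 0" using assms r by (auto simp: \<zeta>_def prim_roots_def power_0_left split: if_splits)
  have n: "k * r > 0" using k r by simp
  have F0: "F \<noteq> 0" using degree_periodic_poly(2)[OF n, of c] by (auto simp: F_def)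
  have hF: "F = h - [:0, 1:]" by (simp add: F_def h_def periodic_poly_def)
  have fixn: "(quad c ^^ (k * r)) \<alpha> = \<alpha>" using \<alpha> by (rule funpow_mult_fixed)
  have M2: "M \<ge> 2"
    unfolding M_def
  proof (rule order_ge_2_iff[OF F0])
    show "poly F \<alpha> = 0" using fixn by (simp add: F_def)
    show "poly (pderiv F) \<alpha> = 0"
      using multiplier_mult[OF \<alpha>, of r] \<zeta>1 by (simp add: F_def pderiv_periodic_poly multiplier_def \<zeta>_def)
  qed
  obtain u where u: "F = l ^ M * u" "\<not> l dvd u"
    using order_decomp[OF F0, of \<alpha>] unfolding M_def l_def by blast
  have u0: "poly u \<alpha> \<noteq> 0" using u(2) by (simp only: l_def poly_eq_0_iff_dvd not_False_eq_True)
  obtain Q where Q: "pcompose g h - g = (h - [:0, 1:]) * Q" "poly h \<alpha> = \<alpha> \<Longrightarrow> poly Q \<alpha> = poly (pderiv g) \<alpha>"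
    using pcompose_difference[of g h] by blast
  have Q\<alpha>: "poly Q \<alpha> = \<zeta>"
    using Q(2) fixn by (simp add: h_def poly_quad_iter \<zeta>_def multiplier_def g_def)
  have "poly (g - [:\<alpha>:]) \<alpha> = 0" using \<alpha> by (simp add: g_def poly_quad_iter)
  then obtain v where v: "g - [:\<alpha>:] = l * v" unfolding l_def poly_eq_0_iff_dvd by (auto elim: dvdE)
  have v\<alpha>: "poly v \<alpha> = \<zeta>"
  proof -
    have "poly (pderiv (g - [:\<alpha>:])) \<alpha> = poly v \<alpha>"
    proof -
      have "poly l \<alpha> = 0" "pderiv l = 1" by (simp_all add: l_def pderiv_pCons)
      then show ?thesis unfolding v by (simp add: pderiv_mult)
    qed
    then show ?thesis by (simp add: pderiv_diff pderiv_pCons \<zeta>_def multiplier_def g_def)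
  qed
  have "pcompose g h = pcompose h g"
    by (simp add: g_def h_def pcompose_quad_iter add.commute)
  then have "l ^ M * (u * Q) = pcompose F g"
    using Q(1) unfolding hF[symmetric] u(1)[symmetric] mult.assoc[symmetric]
    by (simp add: hF pcompose_diff pcompose_pCons)
  also have "\<dots> = l ^ M * (v ^ M * pcompose u g)"
  proof -
    have "pcompose l g = l * v" unfolding v[symmetric] by (simp add: l_def pcompose_pCons)
    then show ?thesis unfolding u(1)
      by (simp add: pcompose_mult pcompose_hom.hom_power power_mult_distrib)
  qed
  finally have "u * Q = v ^ M * pcompose u g" by (simp add: l_def)
  then have "poly (u * Q) \<alpha> = poly (v ^ M * pcompose u g) \<alpha>" by simp
  then have "\<zeta> * 1 = \<zeta> ^ M"
    using u0 \<alpha> by (simp add: Q\<alpha> v\<alpha> poly_pcompose g_def poly_quad_iter)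
  also have "\<zeta> ^ M = \<zeta> * \<zeta> ^ (M - 1)" using M2 by (simp flip: power_Suc)
  finally have "\<zeta> ^ (M - 1) = 1" using \<zeta>1 by simp
  then have "r dvd M - 1" using prim_roots_order_dvd[OF assms(4) r] by (simp add: \<zeta>_def)
  then have "r \<le> M - 1" using M2 by (intro dvd_imp_le) auto
  then show ?thesis using M2 by (simp add: M_def F_def)
qed

text \<open>
  Among the proper divisors \<open>d\<close> of \<open>k r\<close> only \<open>d = k\<close> contributes to the order of \<open>f^(k r)(z) - z\<close> at \<open>\<alpha>\<close>, and only \<open>1\<close>,
  since \<open>f^d\<close> has a multiplier different from \<open>1\<close> whenever it fixes \<open>\<alpha>\<close>. All the rest of the order, at
  least \<open>r\<close>, belongs to the dynatomic polynomial of \<open>k r\<close>.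
\<close>

lemma parabolic_order_dynatomic:
  assumes k: "k > 0" and r: "r > 1" and \<alpha>: "\<alpha> \<in> exact_points (quad c) k"
    and \<zeta>: "multiplier c k \<alpha> \<in> prim_roots r"
  shows "order \<alpha> (dynatomic_at c (k * r)) \<ge> r"
    and "order \<alpha> (pderiv (periodic_poly c (k * r))) \<ge> r"
proof -
  let ?F = "periodic_poly c (k * r)"
  have n: "k * r > 0" using k r by simp
  have F0: "?F \<noteq> 0" using degree_periodic_poly(2)[OF n, of c] by auto
  have fix_k: "(quad c ^^ k) \<alpha> = \<alpha>" using \<alpha> by (simp add: exact_points_def)
  have ord: "order \<alpha> ?F \<ge> r + 1" using parabolic_order[OF k _ fix_k \<zeta>] r by simp
  have z1: "multiplier c k \<alpha> \<noteq> 1" using \<zeta> r by (auto simp: prim_roots_def)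
  let ?D = "{d. d dvd k * r \<and> d \<noteq> k * r}"
  let ?R = "\<Prod>d\<in>?D. dynatomic_at c d"
  have split: "?F = dynatomic_at c (k * r) * ?R"
    unfolding prod_dynatomic_at[OF n] by (rule proper_divisors_split[OF n])
  have finD: "finite ?D" using n by simp
  have kD: "k \<in> ?D" using k r by auto
  have split2: "?R = dynatomic_at c k * (\<Prod>d\<in>?D - {k}. dynatomic_at c d)"
    using finD kD by (rule prod.remove)
  have nz: "poly (\<Prod>d\<in>?D - {k}. dynatomic_at c d) \<alpha> \<noteq> 0"
  proof
    assume "poly (\<Prod>d\<in>?D - {k}. dynatomic_at c d) \<alpha> = 0"
    then obtain d where d: "d dvd k * r" "d \<noteq> k * r" "d \<noteq> k" "poly (dynatomic_at c d) \<alpha> = 0"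
      using finD by (auto simp: poly_prod prod_zero_iff)
    have d0: "d > 0" using d(1) n by (auto intro: Nat.gr0I)
    have "k dvd d" using exact_period_dvd[OF \<alpha> k] dynatomic_at_root_fixed[OF d0 d(4)] .
    then obtain s where s: "d = k * s" by (elim dvdE)
    have "multiplier c d \<alpha> = 1"
      using common_dynatomic_root_multiplier[OF d0 \<open>k dvd d\<close> dvd_refl _ dynatomic_at_exact_root[OF k \<alpha>] d(4)] d(3)
      by simp
    then have "multiplier c k \<alpha> ^ s = 1" using multiplier_mult[OF fix_k, of s] s by simp
    then have "r dvd s" using prim_roots_order_dvd[OF \<zeta>] r by simp
    then have "k * r dvd d" using s by simp
    then show False using d(1,2) by (metis dvd_antisym)
  qed
  have o1: "order \<alpha> (dynatomic_at c k) \<le> 1"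
  proof (rule ccontr)
    assume "\<not> ?thesis"
    then have "[:-\<alpha>, 1:] ^ 2 dvd dynatomic_at c k" by (subst order_divides) auto
    also have "dynatomic_at c k dvd periodic_poly c k"
      unfolding prod_dynatomic_at[OF k] using k by (intro dvd_prodI) auto
    finally obtain q where q: "periodic_poly c k = [:-\<alpha>, 1:] * [:-\<alpha>, 1:] * q"
      by (auto simp: power2_eq_square dvd_def)
    have "poly (pderiv (periodic_poly c k)) \<alpha> = 0"
      unfolding q by (rule pderiv_double_root) simp_all
    then show False using z1 by (simp add: pderiv_periodic_poly multiplier_def)
  qed
  have R0: "?R \<noteq> 0" and Dn0: "dynatomic_at c (k * r) \<noteq> 0" using F0 unfolding split by auto
  have "order \<alpha> ?F = order \<alpha> (dynatomic_at c (k * r)) + order \<alpha> ?R"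
    unfolding split using R0 Dn0 by (intro order_mult) simp
  also have "order \<alpha> ?R = order \<alpha> (dynatomic_at c k) + order \<alpha> (\<Prod>d\<in>?D - {k}. dynatomic_at c d)"
    using R0 unfolding split2 by (intro order_mult) simp
  also have "order \<alpha> (\<Prod>d\<in>?D - {k}. dynatomic_at c d) = 0" using nz by (rule order_0I)
  finally show "order \<alpha> (dynatomic_at c (k * r)) \<ge> r" using ord o1 by linarith
  have "pderiv ?F \<noteq> 0"
    using degree_periodic_poly(1)[OF n, of c] by (auto simp: pderiv_eq_0_iff)
  then show "order \<alpha> (pderiv ?F) \<ge> r" 
    using order_pderiv[of ?F \<alpha>] ord F0 funpow_mult_fixed[OF fix_k, of r] by simp
qed

lemma prod_linear_powers_dvd:
  fixes F :: "'a::field poly"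
  assumes "finite I" "inj_on b I" "F \<noteq> 0" "\<And>i. i \<in> I \<Longrightarrow> e i \<le> order (b i) F"
  shows "(\<Prod>i\<in>I. [:- b i, 1:] ^ e i) dvd F"
  using assms
proof (induction I arbitrary: F rule: finite_induct)
  case (insert i I)
  have "[:- b i, 1:] ^ e i dvd F" using insert.prems(2,3) by (subst order_divides) auto
  then obtain G where G: "F = [:- b i, 1:] ^ e i * G" by (elim dvdE)
  have G0: "G \<noteq> 0" using insert.prems(2) unfolding G by auto
  have "(\<Prod>i\<in>I. [:- b i, 1:] ^ e i) dvd G"
  proof (rule insert.IH[OF _ G0])
    show "inj_on b I" using insert.prems(1) by simp
    fix j assume j: "j \<in> I"
    then have "b j \<noteq> b i" using insert.prems(1) insert.hyps(2) by (auto simp: inj_on_def)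
    then have "order (b j) ([:- b i, 1:] ^ e i) = 0" by (intro order_0I) simp
    moreover have "order (b j) F = order (b j) ([:- b i, 1:] ^ e i) + order (b j) G"
      using insert.prems(2) unfolding G by (rule order_mult)
    ultimately show "e j \<le> order (b j) G" using insert.prems(3)[of j] j by simp
  qed
  then show ?case unfolding G prod.insert[OF insert.hyps] by (rule mult_dvd_mono[OF dvd_refl])
qed simp

lemma resultant_order:
  fixes F G :: "complex poly poly"
  assumes F: "lead_coeff F = 1" and G: "degree (map_poly (\<lambda>p. poly p c) G) = degree G" "G \<noteq> 0"
    and D: "D dvd map_poly (\<lambda>p. poly p c) F" "D dvd map_poly (\<lambda>p. poly p c) G" "lead_coeff D = 1"
    and G0: "map_poly (\<lambda>p. poly p c) G \<noteq> 0"
  shows "[:-c, 1:] ^ degree D dvd resultant F G"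
proof -
  let ?ev = "map_poly (\<lambda>p. poly p c)"
  let ?lift = "map_poly (\<lambda>a::complex. [:a:])"
  interpret ev: map_poly_idom_hom "\<lambda>p. poly p c" ..
  have F0: "lead_coeff (?ev F) = 1" "degree (?ev F) = degree F"
    using poly_hom.map_poly_monic[OF F] by auto
  obtain E0 where E0: "?ev F = D * E0" using D(1) by (elim dvdE)
  obtain H0 where H0: "?ev G = D * H0" using D(2) by (elim dvdE)
  have D0: "D \<noteq> 0" using D(3) by auto
  have nz: "E0 \<noteq> 0" "H0 \<noteq> 0" using F0(1) G0 unfolding E0 H0 by auto
  have lE0: "lead_coeff E0 = 1"
    using F0(1) D(3) unfolding E0 lead_coeff_mult by (simp only: mult_1)
  have evl: "?ev (?lift p) = p" for p by (rule poly_eqI) (simp add: coeff_map_poly)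
  have "?ev (?lift E0 * G - ?lift H0 * F) = 0"
    unfolding ev.hom_minus ev.hom_mult evl E0 H0 by (simp add: mult_ac)
  then have "\<forall>i. [:-c, 1:] dvd coeff (?lift E0 * G - ?lift H0 * F) i"
    by (metis coeff_0 coeff_map_poly poly_0 poly_eq_0_iff_dvd)
  then have "[:[:-c, 1:]:] dvd ?lift E0 * G - ?lift H0 * F"
    by (rule const_poly_dvd_iff[THEN iffD2])
  then obtain Y where Y: "?lift E0 * G - ?lift H0 * F = smult [:-c, 1:] Y"
    by (elim dvdE) simp
  show ?thesis
  proof (rule power_dvd_resultant[OF _ _ _ Y])
    show "lead_coeff (?lift E0) = 1"
      using lE0 by (simp only: coeff_lift_hom.hom_lead_coeff) (simp only: one_pCons)
    show "degree (?lift E0) + degree D = degree F"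
      using nz D0 unfolding F0(2)[symmetric] E0 by (simp add: degree_mult_eq)
    show "degree (?lift H0) + degree D \<le> degree G"
      using nz D0 unfolding G(1)[symmetric] H0 by (simp add: degree_mult_eq)
  qed
qed

section \<open>Collisions with shorter cycles\<close>

lemma poly_image_charpoly:
  fixes F G :: "'a::idom poly"
  assumes "degree G > 0"
  shows "poly (image_charpoly F G) x = resultant F ([:x:] - G)"
proof -
  let ?lift = "map_poly (\<lambda>a::'a. [:a:])"
  let ?ev = "map_poly (\<lambda>p::'a poly. poly p x)"
  interpret ev: map_poly_idom_hom "\<lambda>p::'a poly. poly p x" ..
  have evl: "?ev (?lift p) = p" for p by (rule poly_eqI) (simp add: coeff_map_poly)
  have "?ev [:[:0, 1:]:] = [:x:]" by simp
  then have 2: "?ev ([:[:0, 1:]:] - ?lift G) = [:x:] - G" unfolding ev.hom_minus evl by (simp only:)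
  have "degree ([:x:] - G) = degree G"
    using degree_add_eq_right[of "[:x:]" "- G"] assms by simp
  then have "resultant (?ev (?lift F)) (?ev ([:[:0, 1:]:] - ?lift G)) = poly (resultant (?lift F) ([:[:0, 1:]:] - ?lift G)) x"
    unfolding image_charpoly_def using degree_indet_minus[OF assms]
    by (intro poly_hom.resultant_map_poly) (simp_all only: 2 evl coeff_lift_hom.degree_map_poly_hom)
  then show ?thesis unfolding image_charpoly_def 2 evl by simp
qed

lemma map_poly_of_int_indet_c: "map_poly of_int indet_c = [:0, 1:]"
  unfolding indet_c_def by (rule poly_eqI) (simp add: coeff_map_poly coeff_pCons split: nat.split)

lemma delta_val_1_power:
  assumes n: "n > 0"
  shows "delta_val n 1 ^ n = 
    resultant (map_poly (map_poly of_int) (dynatomic n)) ([:1:] - pderiv (quad_iter [:0, 1:] n))"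
proof -
  let ?h = "map_poly of_int :: int poly \<Rightarrow> complex poly"
  interpret hh: map_poly_idom_hom ?h ..
  have "delta_val n 1 ^ n = ?h (poly (delta n ^ n) 1)"
    unfolding delta_val_1[symmetric] by (simp add: of_int_poly_hom.hom_power)
  also have "poly (delta n ^ n) 1 = resultant (dynatomic n) ([:1:] - pderiv (quad_iter indet_c n))"
    unfolding delta_power[OF n] 
    by (rule poly_image_charpoly) (use degree_pderiv_quad_iter_pos[OF n, of indet_c] in simp)
  also have "?h \<dots> = resultant (map_poly ?h (dynatomic n)) (map_poly ?h ([:1:] - pderiv (quad_iter indet_c n)))"
    by (rule of_int_poly_hom.resultant_hom[symmetric])
  also have "map_poly ?h ([:1:] - pderiv (quad_iter indet_c n)) = [:1:] - pderiv (quad_iter [:0, 1:] n)"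
    unfolding hh.hom_minus of_int_poly_hom.map_poly_pderiv of_int_poly_hom.map_poly_quad_iter map_poly_of_int_indet_c
    by simp
  finally show ?thesis .
qed

lemma Delta_proper_root:
  assumes k: "k > 0" and r: "r > 1" and n: "n = k * r"
    and root: "poly (map_poly of_int (Delta_proper n k)) c = 0"
  obtains \<alpha> where "\<alpha> \<in> exact_points (quad c) k" "multiplier c k \<alpha> \<in> prim_roots r"
proof -
  have "(\<Prod>\<zeta>\<in>prim_roots r. poly (delta_at c k) \<zeta>) = 0"
    using root Delta_proper_eq_prod[of r n k] r n k by (simp add: poly_prod poly_delta_val)
  then obtain \<zeta> where \<zeta>: "\<zeta> \<in> prim_roots r" "poly (delta_at c k) \<zeta> = 0"
    using finite_prim_roots[of r] r by (auto simp: prod_zero_iff)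
  then obtain \<alpha> where \<alpha>: "poly (dynatomic_at c k) \<alpha> = 0" "multiplier c k \<alpha> = \<zeta>"
    using poly_delta_at_eq_0_iff[OF k] by blast
  have "\<zeta> \<noteq> 1" using \<zeta>(1) r by (auto simp: prim_roots_def)
  then show ?thesis using that[of \<alpha>] dynatomic_at_root_exact[OF k \<alpha>(1)] \<alpha>(2) \<zeta>(1) by simp
qed

text \<open>
  For each \<open>k\<close> in \<open>S\<close> there is a cycle of length \<open>k\<close> whose multiplier is a primitive \<open>(n div k)\<close>-th root of
  unity. Each of its \<open>k\<close> points is a root of multiplicity at least \<open>n div k\<close> of both \<open>dynatomic n\<close> and
  \<open>1 - (f^n)'\<close> at \<open>c\<close>. Cycles of different length are disjoint, so these two polynomials acquire a common factor
  of degree \<open>n\<close> times the size of \<open>S\<close>, which forces a zero of that order on their resultant.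
\<close>

lemma Delta_collision_order:
  fixes c :: complex
  assumes n: "n > 0"
  defines "S \<equiv> {k. k dvd n \<and> k \<noteq> n \<and> poly (map_poly of_int (Delta_proper n k)) c = 0}"
  shows "[:-c, 1:] ^ (n * card S) dvd delta_val n 1 ^ n"
proof -
  have finS: "finite S" using n by (simp add: S_def)
  have Sk: "k > 0" "n = k * (n div k)" "n div k > 1" if "k \<in> S" for k
  proof -
    have kn: "k dvd n" "k \<noteq> n" using that by (auto simp: S_def)
    then show "k > 0" using n by (auto intro: Nat.gr0I)
    show "n = k * (n div k)" using kn by simp
    then have "n div k \<noteq> 0" "n div k \<noteq> 1" using n kn by (auto intro: Nat.gr0I)
    then show "n div k > 1" by linarith
  qed
  have "\<forall>k\<in>S. \<exists>\<alpha>. \<alpha> \<in> exact_points (quad c) k \<and> multiplier c k \<alpha> \<in> prim_roots (n div k)"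
  proof
    fix k assume k: "k \<in> S"
    have "poly (map_poly of_int (Delta_proper n k)) c = 0" using k by (simp add: S_def)
    then show "\<exists>\<alpha>. \<alpha> \<in> exact_points (quad c) k \<and> multiplier c k \<alpha> \<in> prim_roots (n div k)"
      using Delta_proper_root[OF Sk(1)[OF k] Sk(3)[OF k] Sk(2)[OF k]] by blast
  qed
  then obtain \<alpha> where \<alpha>: "\<And>k. k \<in> S \<Longrightarrow> \<alpha> k \<in> exact_points (quad c) k"
    "\<And>k. k \<in> S \<Longrightarrow> multiplier c k (\<alpha> k) \<in> prim_roots (n div k)" by metis
  \<comment> \<open>the pairs index the points of the chosen cycles\<close>
  define I where "I = (SIGMA k:S. {..<k})"
  define b where "b = (\<lambda>(k, i). (quad c ^^ i) (\<alpha> k))"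
  define e where "e = (\<lambda>(k::nat, i::nat). n div k)"
  have finI: "finite I" using finS by (auto simp: I_def)
  have bex: "b (k, i) \<in> exact_points (quad c) k" "multiplier c k (b (k, i)) \<in> prim_roots (n div k)"
    if k: "k \<in> S" for k i
  proof -
    show ex: "b (k, i) \<in> exact_points (quad c) k" for i using exact_points_iterate[OF \<alpha>(1)[OF k]] by (simp add: b_def)
    have "multiplier c k (b (k, i)) = multiplier c k (\<alpha> k)"
    proof (induction i)
      case (Suc i)
      have "(quad c ^^ k) (b (k, i)) = b (k, i)" using ex by (simp add: exact_points_def)
      then show ?case using Suc multiplier_shift[of k c "b (k, i)"] by (simp add: b_def)
    qed (simp add: b_def)
    then show "multiplier c k (b (k, i)) \<in> prim_roots (n div k)" using \<alpha>(2)[OF k] by simp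
  qed
  have inj: "inj_on b I"
  proof (rule inj_onI)
    fix x y assume xy: "x \<in> I" "y \<in> I" "b x = b y"
    obtain k i l j where kl: "x = (k, i)" "y = (l, j)" by (cases x, cases y)
    have S: "k \<in> S" "l \<in> S" "i < k" "j < l" using xy kl by (auto simp: I_def)
    have "k = l"
      using exact_period_unique[OF bex(1)[OF S(1), of i] _ Sk(1)[OF S(1)] Sk(1)[OF S(2)]]
        bex(1)[OF S(2), of j] xy(3) kl by simp
    moreover have "i = j"
      using exact_orbit_inj[OF \<alpha>(1)[OF S(1)]] S xy(3) \<open>k = l\<close> by (auto simp: kl b_def inj_on_def)
    ultimately show "x = y" using kl by simp
  qed
  define D where "D = (\<Prod>x\<in>I. [:- b x, 1:] ^ e x)"
  have "degree D = (\<Sum>x\<in>I. degree ([:- b x, 1:] ^ e x))"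
    unfolding D_def by (rule degree_prod_eq_sum_degree) simp
  also have "\<dots> = (\<Sum>x\<in>I. e x)" by (simp add: degree_power_eq)
  also have "\<dots> = (\<Sum>k\<in>S. k * (n div k))"
    using finS by (simp add: I_def e_def sum.Sigma[symmetric])
  also have "\<dots> = (\<Sum>k\<in>S. n)" using Sk(2) by (intro sum.cong) auto
  finally have degD: "degree D = n * card S" by simp
  have lD: "lead_coeff D = 1" unfolding D_def lead_coeff_prod lead_coeff_power by simp
  have P0: "dynatomic_at c n \<noteq> 0" using dynatomic_at_monic(2)[OF n, of c] by auto
  have two: "(2::complex) \<noteq> 0" "(2::complex poly) \<noteq> 0" by auto
  have Q0: "pderiv (periodic_poly c n) \<noteq> 0"
    using degree_periodic_poly(1)[OF n, of c] by (auto simp: pderiv_eq_0_iff)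
  have dvd1: "D dvd dynatomic_at c n"
    unfolding D_def
  proof (rule prod_linear_powers_dvd[OF finI inj P0])
    fix x assume "x \<in> I"
    then obtain k i where x: "x = (k, i)" "k \<in> S" by (auto simp: I_def)
    show "e x \<le> order (b x) (dynatomic_at c n)"
      using parabolic_order_dynatomic(1)[OF Sk(1)[OF x(2)] Sk(3)[OF x(2)] bex[OF x(2), of i]] Sk(2)[OF x(2)]
      by (simp add: x e_def)
  qed
  have dvd2: "D dvd pderiv (periodic_poly c n)"
    unfolding D_def
  proof (rule prod_linear_powers_dvd[OF finI inj Q0])
    fix x assume "x \<in> I"
    then obtain k i where x: "x = (k, i)" "k \<in> S" by (auto simp: I_def)
    show "e x \<le> order (b x) (pderiv (periodic_poly c n))"
      using parabolic_order_dynatomic(2)[OF Sk(1)[OF x(2)] Sk(3)[OF x(2)] bex[OF x(2), of i]] Sk(2)[OF x(2)]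
      by (simp add: x e_def)
  qed
  let ?ev = "map_poly (\<lambda>p::complex poly. poly p c)"
  let ?F = "map_poly (map_poly of_int) (dynatomic n) :: complex poly poly"
  let ?G = "[:1:] - pderiv (quad_iter [:0, 1:] n) :: complex poly poly"
  interpret ev: map_poly_idom_hom "\<lambda>p::complex poly. poly p c" ..
  have one: "?ev [:1:] = [:1:]" by simp
  have evF: "?ev ?F = dynatomic_at c n"
    unfolding dynatomic_at_def specialise_def[abs_def] by (subst map_poly_map_poly) (simp_all only: o_def map_poly_0 poly_0)
  have "poly [:0, 1:] c = c" by simp
  then have evG: "?ev ?G = [:1:] - pderiv (quad_iter c n)"
    unfolding ev.hom_minus poly_hom.map_poly_pderiv poly_hom.map_poly_quad_iter one by (simp only:)
  have degG: "degree ([:1:] - pderiv (quad_iter (u::'b::idom) n)) = 2 ^ n - 1" if "(2::'b) \<noteq> 0" for u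
    using degree_add_eq_right[of "[:1:]" "- pderiv (quad_iter u n)"] degree_pderiv_quad_iter(1)[OF that, of u n]
      degree_pderiv_quad_iter_pos[OF n that, of u] by simp
  have G': "[:1:] - pderiv (quad_iter c n) = - pderiv (periodic_poly c n)"
    by (simp add: pderiv_periodic_poly flip: one_pCons)
  have "[:-c, 1:] ^ degree D dvd resultant ?F ?G"
  proof (rule resultant_order)
    show "lead_coeff ?F = 1" 
      by (rule of_int_poly_hom.map_poly_monic(2)) (rule lead_coeff_dynatomic[OF n])
    show "degree (?ev ?G) = degree ?G" unfolding evG degG[OF two(1)] degG[OF two(2)] ..
    show "?ev ?G \<noteq> 0" unfolding evG G' using Q0 by simp
    then show "?G \<noteq> 0" by (metis map_poly_0)
    show "D dvd ?ev ?F" unfolding evF by (rule dvd1)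
    show "D dvd ?ev ?G" unfolding evG G' using dvd2 by simp
  qed (rule lD)
  then show ?thesis unfolding degD delta_val_1_power[OF n] .
qed

section \<open>Behaviour for large parameters\<close>

text \<open>
  On a cycle let \<open>M\<close> be the largest absolute value. From \<open>z ^ 2 = z' - c\<close>, where \<open>z'\<close> is the next point,
  \<open>M ^ 2 \<le> M + norm c\<close>, so \<open>M\<close> is small compared with \<open>c\<close>, and then \<open>norm z ^ 2\<close> is close to \<open>norm c\<close> for every
  point.
\<close>

lemma periodic_orbit_bounds:
  fixes c \<alpha> :: complex
  assumes n: "n > 0" and \<alpha>: "(quad c ^^ n) \<alpha> = \<alpha>"
    and \<epsilon>: "\<epsilon> > 0" and c: "norm c \<ge> (1 + 1 / \<epsilon>) / \<epsilon>"
  shows "(1 - \<epsilon>) * norm c \<le> norm ((quad c ^^ i) \<alpha>) ^ 2"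
    and "norm ((quad c ^^ i) \<alpha>) ^ 2 \<le> (1 + \<epsilon>) * norm c"
proof -
  define z where "z i = (quad c ^^ i) \<alpha>" for i
  have zS: "z (Suc i) = z i ^ 2 + c" for i by (simp add: z_def quad_def)
  have period: "z i = z (i mod n)" for i
  proof -
    have "z i = (quad c ^^ (i mod n + n * (i div n))) \<alpha>" by (simp add: z_def)
    also have "\<dots> = z (i mod n)"
      unfolding z_def using \<alpha> by (subst funpow_add) (simp add: funpow_mult_fixed)
    finally show ?thesis .
  qed
  define M where "M = Max ((\<lambda>i. norm (z i)) ` {..<n})"
  have fin: "finite ((\<lambda>i. norm (z i)) ` {..<n})" by simp
  have ne: "(\<lambda>i. norm (z i)) ` {..<n} \<noteq> {}" using n by auto
  have le_M: "norm (z i) \<le> M" for i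
    unfolding M_def using n by (subst period) (intro Max_ge fin imageI, simp)
  obtain j where j: "norm (z j) = M" using Max_in[OF fin ne] unfolding M_def by auto
  have M0: "M \<ge> 0" using j norm_ge_zero by metis
  have "norm (z j ^ 2) \<le> norm (z (Suc j)) + norm c"
    using norm_triangle_ineq4[of "z (Suc j)" c] by (simp add: zS)
  then have M1: "M ^ 2 \<le> M + norm c" using le_M[of "Suc j"] j by (simp add: norm_power)
  have M: "M \<le> \<epsilon> * norm c"
  proof (rule ccontr)
    assume "\<not> ?thesis"
    then have gt: "M > \<epsilon> * norm c" by simp
    have e1: "\<epsilon> * norm c \<ge> 1 + 1 / \<epsilon>" using c \<epsilon> by (simp add: field_simps)
    then have "M - 1 > 1 / \<epsilon>" using gt by linarith
    moreover have "1 / \<epsilon> > 0" using \<epsilon> by simp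
    moreover have "M > 0" using gt e1 \<epsilon> by (smt (verit) divide_pos_pos)
    ultimately have "M * (M - 1) > (\<epsilon> * norm c) * (1 / \<epsilon>)"
      using gt \<epsilon> by (intro mult_strict_mono) auto
    also have "(\<epsilon> * norm c) * (1 / \<epsilon>) = norm c" using \<epsilon> by simp
    finally show False using M1 by (simp add: power2_eq_square algebra_simps)
  qed
  have "norm (z i) ^ 2 \<le> norm (z (Suc i)) + norm c"
    using norm_triangle_ineq4[of "z (Suc i)" c] by (simp add: zS norm_power)
  then show "norm ((quad c ^^ i) \<alpha>) ^ 2 \<le> (1 + \<epsilon>) * norm c"
    using le_M[of "Suc i"] M by (simp add: z_def algebra_simps)
  have "norm c \<le> norm (z (Suc i)) + norm (z i) ^ 2"
    using norm_triangle_ineq4[of "z (Suc i)" "z i ^ 2"] by (simp add: zS norm_power)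
  then show "(1 - \<epsilon>) * norm c \<le> norm ((quad c ^^ i) \<alpha>) ^ 2"
    using le_M[of "Suc i"] M by (simp add: z_def algebra_simps)
qed

lemma multiplier_bounds:
  fixes c \<alpha> :: complex
  assumes n: "n > 0" and \<alpha>: "(quad c ^^ n) \<alpha> = \<alpha>"
    and \<epsilon>: "\<epsilon> > 0" "\<epsilon> < 1" and c: "norm c \<ge> (1 + 1 / \<epsilon>) / \<epsilon>"
  shows "(1 - \<epsilon>) ^ n * (4 * norm c) ^ n \<le> norm (multiplier c n \<alpha>) ^ 2"
    and "norm (multiplier c n \<alpha>) ^ 2 \<le> (1 + \<epsilon>) ^ n * (4 * norm c) ^ n"
proof -
  have eq: "norm (multiplier c n \<alpha>) ^ 2 = 4 ^ n * (\<Prod>i<n. norm ((quad c ^^ i) \<alpha>) ^ 2)"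
  proof -
    have "((2::real) ^ n) ^ 2 = 4 ^ n" by (simp add: power2_eq_square flip: power_mult_distrib)
    moreover have "norm (multiplier c n \<alpha>) = 2 ^ n * (\<Prod>i<n. norm ((quad c ^^ i) \<alpha>))"
      by (simp add: multiplier_eq_prod norm_mult norm_power prod_norm)
    ultimately show ?thesis by (simp only: power_mult_distrib prod_power_distrib)
  qed
  have "(\<Prod>i<n. (1 - \<epsilon>) * norm c) \<le> (\<Prod>i<n. norm ((quad c ^^ i) \<alpha>) ^ 2)"
    using periodic_orbit_bounds[OF n \<alpha> \<epsilon>(1) c] \<epsilon> by (intro prod_mono) auto
  then show "(1 - \<epsilon>) ^ n * (4 * norm c) ^ n \<le> norm (multiplier c n \<alpha>) ^ 2"
    unfolding eq by (simp add: power_mult_distrib mult_ac)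
  have "(\<Prod>i<n. norm ((quad c ^^ i) \<alpha>) ^ 2) \<le> (\<Prod>i<n. (1 + \<epsilon>) * norm c)"
    using periodic_orbit_bounds[OF n \<alpha> \<epsilon>(1) c] \<epsilon> by (intro prod_mono) auto
  then show "norm (multiplier c n \<alpha>) ^ 2 \<le> (1 + \<epsilon>) ^ n * (4 * norm c) ^ n"
    unfolding eq by (simp add: power_mult_distrib mult_ac)
qed

lemma unit_minus_multiplier_bounds:
  fixes c \<alpha> \<zeta> :: complex
  assumes n: "n > 0" and \<alpha>: "(quad c ^^ n) \<alpha> = \<alpha>" and \<zeta>: "norm \<zeta> = 1"
    and \<epsilon>: "\<epsilon> > 0" "\<epsilon> < 1" and c: "norm c \<ge> (1 + 1 / \<epsilon>) / \<epsilon>"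
    and c': "(1 - \<epsilon>) ^ n * (4 * norm c) ^ n \<ge> (1 / \<epsilon>) ^ 2"
  shows "(1 - \<epsilon>) ^ (n + 2) * (4 * norm c) ^ n \<le> norm (\<zeta> - multiplier c n \<alpha>) ^ 2"
    and "norm (\<zeta> - multiplier c n \<alpha>) ^ 2 \<le> (1 + \<epsilon>) ^ (n + 2) * (4 * norm c) ^ n"
proof -
  define m where "m = norm (multiplier c n \<alpha>)"
  note b = multiplier_bounds[OF n \<alpha> \<epsilon> c, folded m_def]
  have "(1 / \<epsilon>) ^ 2 \<le> m ^ 2" using b(1) c' by linarith
  then have "1 / \<epsilon> \<le> m" by (rule power2_le_imp_le) (simp add: m_def)
  then have m: "1 \<le> \<epsilon> * m" using \<epsilon> by (simp add: field_simps)
  have m0: "m \<ge> 0" by (simp add: m_def)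
  have "m - 1 \<le> norm (\<zeta> - multiplier c n \<alpha>)"
    using norm_triangle_ineq2[of "multiplier c n \<alpha>" \<zeta>] \<zeta> by (simp add: m_def norm_minus_commute)
  then have lo: "(1 - \<epsilon>) * m \<le> norm (\<zeta> - multiplier c n \<alpha>)" using m by (simp add: algebra_simps)
  have "norm (\<zeta> - multiplier c n \<alpha>) \<le> 1 + m"
    using norm_triangle_ineq4[of \<zeta> "multiplier c n \<alpha>"] \<zeta> by (simp add: m_def)
  then have hi: "norm (\<zeta> - multiplier c n \<alpha>) \<le> (1 + \<epsilon>) * m" using m by (simp add: algebra_simps)
  have "(1 - \<epsilon>) ^ (n + 2) * (4 * norm c) ^ n = (1 - \<epsilon>) ^ 2 * ((1 - \<epsilon>) ^ n * (4 * norm c) ^ n)"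
    by (simp only: power_add mult_ac)
  also have "\<dots> \<le> (1 - \<epsilon>) ^ 2 * m ^ 2" using b(1) by (intro mult_left_mono) auto
  also have "\<dots> = ((1 - \<epsilon>) * m) ^ 2" by (simp add: power_mult_distrib)
  also have "\<dots> \<le> norm (\<zeta> - multiplier c n \<alpha>) ^ 2" using lo m0 \<epsilon> by (intro power_mono) auto
  finally show "(1 - \<epsilon>) ^ (n + 2) * (4 * norm c) ^ n \<le> norm (\<zeta> - multiplier c n \<alpha>) ^ 2" .
  have "norm (\<zeta> - multiplier c n \<alpha>) ^ 2 \<le> ((1 + \<epsilon>) * m) ^ 2" using hi by (intro power_mono) auto
  also have "\<dots> = (1 + \<epsilon>) ^ 2 * m ^ 2" by (simp add: power_mult_distrib)
  also have "\<dots> \<le> (1 + \<epsilon>) ^ 2 * ((1 + \<epsilon>) ^ n * (4 * norm c) ^ n)"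
    using b(2) by (intro mult_left_mono) auto
  also have "\<dots> = (1 + \<epsilon>) ^ (n + 2) * (4 * norm c) ^ n" by (simp only: power_add mult_ac)
  finally show "norm (\<zeta> - multiplier c n \<alpha>) ^ 2 \<le> (1 + \<epsilon>) ^ (n + 2) * (4 * norm c) ^ n" .
qed

lemma prod_mset_bounds:
  fixes f :: "'a \<Rightarrow> real"
  assumes "0 \<le> a" "\<And>x. x \<in># A \<Longrightarrow> a \<le> f x \<and> f x \<le> b"
  shows "a ^ size A \<le> (\<Prod>x\<in>#A. f x) \<and> (\<Prod>x\<in>#A. f x) \<le> b ^ size A"
  using assms(2)
proof (induction A)
  case (add x A)
  have IH: "a ^ size A \<le> (\<Prod>x\<in>#A. f x)" "(\<Prod>x\<in>#A. f x) \<le> b ^ size A" using add by auto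
  have x: "a \<le> f x" "f x \<le> b" using add.prems by auto
  have 0: "0 \<le> (\<Prod>x\<in>#A. f x)" using IH(1) assms(1) by (meson order.trans zero_le_power)
  show ?case using IH x 0 assms(1) by (auto intro!: mult_mono)
qed simp

lemma delta_at_bounds:
  fixes c \<zeta> :: complex
  assumes n: "n > 0" and \<zeta>: "norm \<zeta> = 1"
    and \<epsilon>: "\<epsilon> > 0" "\<epsilon> < 1" and c: "norm c \<ge> (1 + 1 / \<epsilon>) / \<epsilon>"
    and c': "(1 - \<epsilon>) ^ n * (4 * norm c) ^ n \<ge> (1 / \<epsilon>) ^ 2"
  defines "N \<equiv> degree (dynatomic n)"
  shows "(1 - \<epsilon>) ^ ((n + 2) * N) * (4 * norm c) ^ (n * N) \<le> norm (poly (delta_at c n) \<zeta>) ^ (2 * n)"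
    and "norm (poly (delta_at c n) \<zeta>) ^ (2 * n) \<le> (1 + \<epsilon>) ^ ((n + 2) * N) * (4 * norm c) ^ (n * N)"
proof -
  let ?A = "proots (dynatomic_at c n)"
  have P0: "dynatomic_at c n \<noteq> 0" using dynatomic_at_monic(2)[OF n, of c] by auto
  have size: "size ?A = N"
    using dynatomic_at_monic(1)[OF n, of c] by (simp add: size_proots_complex N_def)
  have "norm (poly (delta_at c n) \<zeta>) ^ (2 * n) = norm (poly (delta_at c n) \<zeta> ^ n) ^ 2"
    by (simp add: norm_power power_mult[symmetric] mult.commute)
  also have "\<dots> = (\<Prod>\<alpha>\<in>#?A. norm (\<zeta> - multiplier c n \<alpha>) ^ 2)"
  proof -
    have "norm (\<Prod>\<alpha>\<in>#A. \<zeta> - multiplier c n \<alpha>) ^ 2 = (\<Prod>\<alpha>\<in>#A. norm (\<zeta> - multiplier c n \<alpha>) ^ 2)" for A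
      by (induction A) (simp_all add: norm_mult power_mult_distrib)
    then show ?thesis unfolding poly_delta_at_power[OF n] .
  qed
  finally have eq: "norm (poly (delta_at c n) \<zeta>) ^ (2 * n) = (\<Prod>\<alpha>\<in>#?A. norm (\<zeta> - multiplier c n \<alpha>) ^ 2)" .
  have b: "(1 - \<epsilon>) ^ (n + 2) * (4 * norm c) ^ n \<le> norm (\<zeta> - multiplier c n \<alpha>) ^ 2 \<and>
      norm (\<zeta> - multiplier c n \<alpha>) ^ 2 \<le> (1 + \<epsilon>) ^ (n + 2) * (4 * norm c) ^ n" if "\<alpha> \<in># ?A" for \<alpha>
  proof -
    have "(quad c ^^ n) \<alpha> = \<alpha>" using that P0 by (intro dynatomic_at_root_fixed[OF n]) simp
    then show ?thesis using unit_minus_multiplier_bounds[OF n _ \<zeta> \<epsilon> c c'] by blast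
  qed
  have "0 \<le> (1 - \<epsilon>) ^ (n + 2) * (4 * norm c) ^ n" using \<epsilon> by simp
  from prod_mset_bounds[of _ ?A "\<lambda>\<alpha>. norm (\<zeta> - multiplier c n \<alpha>) ^ 2", OF this b]
  have p: "((1 - \<epsilon>) ^ (n + 2) * (4 * norm c) ^ n) ^ N \<le> (\<Prod>\<alpha>\<in>#?A. norm (\<zeta> - multiplier c n \<alpha>) ^ 2)"
    "(\<Prod>\<alpha>\<in>#?A. norm (\<zeta> - multiplier c n \<alpha>) ^ 2) \<le> ((1 + \<epsilon>) ^ (n + 2) * (4 * norm c) ^ n) ^ N"
    unfolding size by blast+
  show "(1 - \<epsilon>) ^ ((n + 2) * N) * (4 * norm c) ^ (n * N) \<le> norm (poly (delta_at c n) \<zeta>) ^ (2 * n)"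
    "norm (poly (delta_at c n) \<zeta>) ^ (2 * n) \<le> (1 + \<epsilon>) ^ ((n + 2) * N) * (4 * norm c) ^ (n * N)"
    using p unfolding eq by (simp_all only: power_mult_distrib power_mult)
qed

text \<open>
  All multipliers of period \<open>n\<close> have absolute value close to \<open>(4 * norm c) ^ (n / 2)\<close> for large \<open>c\<close>, and
  \<open>\<zeta>\<close> is negligible against them; the power \<open>2 * n\<close> avoids roots.
\<close>

lemma delta_val_asymptotics:
  assumes n: "n > 0" and \<zeta>: "norm \<zeta> = 1"
  shows "(\<lambda>m. norm (poly (delta_val n \<zeta>) (of_nat m)) ^ (2 * n) / (4 * real m) ^ (n * degree (dynatomic n))) \<longlonglongrightarrow> 1"
    (is "?f \<longlonglongrightarrow> 1")
proof -
  define K where "K = (n + 2) * degree (dynatomic n)"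
  have bounds: "\<forall>\<^sub>F m in sequentially. (1 - \<epsilon>) ^ K \<le> ?f m \<and> ?f m \<le> (1 + \<epsilon>) ^ K" if \<epsilon>: "\<epsilon> > 0" "\<epsilon> < 1" for \<epsilon>
  proof -
    have t: "filterlim real at_top sequentially" by (rule filterlim_real_sequentially)
    have "\<forall>\<^sub>F m in sequentially. real m \<ge> (1 + 1 / \<epsilon>) / \<epsilon>"
      using t by (simp add: filterlim_at_top)
    moreover have "\<forall>\<^sub>F m in sequentially. real m \<ge> (1 / \<epsilon>) ^ 2 / (1 - \<epsilon>) ^ n"
      using t by (simp add: filterlim_at_top)
    moreover have "\<forall>\<^sub>F m in sequentially. real m \<ge> 1" using t by (simp add: filterlim_at_top)
    ultimately show ?thesis
    proof eventually_elim
      case (elim m)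
      have "(1 / \<epsilon>) ^ 2 \<le> (1 - \<epsilon>) ^ n * real m" using elim(2) \<epsilon> by (simp add: field_simps)
      also have "real m \<le> (4 * real m) ^ n"
      proof -
        have "real m \<le> 4 * real m" by simp
        also have "\<dots> \<le> (4 * real m) ^ n" using elim(3) n by (intro self_le_power) auto
        finally show ?thesis .
      qed
      finally have c': "(1 / \<epsilon>) ^ 2 \<le> (1 - \<epsilon>) ^ n * (4 * real m) ^ n" using \<epsilon> by (simp add: mult_left_mono)
      show ?case
        using delta_at_bounds[OF n \<zeta> \<epsilon>, of "of_nat m"] elim c'
        by (simp add: K_def poly_delta_val field_simps)
    qed
  qed
  show ?thesis
  proof (rule order_tendstoI)
    fix a :: real assume a: "a < 1"
    have "((\<lambda>\<epsilon>::real. (1 - \<epsilon>) ^ K) \<longlongrightarrow> (1 - 0) ^ K) (at_right 0)" by (intro tendsto_intros)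
    then have "\<forall>\<^sub>F \<epsilon> in at_right 0. a < (1 - \<epsilon>) ^ K" using a by (intro order_tendstoD) auto
    moreover have "\<forall>\<^sub>F \<epsilon>::real in at_right 0. \<epsilon> \<in> {0<..<1}" by (rule eventually_at_right_real) simp
    ultimately have "\<forall>\<^sub>F \<epsilon>::real in at_right 0. a < (1 - \<epsilon>) ^ K \<and> \<epsilon> \<in> {0<..<1}" by (rule eventually_conj)
    then obtain \<epsilon> where \<epsilon>: "a < (1 - \<epsilon>) ^ K" "\<epsilon> > 0" "\<epsilon> < 1"
      using eventually_happens'[OF trivial_limit_at_right_real] by fastforce
    show "\<forall>\<^sub>F m in sequentially. a < ?f m"
      using bounds[OF \<epsilon>(2,3)] by eventually_elim (use \<epsilon>(1) in linarith)
  next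
    fix a :: real assume a: "a > 1"
    have "((\<lambda>\<epsilon>::real. (1 + \<epsilon>) ^ K) \<longlongrightarrow> (1 + 0) ^ K) (at_right 0)" by (intro tendsto_intros)
    then have "\<forall>\<^sub>F \<epsilon> in at_right 0. a > (1 + \<epsilon>) ^ K" using a by (intro order_tendstoD) auto
    moreover have "\<forall>\<^sub>F \<epsilon>::real in at_right 0. \<epsilon> \<in> {0<..<1}" by (rule eventually_at_right_real) simp
    ultimately have "\<forall>\<^sub>F \<epsilon>::real in at_right 0. a > (1 + \<epsilon>) ^ K \<and> \<epsilon> \<in> {0<..<1}" by (rule eventually_conj)
    then obtain \<epsilon> where \<epsilon>: "a > (1 + \<epsilon>) ^ K" "\<epsilon> > 0" "\<epsilon> < 1"
      using eventually_happens'[OF trivial_limit_at_right_real] by fastforce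
    show "\<forall>\<^sub>F m in sequentially. a > ?f m"
      using bounds[OF \<epsilon>(2,3)] by eventually_elim (use \<epsilon>(1) in linarith)
  qed
qed

lemma poly_div_power_tendsto_lead_coeff:
  fixes g :: "complex poly"
  shows "(\<lambda>m. norm (poly g (of_nat m)) / real m ^ degree g) \<longlonglongrightarrow> norm (lead_coeff g)"
proof -
  have "(\<lambda>m. poly (reflect_poly g) (inverse (of_nat m))) \<longlonglongrightarrow> poly (reflect_poly g) 0"
    by (intro tendsto_intros tendsto_inverse_0[THEN filterlim_compose] tendsto_of_nat)
  then have "(\<lambda>m. norm (poly (reflect_poly g) (inverse (of_nat m)))) \<longlonglongrightarrow> norm (lead_coeff g)"
    using tendsto_norm by (fastforce simp: poly_0_coeff_0)
  moreover have "\<forall>\<^sub>F m in sequentially. norm (poly (reflect_poly g) (inverse (of_nat m))) =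
      norm (poly g (of_nat m)) / real m ^ degree g"
    using eventually_gt_at_top[of 0]
  proof eventually_elim
    case (elim m)
    then show ?case
      by (subst poly_reflect_poly_nz) (auto simp: norm_mult norm_power norm_inverse norm_divide field_simps)
  qed
  ultimately show ?thesis by (rule Lim_transform_eventually)
qed

text \<open>
  The growth rate of a polynomial along the integers determines its degree and the absolute value of
  its leading coefficient.
\<close>

lemma delta_val_degree:
  assumes n: "n > 0" and \<zeta>: "norm \<zeta> = 1"
  shows degree_delta_val: "2 * degree (delta_val n \<zeta>) = degree (dynatomic n)"
    and norm_lead_coeff_delta_val: "norm (lead_coeff (delta_val n \<zeta>)) = 2 ^ degree (dynatomic n)"
proof -
  define g N d where "g = delta_val n \<zeta>" and "N = degree (dynatomic n)" and "d = degree g"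
  define L where "L = norm (lead_coeff g) ^ (2 * n)"
  let ?b = "\<lambda>m. norm (poly g (of_nat m)) ^ (2 * n) / (4 * real m) ^ (n * N)"
  let ?a = "\<lambda>m. (norm (poly g (of_nat m)) / real m ^ d) ^ (2 * n)"
  have b: "?b \<longlonglongrightarrow> 1" using delta_val_asymptotics[OF n \<zeta>] by (simp add: g_def N_def)
  have a: "?a \<longlonglongrightarrow> L"
    unfolding L_def d_def by (intro tendsto_power poly_div_power_tendsto_lead_coeff)
  have g0: "g \<noteq> 0"
  proof
    assume "g = 0"
    then have "?b = (\<lambda>_. 0)" using n by auto
    then show False using b by (simp add: LIMSEQ_const_iff)
  qed
  then have L0: "L > 0" by (simp add: L_def)
  have b0: "\<forall>\<^sub>F m in sequentially. ?b m > 0" using b by (rule order_tendstoD) simp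
  have q: "(\<lambda>m. ?a m / ?b m) \<longlonglongrightarrow> L / 1" by (intro tendsto_divide a b) simp
  have eq: "\<forall>\<^sub>F m in sequentially. ?a m / ?b m = 4 ^ (n * N) * (real m ^ (n * N) / real m ^ (2 * n * d))"
    using b0 eventually_gt_at_top[of 0]
  proof eventually_elim
    case (elim m)
    then have "norm (poly g (of_nat m)) ^ (2 * n) \<noteq> 0" using n by (auto simp: power_0_left)
    then show ?case using elim(2)
      by (simp add: power_divide power_mult_distrib power_mult[symmetric] field_simps)
  qed
  have "(\<lambda>m. 4 ^ (n * N) * (real m ^ (n * N) / real m ^ (2 * n * d))) \<longlonglongrightarrow> L"
    using Lim_transform_eventually[OF q eq] by simp
  then have "(\<lambda>m. 4 ^ (n * N) * (real m ^ (n * N) / real m ^ (2 * n * d)) / 4 ^ (n * N)) \<longlonglongrightarrow> L / 4 ^ (n * N)"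
    by (intro tendsto_divide tendsto_const) auto
  then have lim: "(\<lambda>m. real m ^ (n * N) / real m ^ (2 * n * d)) \<longlonglongrightarrow> L / 4 ^ (n * N)" by simp
  have inv0: "(\<lambda>m. inverse (real m) ^ j) \<longlonglongrightarrow> 0" if "j > 0" for j
    using tendsto_power[OF lim_inverse_n[where 'a = real], of j] that by (simp add: power_0_left)
  have lt1: "\<not> n * N < 2 * n * d"
  proof
    assume lt: "n * N < 2 * n * d"
    have "\<forall>\<^sub>F m in sequentially. real m ^ (n * N) / real m ^ (2 * n * d) = inverse (real m) ^ (2 * n * d - n * N)"
      using eventually_gt_at_top[of 0]
      by eventually_elim (use lt in \<open>simp add: power_diff field_simps\<close>)
    then have "(\<lambda>m. inverse (real m) ^ (2 * n * d - n * N)) \<longlonglongrightarrow> L / 4 ^ (n * N)"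
      by (rule Lim_transform_eventually[OF lim])
    moreover have "(\<lambda>m. inverse (real m) ^ (2 * n * d - n * N)) \<longlonglongrightarrow> 0" using lt by (intro inv0) simp
    ultimately have "L / 4 ^ (n * N) = 0" by (rule LIMSEQ_unique)
    then show False using L0 by simp
  qed
  have lt2: "\<not> 2 * n * d < n * N"
  proof
    assume lt: "2 * n * d < n * N"
    have "\<forall>\<^sub>F m in sequentially. real m ^ (n * N) / real m ^ (2 * n * d) * inverse (real m) ^ (n * N - 2 * n * d) = 1"
      using eventually_gt_at_top[of 0]
      by eventually_elim (use lt in \<open>simp add: power_diff field_simps\<close>)
    moreover have "(\<lambda>m. real m ^ (n * N) / real m ^ (2 * n * d) * inverse (real m) ^ (n * N - 2 * n * d)) \<longlonglongrightarrow> L / 4 ^ (n * N) * 0"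
      using lt by (intro tendsto_mult lim inv0) simp
    ultimately have "(\<lambda>m. 1::real) \<longlonglongrightarrow> L / 4 ^ (n * N) * 0"
      using Lim_transform_eventually by fastforce
    then show False by (simp add: LIMSEQ_const_iff)
  qed
  have e: "n * N = n * (2 * d)" using lt1 lt2 by linarith
  then have Nd: "N = 2 * d" using n by simp
  then show "2 * degree (delta_val n \<zeta>) = degree (dynatomic n)" by (simp add: g_def d_def N_def)
  have "\<forall>\<^sub>F m in sequentially. real m ^ (n * N) / real m ^ (2 * n * d) = 1"
    using eventually_gt_at_top[of 0] by eventually_elim (simp add: Nd mult_ac)
  then have "(\<lambda>m. 1::real) \<longlonglongrightarrow> L / 4 ^ (n * N)" by (rule Lim_transform_eventually[OF lim])
  then have "L = 4 ^ (n * N)" using L0 by (simp add: LIMSEQ_const_iff)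
  also have "\<dots> = (2 ^ 2) ^ (n * N)" by simp
  also have "\<dots> = (2 ^ N) ^ (2 * n)" by (simp only: power_mult[symmetric] mult_ac)
  finally have "norm (lead_coeff g) ^ (2 * n) = (2 ^ N) ^ (2 * n)" by (simp add: L_def)
  then show "norm (lead_coeff (delta_val n \<zeta>)) = 2 ^ degree (dynatomic n)"
    using n by (auto simp: g_def N_def intro: power_eq_imp_eq_base[of _ "2 * n"])
qed

section \<open>Degrees in the parameter\<close>

lemma degree_Delta_proper:
  assumes m: "m > 0" and r: "r > 0" and n: "n = m * r"
  shows "2 * degree (Delta_proper n m) = totient r * degree (dynatomic m)"
    and "norm (complex_of_int (lead_coeff (Delta_proper n m))) = 2 ^ (totient r * degree (dynatomic m))"
proof -
  have eq: "map_poly complex_of_int (Delta_proper n m) = (\<Prod>\<zeta>\<in>prim_roots r. delta_val m \<zeta>)"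
    by (rule Delta_proper_eq_prod[OF r n m])
  have \<zeta>: "norm \<zeta> = 1" if "\<zeta> \<in> prim_roots r" for \<zeta> using norm_prim_roots[OF that r] .
  have nz: "delta_val m \<zeta> \<noteq> 0" if "\<zeta> \<in> prim_roots r" for \<zeta>
    using norm_lead_coeff_delta_val[OF m \<zeta>[OF that]] by auto
  have "2 * degree (Delta_proper n m) = 2 * degree (map_poly complex_of_int (Delta_proper n m))" by simp
  also have "\<dots> = (\<Sum>\<zeta>\<in>prim_roots r. 2 * degree (delta_val m \<zeta>))"
    unfolding eq using nz by (subst degree_prod_eq_sum_degree) (auto simp: sum_distrib_left)
  also have "\<dots> = (\<Sum>\<zeta>\<in>prim_roots r. degree (dynatomic m))"
    using degree_delta_val[OF m] \<zeta> by (intro sum.cong) auto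
  finally show "2 * degree (Delta_proper n m) = totient r * degree (dynatomic m)"
    by (simp add: card_prim_roots[OF r])
  have "norm (complex_of_int (lead_coeff (Delta_proper n m))) =
      norm (lead_coeff (map_poly complex_of_int (Delta_proper n m)))" by simp
  also have "\<dots> = (\<Prod>\<zeta>\<in>prim_roots r. norm (lead_coeff (delta_val m \<zeta>)))"
    unfolding eq lead_coeff_prod by (rule prod_norm[symmetric])
  also have "\<dots> = (\<Prod>\<zeta>\<in>prim_roots r. 2 ^ degree (dynatomic m))"
    using norm_lead_coeff_delta_val[OF m] \<zeta> by (intro prod.cong) auto
  finally show "norm (complex_of_int (lead_coeff (Delta_proper n m))) = 2 ^ (totient r * degree (dynatomic m))"
    by (simp add: card_prim_roots[OF r] power_mult[symmetric] mult.commute)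
qed

lemma degree_delta_1:
  assumes n: "n > 0"
  shows "2 * degree (poly (delta n) 1) = degree (dynatomic n)" "poly (delta n) 1 \<noteq> 0"
proof -
  show "2 * degree (poly (delta n) 1) = degree (dynatomic n)"
    using degree_delta_val[OF n, of 1] unfolding delta_val_1[symmetric] by simp
  show "poly (delta n) 1 \<noteq> 0"
    using norm_lead_coeff_delta_val[OF n, of 1] unfolding delta_val_1[symmetric] by auto
qed

lemma sum_proper_divisors:
  assumes "n > (0::nat)"
  shows "(\<Sum>d | d dvd n. f d) = f n + (\<Sum>d | d dvd n \<and> d \<noteq> n. (f d :: nat))"
proof -
  have "{d. d dvd n} = insert n {d. d dvd n \<and> d \<noteq> n}" by auto
  moreover have "finite {d. d dvd n \<and> d \<noteq> n}" using assms by simp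
  ultimately show ?thesis by simp
qed

lemma degree_dynatomic_le: "n > 0 \<Longrightarrow> degree (dynatomic n) \<le> 2 ^ n"
  using sum_degree_dynatomic[of n] sum_proper_divisors[of n "\<lambda>d. degree (dynatomic d)"] by simp

lemma proper_divisor_le_half:
  assumes "n > (0::nat)" "d dvd n" "d \<noteq> n"
  shows "d \<in> {1..n div 2}"
proof -
  obtain e where e: "n = d * e" using assms(2) by (elim dvdE)
  have "e \<noteq> 0" "e \<noteq> 1" "d \<noteq> 0" using assms e by auto
  then have "e \<ge> 2" "d \<ge> 1" by auto
  then have "d * 2 \<le> n" unfolding e by (intro mult_le_mono2)
  then show ?thesis using \<open>d \<ge> 1\<close> by simp
qed

lemma sum_powers_of_2: "(\<Sum>d\<in>{1..h}. 2 ^ d) + 2 = (2::nat) ^ (h + 1)"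
  by (induction h) simp_all

text \<open>
  The proper divisors of \<open>n\<close> lie in \<open>{1..n div 2}\<close>, and each contributes at most \<open>2 ^ d\<close> to the sum
  \<open>2 ^ n\<close> of the degrees.
\<close>

lemma degree_dynatomic_ge:
  assumes n: "n > 0"
  shows "2 ^ n + 2 \<le> degree (dynatomic n) + 2 ^ (n div 2 + 1)"
proof -
  have "(\<Sum>d | d dvd n \<and> d \<noteq> n. degree (dynatomic d)) \<le> (\<Sum>d\<in>{1..n div 2}. 2 ^ d)"
  proof -
    have sub: "{d. d dvd n \<and> d \<noteq> n} \<subseteq> {1..n div 2}" using proper_divisor_le_half[OF n] by blast
    have "(\<Sum>d | d dvd n \<and> d \<noteq> n. degree (dynatomic d)) \<le> (\<Sum>d | d dvd n \<and> d \<noteq> n. 2 ^ d)"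
    proof (rule sum_mono)
      fix d assume "d \<in> {d. d dvd n \<and> d \<noteq> n}"
      then have "d > 0" using sub by fastforce
      then show "degree (dynatomic d) \<le> 2 ^ d" by (rule degree_dynatomic_le)
    qed
    also have "\<dots> \<le> (\<Sum>d\<in>{1..n div 2}. 2 ^ d)" using sub by (intro sum_mono2) auto
    finally show ?thesis .
  qed
  then show ?thesis
    using sum_degree_dynatomic[OF n] sum_proper_divisors[OF n, of "\<lambda>d. degree (dynatomic d)"]
      sum_powers_of_2[of "n div 2"] by linarith
qed

lemma degree_dynatomic_pos:
  assumes n: "n > 0"
  shows "degree (dynatomic n) > 0"
proof -
  have "(2::nat) ^ (n div 2 + 1) \<le> 2 ^ n" using n by (intro power_increasing) auto
  then show ?thesis using degree_dynatomic_ge[OF n] by linarith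
qed

section \<open>Parity at the parameter 0\<close>

lemma odd_cyclotomic_even:
  assumes r: "r > 0" and y: "even y"
  shows "odd (poly (cyclotomic r) y)"
proof -
  have "cyclotomic r dvd monom 1 r - 1"
    unfolding prod_cyclotomic[OF r] using r by (intro dvd_prodI) auto
  then have "poly (cyclotomic r) y dvd poly (monom 1 r - 1) y" by (rule poly_hom.hom_dvd)
  moreover have "odd (poly (monom 1 r - 1) y)" using y r by (simp add: poly_monom)
  ultimately show ?thesis using dvd_trans by blast
qed

text \<open>
  At \<open>c = 0\<close> all multipliers of period \<open>m\<close> are \<open>0\<close> or \<open>2 ^ m\<close>, so the \<open>m\<close>-th power of the value in question is
  up to sign a product of values of the \<open>r\<close>-th cyclotomic polynomial at even integers. These values divide
  numbers \<open>y ^ r - 1\<close> and are odd.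
\<close>

lemma odd_Delta_proper_0:
  assumes m: "m > 0" and r: "r > 0" and n: "n = m * r"
  shows "odd (poly (Delta_proper n m) 0)"
proof -
  define E where "E = poly (Delta_proper n m) 0"
  have mult: "\<exists>y::int. even y \<and> multiplier 0 m \<alpha> = of_int y" if \<alpha>: "(quad 0 ^^ m) \<alpha> = \<alpha>" for \<alpha> :: complex
  proof -
    note eq = multiplier_zero_param[of m \<alpha>]
    have \<alpha>': "\<alpha> ^ (2 ^ m) = \<alpha>"
      using \<alpha> poly_quad_iter[of 0 m \<alpha>] by (simp add: quad_iter_zero_param poly_monom)
    have lt: "(2::nat) ^ m \<ge> 2" using power_increasing[of 1 m "2::nat"] m by simp
    show ?thesis
    proof (cases "\<alpha> = 0")
      case True
      then show ?thesis using eq lt by (intro exI[of _ 0]) (simp add: power_0_left)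
    next
      case False
      have "\<alpha> * \<alpha> ^ (2 ^ m - 1) = \<alpha> * 1" using \<alpha>' lt by (simp flip: power_Suc)
      then have "\<alpha> ^ (2 ^ m - 1) = 1" using False by simp
      then show ?thesis using eq m by (intro exI[of _ "2 ^ m"]) simp
    qed
  qed
  have odd_prod: "\<exists>o'::int. odd o' \<and> (\<Prod>\<zeta>\<in>prim_roots r. \<zeta> - of_int y) = of_int o'" if y: "even y" for y
  proof -
    have "(\<Prod>\<zeta>\<in>prim_roots r. \<zeta> - of_int y) = (\<Prod>\<zeta>\<in>prim_roots r. - 1 * (of_int y - \<zeta>))"
      by (rule prod.cong) auto
    also have "\<dots> = (- 1) ^ card (prim_roots r) * poly (map_poly of_int (cyclotomic r)) (of_int y)"
      unfolding prod.distrib cyclotomic[OF r] by (simp add: poly_prod)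
    also have "\<dots> = of_int ((- 1) ^ card (prim_roots r) * poly (cyclotomic r) y)"
      by simp
    finally show ?thesis using odd_cyclotomic_even[OF r y]
      by (intro exI[of _ "(- 1) ^ card (prim_roots r) * poly (cyclotomic r) y"]) auto
  qed
  let ?A = "proots (dynatomic_at 0 m)"
  have P0: "dynatomic_at 0 m \<noteq> 0" using dynatomic_at_monic(2)[OF m, of 0] by auto
  have odd_prod_mset: "\<exists>o'::int. odd o' \<and> (\<Prod>\<alpha>\<in>#A. \<Prod>\<zeta>\<in>prim_roots r. \<zeta> - multiplier 0 m \<alpha>) = of_int o'"
    if "\<forall>\<alpha>\<in>#A. (quad 0 ^^ m) \<alpha> = \<alpha>" for A
    using that
  proof (induction A)
    case empty
    show ?case by (intro exI[of _ 1]) simp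
  next
    case (add \<alpha> A)
    from add.prems have "\<forall>\<alpha>\<in>#A. (quad 0 ^^ m) \<alpha> = \<alpha>" by simp
    from add.IH[OF this]
    obtain o1 :: int where o1: "odd o1" "(\<Prod>\<alpha>\<in>#A. \<Prod>\<zeta>\<in>prim_roots r. \<zeta> - multiplier 0 m \<alpha>) = of_int o1"
      by blast
    have "(quad 0 ^^ m) \<alpha> = \<alpha>" using add.prems by simp
    then obtain y :: int where y: "even y" "multiplier 0 m \<alpha> = of_int y" using mult by blast
    obtain o2 :: int where o2: "odd o2" "(\<Prod>\<zeta>\<in>prim_roots r. \<zeta> - multiplier 0 m \<alpha>) = of_int o2"
      using odd_prod[OF y(1)] unfolding y(2) by blast
    show ?case using o1 o2 by (intro exI[of _ "o2 * o1"]) simp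
  qed
  have "\<forall>\<alpha>\<in>#?A. (quad 0 ^^ m) \<alpha> = \<alpha>" using dynatomic_at_root_fixed[OF m] P0 by auto
  from odd_prod_mset[OF this] obtain o' :: int where o': "odd o'" "(\<Prod>\<alpha>\<in>#?A. \<Prod>\<zeta>\<in>prim_roots r. \<zeta> - multiplier 0 m \<alpha>) = of_int o'"
    by blast
  have "of_int (E ^ m) = poly (map_poly of_int (Delta_proper n m)) (0::complex) ^ m"
    by (simp add: E_def)
  also have "\<dots> = (\<Prod>\<zeta>\<in>prim_roots r. poly (delta_at 0 m) \<zeta> ^ m)"
    unfolding Delta_proper_eq_prod[OF r n m] by (simp add: poly_prod poly_delta_val prod_power_distrib)
  also have "\<dots> = (\<Prod>\<zeta>\<in>prim_roots r. \<Prod>\<alpha>\<in>#?A. \<zeta> - multiplier 0 m \<alpha>)"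
    by (simp only: poly_delta_at_power[OF m])
  also have "\<dots> = (\<Prod>\<alpha>\<in>#?A. \<Prod>\<zeta>\<in>prim_roots r. \<zeta> - multiplier 0 m \<alpha>)"
  proof -
    have "(\<Prod>\<zeta>\<in>prim_roots r. \<Prod>\<alpha>\<in>#A. \<zeta> - multiplier 0 m \<alpha>) =
        (\<Prod>\<alpha>\<in>#A. \<Prod>\<zeta>\<in>prim_roots r. \<zeta> - multiplier 0 m \<alpha>)" for A
      by (induction A) (simp_all add: prod.distrib)
    then show ?thesis .
  qed
  finally have "complex_of_int (E ^ m) = of_int o'" unfolding o'(2) .
  then have "E ^ m = o'" by (simp only: of_int_eq_iff)
  then have "odd (E ^ m)" using o'(1) by simp
  then show ?thesis using m by (simp add: E_def)
qed

section \<open>Divisibility of delta n at 1\<close>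

lemma irreducible_rat_poly_dvd:
  assumes f: "irreducible f" and roots: "poly (map_poly of_rat f) (c::complex) = 0" "poly (map_poly of_rat g) c = 0"
  shows "f dvd g"
proof (rule ccontr)
  interpret oh: map_poly_idom_hom "of_rat :: rat \<Rightarrow> complex" ..
  assume "\<not> f dvd g"
  moreover have "prime_elem f" using f by (rule irreducible_imp_prime_elem)
  ultimately have "coprime f g" using prime_elem_imp_coprime by blast
  moreover define a b where "a = fst (bezout_coefficients f g)" and "b = snd (bezout_coefficients f g)"
  ultimately have ab: "a * f + b * g = 1" using bezout_coefficients_fst_snd[of f g] by simp
  have "poly (map_poly of_rat (a * f + b * g)) c = 0"
    unfolding oh.hom_add oh.hom_mult using roots by simp
  then show False unfolding ab by simp
qed

lemma irreducible_rat_poly_simple_root: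
  assumes irr: "irreducible p" and root: "poly (map_poly of_rat p) (c::complex) = 0"
  shows "poly (map_poly of_rat (pderiv p)) c \<noteq> 0"
proof
  assume "poly (map_poly of_rat (pderiv p)) c = 0"
  then have "p dvd pderiv p" by (rule irreducible_rat_poly_dvd[OF irr root])
  moreover have "p \<noteq> 0" "\<not> is_unit p" using irr by (auto simp: irreducible_def)
  then have "degree p > 0" by (metis is_unit_iff_degree neq0_conv)
  then have "\<not> p dvd pderiv p" by (intro not_dvd_pderiv) auto
  ultimately show False by contradiction
qed

lemma map_poly_of_rat_of_int: "map_poly of_rat (map_poly rat_of_int p) = (map_poly of_int p :: complex poly)"
  by (subst map_poly_map_poly) (auto simp: o_def)

lemma irreducible_int_poly_order_le_1:
  assumes "irreducible (map_poly rat_of_int p)"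
  shows "order c (map_poly of_int p :: complex poly) \<le> 1"
proof (cases "poly (map_poly of_int p) c = 0")
  case True
  have p0: "map_poly of_int p \<noteq> (0 :: complex poly)" using assms by auto
  have "poly (map_poly of_rat (pderiv (map_poly rat_of_int p))) c \<noteq> 0"
    using irreducible_rat_poly_simple_root[OF assms] True unfolding map_poly_of_rat_of_int by blast
  also have "map_poly of_rat (pderiv (map_poly rat_of_int p)) = pderiv (map_poly of_int p :: complex poly)"
    unfolding of_rat_hom.map_poly_pderiv map_poly_of_rat_of_int ..
  finally show ?thesis using order_simple_root[OF p0 True] by simp
next
  case False
  then show ?thesis by (simp add: order_0I)
qed

lemma dvd_if_order_le:
  fixes p q :: "'a::alg_closed_field poly"
  assumes p: "p \<noteq> 0" and q: "q \<noteq> 0" and ord: "\<And>c. order c p \<le> order c q"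
  shows "p dvd q"
proof -
  let ?p = "\<lambda>p. \<Prod>b\<in>#proots p. [:-b, 1::'a:]"
  have split: "f = smult (lead_coeff f) (?p f)" if "f \<noteq> 0" for f :: "'a poly"
  proof -
    obtain B where B: "f = smult (lead_coeff f) (\<Prod>b\<in>#B. [:-b, 1:])"
      using alg_closed_imp_factorization[OF \<open>f \<noteq> 0\<close>] by blast
    have "proots f = proots (smult (lead_coeff f) (\<Prod>b\<in>#B. [:-b, 1:]))"
      using B by (rule arg_cong)
    also have "\<dots> = proots (\<Prod>b\<in>#B. [:-b, 1:])" by (rule proots_smult) (use that in simp)
    also have "\<dots> = B" by (rule proots_prod_mset_linear)
    finally have "proots f = B" .
    then show ?thesis using B by simp
  qed
  have "proots p \<subseteq># proots q"
    using p q ord by (intro mset_subset_eqI) simp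
  then obtain C where "proots q = proots p + C" by (auto simp: mset_subset_eq_exists_conv)
  then have "?p p dvd ?p q" by simp
  then show ?thesis
    using p q by (subst split[OF p], subst split[OF q]) (simp add: smult_dvd_iff dvd_smult)
qed

lemma int_poly_dvd_of_odd_const:
  fixes D g s :: "int poly"
  assumes odd: "odd (poly D 0)" and eq: "smult (2 ^ i) g = D * s"
  shows "D dvd g"
  using eq
proof (induction i arbitrary: s)
  case (Suc i)
  have "prime_elem [:2::int:]" by (simp add: prime_elem_const_poly_iff)
  moreover have "[:2:] dvd D * s" unfolding Suc.prems[symmetric] by (simp add: const_poly_dvd_iff)
  moreover have "\<not> [:2:] dvd D" using odd by (auto simp: const_poly_dvd_iff poly_0_coeff_0)
  ultimately have "[:2:] dvd s" by (auto dest: prime_elem_dvd_multD)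
  then obtain t where t: "s = smult 2 t" by (elim dvdE) simp
  have "smult 2 (smult (2 ^ i) g - D * t) = 0" using Suc.prems by (simp add: t smult_diff_right)
  then have "smult (2 ^ i) g = D * t" by simp
  then show ?case by (rule Suc.IH)
qed simp

text \<open>
  Pseudo-division by \<open>D\<close> only introduces a power of the leading coefficient, which is a power of \<open>2\<close> up to
  sign, and this power can be cancelled because \<open>D\<close> is nonzero modulo the prime \<open>2\<close>.
\<close>

lemma int_poly_dvd_of_complex_dvd:
  fixes D g :: "int poly"
  assumes lead: "norm (complex_of_int (lead_coeff D)) = 2 ^ j" and odd: "odd (poly D 0)"
    and dvd: "map_poly complex_of_int D dvd map_poly of_int g"
  shows "D dvd g"
proof -
  have D0: "D \<noteq> 0" using odd by auto
  obtain s t where st: "pseudo_divmod g D = (s, t)" by (cases "pseudo_divmod g D")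
  define e where "e = Suc (degree g) - degree D"
  have eq: "smult (lead_coeff D ^ e) g = D * s + t" and t: "t = 0 \<or> degree t < degree D"
    using pseudo_divmod[OF D0 st] by (auto simp: e_def)
  have "map_poly complex_of_int t = smult (of_int (lead_coeff D ^ e)) (map_poly of_int g) - map_poly of_int D * map_poly of_int s"
  proof -
    have "t = smult (lead_coeff D ^ e) g - D * s" using eq by simp
    then show ?thesis by (simp only: of_int_poly_hom.hom_minus of_int_poly_hom.hom_mult of_int_hom.map_poly_hom_smult)
  qed
  then have "map_poly complex_of_int D dvd map_poly of_int t"
    using dvd by (simp add: dvd_smult)
  have "t = 0"
  proof (rule ccontr)
    assume t0: "t \<noteq> 0"
    then have "map_poly complex_of_int t \<noteq> 0" by simp
    from dvd_imp_degree_le[OF \<open>map_poly complex_of_int D dvd map_poly of_int t\<close> this]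
    show False using t t0 by simp
  qed
  have "\<bar>lead_coeff D\<bar> = 2 ^ j"
  proof -
    have "real_of_int \<bar>lead_coeff D\<bar> = real_of_int (2 ^ j)" using lead by simp
    then show ?thesis by (simp only: of_int_eq_iff)
  qed
  then have "lead_coeff D = 2 ^ j \<or> lead_coeff D = - (2 ^ j)" by linarith
  then have "lead_coeff D ^ e = 2 ^ (j * e) \<or> lead_coeff D ^ e = - (2 ^ (j * e))"
    by (cases "even e") (auto simp: power_mult)
  then have "smult (2 ^ (j * e)) g = D * s \<or> smult (2 ^ (j * e)) g = D * (- s)"
    using eq \<open>t = 0\<close> by (auto simp: minus_equation_iff[of _ "D * s"])
  then show ?thesis using int_poly_dvd_of_odd_const[OF odd] by blast
qed

text \<open>
  This justifies the definite description of \<open>Delta n n\<close>. By irreducibility the \<open>Delta_proper n k\<close> have simple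
  complex roots, so the order of their product at a parameter \<open>c\<close> is the number of those that vanish at
  \<open>c\<close>. By \<open>Delta_collision_order\<close> the value of \<open>delta n\<close> at \<open>1\<close> has at least this order. Hence the product
  divides it over the complex numbers, and then over the integers.
\<close>

lemma delta_1_factorization:
  assumes n: "n > 0"
    and irr: "\<And>k. k dvd n \<Longrightarrow> k \<noteq> n \<Longrightarrow> irreducible (map_poly rat_of_int (Delta_proper n k))"
  shows "poly (delta n) 1 = Delta n n * (\<Prod>k | k dvd n \<and> k \<noteq> n. Delta_proper n k)"
proof -
  let ?P = "{k. k dvd n \<and> k \<noteq> n}"
  let ?h = "map_poly complex_of_int"
  define D where "D = (\<Prod>k\<in>?P. Delta_proper n k)"
  define g where "g = poly (delta n) 1"
  have finP: "finite ?P" using n by simp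
  have kr: "k > 0" "n div k > 0" "n = k * (n div k)" if "k \<in> ?P" for k
    using that n by (auto intro: Nat.gr0I dest: dvd_imp_le)
  have oddk: "odd (poly (Delta_proper n k) 0)" if "k \<in> ?P" for k
    by (rule odd_Delta_proper_0[OF kr[OF that]])
  have D0: "odd (poly D 0)"
    unfolding D_def poly_prod even_prod_iff[OF finP] using oddk by blast
  have Dk0: "?h (Delta_proper n k) \<noteq> 0" if "k \<in> ?P" for k
  proof
    assume "?h (Delta_proper n k) = 0"
    then have "Delta_proper n k = 0" by (simp only: of_int_poly_hom.hom_0_iff)
    then show False using oddk[OF that] by simp
  qed
  have g0: "g \<noteq> 0" using degree_delta_1(2)[OF n] by (simp add: g_def)
  have hD: "?h D = (\<Prod>k\<in>?P. ?h (Delta_proper n k))"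
    unfolding D_def by (rule of_int_poly_hom.hom_prod)
  have hD0: "?h D \<noteq> 0" unfolding hD prod_zero_iff[OF finP] using Dk0 by blast
  have lead: "norm (complex_of_int (lead_coeff D)) = 2 ^ (\<Sum>k\<in>?P. totient (n div k) * degree (dynatomic k))"
  proof -
    have "norm (complex_of_int (lead_coeff D)) = (\<Prod>k\<in>?P. norm (complex_of_int (lead_coeff (Delta_proper n k))))"
      unfolding D_def lead_coeff_prod of_int_prod by (rule prod_norm[symmetric])
    also have "\<dots> = (\<Prod>k\<in>?P. 2 ^ (totient (n div k) * degree (dynatomic k)))"
      by (intro prod.cong refl degree_Delta_proper(2) kr)
    finally show ?thesis by (simp add: power_sum)
  qed
  have "?h D dvd ?h g"
  proof (rule dvd_if_order_le[OF hD0])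
    show hg0: "?h g \<noteq> 0" using g0 by simp
    fix c
    let ?S = "{k. k dvd n \<and> k \<noteq> n \<and> poly (?h (Delta_proper n k)) c = 0}"
    have "order c (?h D) = (\<Sum>k\<in>?P. order c (?h (Delta_proper n k)))"
    proof -
      have "finite Q \<Longrightarrow> Q \<subseteq> ?P \<Longrightarrow> order c (\<Prod>k\<in>Q. ?h (Delta_proper n k)) = (\<Sum>k\<in>Q. order c (?h (Delta_proper n k)))" for Q
      proof (induction Q rule: finite_induct)
        case (insert k Q)
        have "(\<Prod>k\<in>insert k Q. ?h (Delta_proper n k)) \<noteq> 0"
          using insert Dk0 by (subst prod_zero_iff) auto
        then have "order c (?h (Delta_proper n k) * (\<Prod>k\<in>Q. ?h (Delta_proper n k))) =
            order c (?h (Delta_proper n k)) + order c (\<Prod>k\<in>Q. ?h (Delta_proper n k))"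
          using insert by (intro order_mult) simp
        then show ?case using insert by simp
      qed (simp add: order_0I)
      then show ?thesis unfolding hD using finP by blast
    qed
    also have "\<dots> \<le> (\<Sum>k\<in>?P. if k \<in> ?S then 1 else 0)"
    proof (rule sum_mono)
      fix k assume k: "k \<in> ?P"
      show "order c (?h (Delta_proper n k)) \<le> (if k \<in> ?S then 1 else 0)"
        using irreducible_int_poly_order_le_1[OF irr, of k c] k by (auto simp: order_0I)
    qed
    also have "\<dots> = card ?S"
      using finP by (subst sum.inter_filter[symmetric]) (auto intro!: arg_cong[of _ _ card])
    also have "\<dots> \<le> order c (?h g)"
    proof -
      have "[:-c, 1:] ^ (n * card ?S) dvd ?h g ^ n"
        using Delta_collision_order[OF n, of c] unfolding g_def delta_val_1 .
      then have "n * card ?S \<le> order c (?h g ^ n)"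
        using hg0 by (subst (asm) order_divides) auto
      also have "order c (?h g ^ n) = n * order c (?h g)"
      proof (induction n)
        case (Suc n)
        then show ?case using hg0 by (simp add: order_mult)
      qed (simp add: order_0I)
      finally show ?thesis using n by simp
    qed
    finally show "order c (?h D) \<le> order c (?h g)" .
  qed
  then have "D dvd g" by (rule int_poly_dvd_of_complex_dvd[OF lead D0])
  then obtain q where "g = D * q" by (rule dvdE)
  then have q: "g = q * D" by (simp only: mult.commute)
  have D_nz: "D \<noteq> 0" using D0 by auto
  have "Delta n n = (THE d. g = d * D)" 
    unfolding Delta_def g_def D_def by (rule if_P) (rule refl)
  also have "\<dots> = q"
  proof (rule the_equality)
    fix d assume "g = d * D"
    then have "(d - q) * D = 0" using q by (simp only: left_diff_distrib diff_self)
    then show "d = q" using D_nz by simp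
  qed (rule q)
  finally show ?thesis using q unfolding g_def D_def by (simp only:)
qed

lemma degree_Delta_diagonal:
  assumes n: "n > 0"
    and irr: "\<And>k. k dvd n \<Longrightarrow> k \<noteq> n \<Longrightarrow> irreducible (map_poly rat_of_int (Delta_proper n k))"
  shows "degree (dynatomic n) = 2 * degree (Delta n n) +
    (\<Sum>k | k dvd n \<and> k \<noteq> n. totient (n div k) * degree (dynatomic k))"
proof -
  let ?P = "{k. k dvd n \<and> k \<noteq> n}"
  have kr: "k > 0" "n div k > 0" "n = k * (n div k)" if "k \<in> ?P" for k
    using that n by (auto intro: Nat.gr0I dest: dvd_imp_le)
  have eq: "poly (delta n) 1 = Delta n n * (\<Prod>k\<in>?P. Delta_proper n k)"
    by (rule delta_1_factorization[OF n]) (rule irr)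
  have nz: "Delta n n \<noteq> 0" "(\<Prod>k\<in>?P. Delta_proper n k) \<noteq> 0"
    using eq degree_delta_1(2)[OF n] by auto
  have "degree (dynatomic n) = 2 * degree (poly (delta n) 1)"
    by (rule degree_delta_1(1)[OF n, symmetric])
  also have "\<dots> = 2 * degree (Delta n n * (\<Prod>k\<in>?P. Delta_proper n k))"
    unfolding eq ..
  also have "degree (Delta n n * (\<Prod>k\<in>?P. Delta_proper n k)) = degree (Delta n n) + (\<Sum>k\<in>?P. degree (Delta_proper n k))"
  proof -
    have "finite ?P" using n by simp
    then have nzk: "Delta_proper n k \<noteq> 0" if "k \<in> ?P" for k
      using nz(2) that unfolding prod_zero_iff[OF \<open>finite ?P\<close>] by blast
    have "degree (\<Prod>k\<in>?P. Delta_proper n k) = (\<Sum>k\<in>?P. degree (Delta_proper n k))"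
      using nzk by (intro degree_prod_eq_sum_degree ballI)
    then show ?thesis unfolding degree_mult_eq[OF nz] by simp
  qed
  also have "2 * (degree (Delta n n) + (\<Sum>k\<in>?P. degree (Delta_proper n k))) =
      2 * degree (Delta n n) + (\<Sum>k\<in>?P. 2 * degree (Delta_proper n k))"
    by (simp add: sum_distrib_left)
  also have "(\<Sum>k\<in>?P. 2 * degree (Delta_proper n k)) = (\<Sum>k\<in>?P. totient (n div k) * degree (dynatomic k))"
    by (intro sum.cong refl degree_Delta_proper(1) kr)
  finally show ?thesis .
qed

section \<open>Which degrees equal 4\<close>

lemma proper_divisors_eq_filter:
  assumes "n > 0"
  shows "{d. d dvd n \<and> d \<noteq> n} = set (filter (\<lambda>d. d dvd n) [1..<n])"
  using assms by (auto simp: Suc_le_eq intro!: Nat.gr0I dest: dvd_imp_le)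

lemma proper_divisors_small:
  "{d::nat. d dvd 1 \<and> d \<noteq> 1} = {}" "{d::nat. d dvd 2 \<and> d \<noteq> 2} = {1}"
  "{d::nat. d dvd 3 \<and> d \<noteq> 3} = {1}" "{d::nat. d dvd 4 \<and> d \<noteq> 4} = {1, 2}"
  "{d::nat. d dvd 5 \<and> d \<noteq> 5} = {1}" "{d::nat. d dvd 6 \<and> d \<noteq> 6} = {1, 2, 3}"
  "{d::nat. d dvd 7 \<and> d \<noteq> 7} = {1}" "{d::nat. d dvd 8 \<and> d \<noteq> 8} = {1, 2, 4}"
  by (subst proper_divisors_eq_filter, simp, code_simp)+

lemma degree_dynatomic_small:
  "degree (dynatomic 1) = 2" "degree (dynatomic 2) = 2" "degree (dynatomic 3) = 6"
  "degree (dynatomic 4) = 12" "degree (dynatomic 5) = 30" "degree (dynatomic 6) = 54"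
  "degree (dynatomic 7) = 126" "degree (dynatomic 8) = 240"
proof -
  have rec: "degree (dynatomic n) = 2 ^ n - (\<Sum>d | d dvd n \<and> d \<noteq> n. degree (dynatomic d))" if "n > 0" for n
    using sum_degree_dynatomic[OF that] sum_proper_divisors[OF that, of "\<lambda>d. degree (dynatomic d)"] by simp
  show 1: "degree (dynatomic 1) = 2" by (subst rec) (simp_all add: proper_divisors_small)
  show 2: "degree (dynatomic 2) = 2" by (subst rec) (simp_all only: proper_divisors_small, simp_all add: 1[simplified])
  show 3: "degree (dynatomic 3) = 6" by (subst rec) (simp_all only: proper_divisors_small, simp_all add: 1[simplified])
  show 4: "degree (dynatomic 4) = 12" by (subst rec) (simp_all only: proper_divisors_small, simp_all add: 1[simplified] 2)
  show "degree (dynatomic 5) = 30" by (subst rec) (simp_all only: proper_divisors_small, simp_all add: 1[simplified])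
  show "degree (dynatomic 6) = 54" by (subst rec) (simp_all only: proper_divisors_small, simp_all add: 1[simplified] 2 3)
  show "degree (dynatomic 7) = 126" by (subst rec) (simp_all only: proper_divisors_small, simp_all add: 1[simplified])
  show "degree (dynatomic 8) = 240" by (subst rec) (simp_all only: proper_divisors_small, simp_all add: 1[simplified] 2 4)
qed

lemma totient_small: "totient 3 = 2" "totient 5 = 4" "totient 7 = 6" "totient 8 = 4"
  "totient 15 = 8" "totient 20 = 8" "totient 24 = 8"
  by code_simp+

text \<open>
  Every prime power dividing \<open>r\<close> has a totient dividing \<open>4\<close>, which bounds its exponent and shows that \<open>r\<close>
  divides \<open>120 = 8 * 3 * 5\<close>; the remaining divisors are inspected.
\<close>

lemma totient_eq_4D:
  assumes r: "totient r = 4"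
  shows "r \<in> {5, 8, 10, 12}"
proof -
  have tot: "totient d dvd 4" if "d dvd r" for d using totient_dvd[OF that] r by simp
  have r0: "r > 0" using r by (intro Nat.gr0I) auto
  have "r dvd 120"
  proof (rule multiplicity_le_imp_dvd)
    fix p :: nat assume p: "prime p"
    define e where "e = multiplicity p r"
    have "p ^ e dvd 120"
    proof (cases "e = 0")
      case False
      have "p ^ e dvd r" by (simp add: e_def multiplicity_dvd)
      then have d: "p ^ (e - 1) * (p - 1) dvd 4"
        using tot[of "p ^ e"] False p by (simp add: totient_prime_power)
      have dp: "p - 1 dvd 4" and de: "p ^ (e - 1) dvd 4" using d by (auto dest: dvd_mult_left dvd_mult_right)
      have "p - 1 \<le> 4" using dp by (auto dest: dvd_imp_le)
      then have "p \<in> {0, 1, 2, 3, 4, 5}" by auto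
      then have "p = 2 \<or> p = 3 \<or> p = 5" using p dp by auto
      then show ?thesis
      proof (elim disjE)
        assume p2: "p = 2"
        have "(2::nat) ^ (e - 1) \<le> 2 ^ 2" using de p2 by (auto dest: dvd_imp_le)
        then have "e - 1 \<le> 2" by (rule power_le_imp_le_exp[rotated]) simp
        then have "(2::nat) ^ e dvd 2 ^ 3" by (intro le_imp_power_dvd) simp
        moreover have "(2::nat) ^ 3 dvd 120" by simp
        ultimately show ?thesis unfolding p2 by (rule dvd_trans)
      next
        assume p3: "p = 3"
        have "(3::nat) ^ (e - 1) * 2 \<le> 4" using d p3 by (intro dvd_imp_le) auto
        then have "(3::nat) ^ (e - 1) \<le> 2" by simp
        then have "e - 1 = 0" using self_le_power[of "3::nat" "e - 1"] by (intro ccontr[of "e - 1 = 0"]) auto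
        then show ?thesis using False p3 by (simp add: le_Suc_eq)
      next
        assume p5: "p = 5"
        have "(5::nat) ^ (e - 1) \<le> 4" using de p5 by (auto dest: dvd_imp_le)
        then have "e - 1 = 0" using self_le_power[of "5::nat" "e - 1"] by (intro ccontr[of "e - 1 = 0"]) auto
        then show ?thesis using False p5 by (simp add: le_Suc_eq)
      qed
    qed simp
    then show "multiplicity p r \<le> multiplicity p 120"
      unfolding e_def using p by (intro multiplicity_geI) (auto dest: prime_gt_1_nat)
  qed (use r0 in auto)
  moreover have "{d::nat. d dvd 120} = set (filter (\<lambda>d. d dvd 120) [1..<121])"
    by (auto simp: Suc_le_eq less_Suc_eq_le intro!: Nat.gr0I dest: dvd_imp_le)
  moreover have "set (filter (\<lambda>d. d dvd 120) [1..<121]) =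
      {1, 2, 3, 4, 5, 6, 8, 10, 12, 15, 20, 24, 30, 40, 60, 120::nat}" by code_simp
  ultimately have "r \<in> {1, 2, 3, 4, 5, 6, 8, 10, 12, 15, 20, 24, 30, 40, 60, 120}" by blast
  moreover have "\<not> 15 dvd r" "\<not> 20 dvd r" "\<not> 24 dvd r"
    using tot[of 15] tot[of 20] tot[of 24] by (auto simp: totient_small)
  ultimately show ?thesis using r by (auto simp: totient_small)
qed

lemma proper_degree_4D:
  assumes k: "k > 0" and eq: "totient r * degree (dynatomic k) = 8"
  shows "(k = 1 \<or> k = 2) \<and> totient r = 4"
proof -
  have t: "totient r > 0" using eq by (intro Nat.gr0I) auto
  have le: "degree (dynatomic k) \<le> 8" using eq t by (metis le_add2 mult_eq_if add.commute le_add1 neq0_conv)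
  have "k < 5"
  proof (rule ccontr)
    assume "\<not> k < 5"
    then have k5: "k \<ge> 5" by simp
    have "(2::nat) ^ (k div 2 + 1) \<le> 2 ^ (k - 2)" using k5 by (intro power_increasing) auto
    moreover have "(2::nat) ^ k = 4 * 2 ^ (k - 2)"
      using k5 by (subst le_add_diff_inverse[of 2 k, symmetric]) (simp_all only: power_add, auto)
    moreover have "(2::nat) ^ 3 \<le> 2 ^ (k - 2)" using k5 by (intro power_increasing) auto
    ultimately show False using degree_dynatomic_ge[OF k] le by simp
  qed
  then have "k = 1 \<or> k = 2 \<or> k = 3 \<or> k = 4" using k by auto
  then show ?thesis using eq le degree_dynatomic_small by (elim disjE) (auto, presburger+)
qed

text \<open>
  The left-hand side is about \<open>2 ^ n\<close> and the right-hand side at most of the order of \<open>n * 2 ^ (n / 2)\<close>, which decides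
  all \<open>n \<ge> 9\<close>. For \<open>n \<le> 8\<close> the degrees are computed.
\<close>

lemma diagonal_degree_neq_4:
  assumes n: "n > 0"
  shows "degree (dynatomic n) \<noteq> 8 + (\<Sum>k | k dvd n \<and> k \<noteq> n. totient (n div k) * degree (dynatomic k))"
proof
  assume eq: "degree (dynatomic n) = 8 + (\<Sum>k | k dvd n \<and> k \<noteq> n. totient (n div k) * degree (dynatomic k))"
  consider "n \<ge> 9" | "n \<in> {1, 2, 3, 4, 5, 6, 7, 8}" using n by force
  then show False
  proof cases
    case 1
    define h where "h = n div 2"
    have "(\<Sum>k | k dvd n \<and> k \<noteq> n. totient (n div k) * degree (dynatomic k)) \<le>
        (\<Sum>k | k dvd n \<and> k \<noteq> n. n * 2 ^ k)"
    proof (rule sum_mono)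
      fix k assume "k \<in> {k. k dvd n \<and> k \<noteq> n}"
      then have k: "k > 0" using n by (auto intro: Nat.gr0I)
      have "totient (n div k) \<le> n" using totient_le[of "n div k"] div_le_dividend[of n k] by linarith
      then show "totient (n div k) * degree (dynatomic k) \<le> n * 2 ^ k"
        using degree_dynatomic_le[OF k] by (rule mult_le_mono)
    qed
    also have "\<dots> \<le> (\<Sum>k\<in>{1..h}. n * 2 ^ k)"
      unfolding h_def using proper_divisor_le_half[OF n] by (intro sum_mono2) auto
    also have "\<dots> = n * (\<Sum>k\<in>{1..h}. 2 ^ k)" by (rule sum_distrib_left[symmetric])
    finally have "degree (dynatomic n) + 2 * n \<le> 8 + n * ((\<Sum>k\<in>{1..h}. 2 ^ k) + 2)"
      using eq by simp
    then have "2 ^ n + 2 + 2 * n \<le> 8 + n * 2 ^ (h + 1) + 2 ^ (h + 1)"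
      unfolding sum_powers_of_2 using degree_dynatomic_ge[OF n] unfolding h_def[symmetric] by linarith
    then have le: "2 ^ n + 2 * n \<le> 6 + (n + 1) * 2 ^ (h + 1)" by (simp add: algebra_simps)
    show False
    proof (cases "n = 9")
      case True
      then show False using le by (simp add: h_def)
    next
      case False
      then have h5: "h \<ge> 5" using 1 by (auto simp: h_def)
      have pow: "4 * h + 4 \<le> (2::nat) ^ h" using h5
        by (induction h rule: dec_induct) auto
      have "(n + 1) * 2 ^ (h + 1) \<le> (4 * h + 4) * 2 ^ h"
      proof -
        have "n + 1 \<le> 2 * h + 2" by (simp add: h_def)
        then have "(n + 1) * 2 * 2 ^ h \<le> (2 * h + 2) * 2 * 2 ^ h" by (intro mult_le_mono) auto
        then show ?thesis by (simp add: algebra_simps)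
      qed
      also have "\<dots> \<le> 2 ^ h * 2 ^ h" using pow by (rule mult_le_mono1)
      also have "\<dots> = 2 ^ (2 * h)" by (simp add: power_add[symmetric] mult_2)
      also have "\<dots> \<le> 2 ^ n" by (rule power_increasing) (auto simp: h_def)
      finally show False using le 1 by linarith
    qed
  next
    case 2
    then show False using eq degree_dynatomic_small
      by (elim insertE emptyE)
        (simp_all only: proper_divisors_small, simp_all add: totient_small)
  qed
qed

section \<open>The eight quartics\<close>

lemma prim_roots_minimal_equations:
  "\<zeta> \<in> prim_roots 5 \<Longrightarrow> \<zeta>^4 + \<zeta>^3 + \<zeta>^2 + \<zeta> + 1 = 0"
  "\<zeta> \<in> prim_roots 8 \<Longrightarrow> \<zeta>^4 + 1 = 0"
  "\<zeta> \<in> prim_roots 10 \<Longrightarrow> \<zeta>^4 - \<zeta>^3 + \<zeta>^2 - \<zeta> + 1 = 0"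
  "\<zeta> \<in> prim_roots 12 \<Longrightarrow> \<zeta>^4 - \<zeta>^2 + 1 = 0"
proof -
  have sq: "x = - 1" if "x^2 = 1" "x \<noteq> 1" for x :: complex
    using that by (simp add: power2_eq_1_iff)
  have 5: "(x - 1) * (x^4 + x^3 + x^2 + x + 1) = x^5 - 1" for x :: complex
    by (simp add: eval_nat_numeral algebra_simps)
  {
    assume z: "\<zeta> \<in> prim_roots 5"
    have "\<zeta>^5 = 1" "\<zeta>^1 \<noteq> 1" using z unfolding prim_roots_def by auto
    then show "\<zeta>^4 + \<zeta>^3 + \<zeta>^2 + \<zeta> + 1 = 0" using 5[of \<zeta>] by simp
  next
    assume z: "\<zeta> \<in> prim_roots 8"
    have "(\<zeta>^4)^2 = 1" "\<zeta>^4 \<noteq> 1" using z unfolding prim_roots_def by (simp_all flip: power_mult)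
    then show "\<zeta>^4 + 1 = 0" using sq[of "\<zeta>^4"] by simp
  next
    assume z: "\<zeta> \<in> prim_roots 10"
    have "(\<zeta>^5)^2 = 1" "\<zeta>^5 \<noteq> 1" "\<zeta>^2 \<noteq> 1"
      using z unfolding prim_roots_def by (simp_all flip: power_mult)
    then have "\<zeta>^5 = - 1" "\<zeta> \<noteq> - 1" using sq[of "\<zeta>^5"] by auto
    then have "(- \<zeta> - 1) * (\<zeta>^4 - \<zeta>^3 + \<zeta>^2 - \<zeta> + 1) = 0" "- \<zeta> - 1 \<noteq> 0"
      using 5[of "- \<zeta>"] by (simp_all add: minus_equation_iff[of \<zeta>] eq_commute[of "- 1"])
    then show "\<zeta>^4 - \<zeta>^3 + \<zeta>^2 - \<zeta> + 1 = 0" using mult_eq_0_iff by blast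
  next
    assume z: "\<zeta> \<in> prim_roots 12"
    have "(\<zeta>^6)^2 = 1" "\<zeta>^6 \<noteq> 1" "(\<zeta>^2)^2 \<noteq> 1"
      using z unfolding prim_roots_def by (simp_all flip: power_mult)
    then have cube: "(\<zeta>^2)^3 = - 1" using sq[of "\<zeta>^6"] by (simp flip: power_mult)
    have nz: "\<zeta>^2 + 1 \<noteq> 0"
    proof
      assume "\<zeta>^2 + 1 = 0"
      then have "\<zeta>^2 = - 1" by (simp only: eq_neg_iff_add_eq_0)
      then have "(\<zeta>^2)^2 = 1" by (simp only: power2_minus power_one)
      then show False using \<open>(\<zeta>^2)^2 \<noteq> 1\<close> by contradiction
    qed
    have "(x + 1) * (x^2 - x + 1) = x^3 + 1" for x :: complex
      by (simp add: eval_nat_numeral algebra_simps)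
    from this[of "\<zeta>^2"] have "(\<zeta>^2 + 1) * (\<zeta>^4 - \<zeta>^2 + 1) = (\<zeta>^2)^3 + 1"
      by (simp flip: power_mult)
    then have "(\<zeta>^2 + 1) * (\<zeta>^4 - \<zeta>^2 + 1) = 0" unfolding cube by simp
    then show "\<zeta>^4 - \<zeta>^2 + 1 = 0" using nz mult_eq_0_iff by blast
  }
qed

lemma fixed_point_multiplier:
  fixes c :: complex
  assumes "\<alpha> \<in> exact_points (quad c) 1"
  shows "4 * c = 2 * multiplier c 1 \<alpha> - (multiplier c 1 \<alpha>)\<^sup>2"
proof -
  have c: "c = \<alpha> - \<alpha>\<^sup>2" using assms by (simp add: exact_points_def quad_def eq_diff_eq add.commute)
  have mult: "multiplier c 1 \<alpha> = 2 * \<alpha>" by (simp add: multiplier_eq_prod)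
  have "4 * (\<alpha> - \<alpha>\<^sup>2) = 2 * (2 * \<alpha>) - (2 * \<alpha>)\<^sup>2" by (simp add: power2_eq_square algebra_simps)
  then show ?thesis unfolding mult c[symmetric] .
qed

text \<open>
  The points of exact period \<open>2\<close> are roots of \<open>z ^ 2 + z + c + 1\<close>, and the multiplier is four times the
  product of the two roots.
\<close>

lemma two_cycle_multiplier:
  fixes c :: complex
  assumes "\<alpha> \<in> exact_points (quad c) 2"
  shows "4 * c = multiplier c 2 \<alpha> - 4"
proof -
  have 2: "(\<alpha>\<^sup>2 + c)\<^sup>2 + c = \<alpha>" and 1: "\<alpha>\<^sup>2 + c \<noteq> \<alpha>"
    using assms by (auto simp: exact_points_def quad_def numeral_2_eq_2)
  have "(\<alpha>\<^sup>2 + c - \<alpha>) * (\<alpha>\<^sup>2 + \<alpha> + c + 1) = (\<alpha>\<^sup>2 + c)\<^sup>2 + c - \<alpha>" by Groebner_Basis.algebra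
  then have "\<alpha>\<^sup>2 + \<alpha> + c + 1 = 0" using 1 2 by simp
  moreover have "multiplier c 2 \<alpha> = 4 * \<alpha> * (\<alpha>\<^sup>2 + c)"
    by (simp add: multiplier_eq_prod numeral_2_eq_2 quad_def)
  ultimately show ?thesis by Groebner_Basis.algebra
qed


lemma root_of_irreducible_degree:
  assumes irr: "irreducible (map_poly rat_of_int D)" and root: "poly (map_poly of_int D) \<gamma> = 0"
    and deg: "has_degree_over_rat \<gamma> d"
  shows "degree D = d"
proof -
  obtain p :: "rat poly" where p: "irreducible p" "degree p = d" "poly (map_poly of_rat p) \<gamma> = 0"
    using deg by (auto simp: has_degree_over_rat_def)
  let ?D = "map_poly rat_of_int D"
  have D: "poly (map_poly of_rat ?D) \<gamma> = 0" using root by (simp only: map_poly_of_rat_of_int)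
  have "p dvd ?D" "?D dvd p" 
    using irreducible_rat_poly_dvd[OF p(1) p(3) D] irreducible_rat_poly_dvd[OF irr D p(3)] .
  moreover have "p \<noteq> 0" "?D \<noteq> 0" using p(1) irr by auto
  ultimately have "degree p = degree ?D" by (intro antisym dvd_imp_degree_le)
  then show ?thesis using p(2) by simp
qed

lemma parabolic_quartic:
  fixes \<gamma> \<alpha> :: complex
  assumes k: "k = 1 \<or> k = 2" and r: "r \<in> {5, 8, 10, 12}"
    and \<alpha>: "\<alpha> \<in> exact_points (quad \<gamma>) k" and \<zeta>: "multiplier \<gamma> k \<alpha> \<in> prim_roots r"
  shows "256 * \<gamma>^4 + 64 * \<gamma>^3 + 16 * \<gamma>^2 - 36 * \<gamma> + 31 = 0
       \<or> 256 * \<gamma>^4 + 32 * \<gamma>^2 - 64 * \<gamma> + 17 = 0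
       \<or> 256 * \<gamma>^4 - 192 * \<gamma>^3 + 144 * \<gamma>^2 - 68 * \<gamma> + 11 = 0
       \<or> 256 * \<gamma>^4 + 128 * \<gamma>^3 - 16 * \<gamma>^2 - 56 * \<gamma> + 13 = 0
       \<or> 256 * \<gamma>^4 + 1088 * \<gamma>^3 + 1744 * \<gamma>^2 + 1252 * \<gamma> + 341 = 0
       \<or> 256 * \<gamma>^4 + 1024 * \<gamma>^3 + 1536 * \<gamma>^2 + 1024 * \<gamma> + 257 = 0
       \<or> 256 * \<gamma>^4 + 960 * \<gamma>^3 + 1360 * \<gamma>^2 + 860 * \<gamma> + 205 = 0
       \<or> 256 * \<gamma>^4 + 1024 * \<gamma>^3 + 1520 * \<gamma>^2 + 992 * \<gamma> + 241 = 0"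
proof -
  define z where "z = multiplier \<gamma> k \<alpha>"
  have pow: "256 * \<gamma>^4 = (4 * \<gamma>)^4" "64 * \<gamma>^3 = (4 * \<gamma>)^3" "16 * \<gamma>^2 = (4 * \<gamma>)^2"
    by (simp_all add: power_mult_distrib)
  have z: "z \<in> prim_roots r" using \<zeta> by (simp add: z_def)
  from k show ?thesis
  proof
    assume "k = 1"
    then have g: "4 * \<gamma> = 2 * z - z\<^sup>2" using fixed_point_multiplier[of \<alpha> \<gamma>] \<alpha> by (simp add: z_def)
    consider "r = 5" | "r = 8" | "r = 10" | "r = 12" using r by blast
    then show ?thesis
    proof cases
      case 1
      then have "z^4 + z^3 + z^2 + z + 1 = 0" using prim_roots_minimal_equations(1) z by simp
      then have "256 * \<gamma>^4 + 64 * \<gamma>^3 + 16 * \<gamma>^2 - 36 * \<gamma> + 31 = 0" using g by Groebner_Basis.algebra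
      then show ?thesis by blast
    next
      case 2
      then have "z^4 + 1 = 0" using prim_roots_minimal_equations(2) z by simp
      then have "256 * \<gamma>^4 + 32 * \<gamma>^2 - 64 * \<gamma> + 17 = 0" using g by Groebner_Basis.algebra
      then show ?thesis by blast
    next
      case 3
      then have "z^4 - z^3 + z^2 - z + 1 = 0" using prim_roots_minimal_equations(3) z by simp
      then have "256 * \<gamma>^4 - 192 * \<gamma>^3 + 144 * \<gamma>^2 - 68 * \<gamma> + 11 = 0" using g by Groebner_Basis.algebra
      then show ?thesis by blast
    next
      case 4
      then have "z^4 - z^2 + 1 = 0" using prim_roots_minimal_equations(4) z by simp
      then have "256 * \<gamma>^4 + 128 * \<gamma>^3 - 16 * \<gamma>^2 - 56 * \<gamma> + 13 = 0" using g by Groebner_Basis.algebra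
      then show ?thesis by blast
    qed
  next
    assume "k = 2"
    then have g: "z = 4 * \<gamma> + 4" using two_cycle_multiplier[of \<alpha> \<gamma>] \<alpha> by (simp add: z_def)
    consider "r = 5" | "r = 8" | "r = 10" | "r = 12" using r by blast
    then show ?thesis
    proof cases
      case 1
      then have "z^4 + z^3 + z^2 + z + 1 = 0" using prim_roots_minimal_equations(1) z by simp
      then have "256 * \<gamma>^4 + 1088 * \<gamma>^3 + 1744 * \<gamma>^2 + 1252 * \<gamma> + 341 = 0" using g by Groebner_Basis.algebra
      then show ?thesis by blast
    next
      case 2
      then have "z^4 + 1 = 0" using prim_roots_minimal_equations(2) z by simp
      then have "256 * \<gamma>^4 + 1024 * \<gamma>^3 + 1536 * \<gamma>^2 + 1024 * \<gamma> + 257 = 0" using g by Groebner_Basis.algebra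
      then show ?thesis by blast
    next
      case 3
      then have "z^4 - z^3 + z^2 - z + 1 = 0" using prim_roots_minimal_equations(3) z by simp
      then have "256 * \<gamma>^4 + 960 * \<gamma>^3 + 1360 * \<gamma>^2 + 860 * \<gamma> + 205 = 0" using g by Groebner_Basis.algebra
      then show ?thesis by blast
    next
      case 4
      then have "z^4 - z^2 + 1 = 0" using prim_roots_minimal_equations(4) z by simp
      then have "256 * \<gamma>^4 + 1024 * \<gamma>^3 + 1520 * \<gamma>^2 + 992 * \<gamma> + 241 = 0" using g by Groebner_Basis.algebra
      then show ?thesis by blast
    qed
  qed
qed

theorem proposition6p9:
  fixes \<gamma> :: complex
  assumes "\<And>n m :: nat. n > 0 \<Longrightarrow> m > 0 \<Longrightarrow> m dvd n \<Longrightarrow> Polynomial.degree (Delta n m) > 0 \<Longrightarrow>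
             Factorial_Ring.irreducible (map_poly rat_of_int (Delta n m))"
    and "parabolic_parameter \<gamma>"
    and "has_degree_over_rat \<gamma> 4"
  shows "256 * \<gamma>^4 + 64 * \<gamma>^3 + 16 * \<gamma>^2 - 36 * \<gamma> + 31 = 0
       \<or> 256 * \<gamma>^4 + 32 * \<gamma>^2 - 64 * \<gamma> + 17 = 0
       \<or> 256 * \<gamma>^4 - 192 * \<gamma>^3 + 144 * \<gamma>^2 - 68 * \<gamma> + 11 = 0
       \<or> 256 * \<gamma>^4 + 128 * \<gamma>^3 - 16 * \<gamma>^2 - 56 * \<gamma> + 13 = 0
       \<or> 256 * \<gamma>^4 + 1088 * \<gamma>^3 + 1744 * \<gamma>^2 + 1252 * \<gamma> + 341 = 0
       \<or> 256 * \<gamma>^4 + 1024 * \<gamma>^3 + 1536 * \<gamma>^2 + 1024 * \<gamma> + 257 = 0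
       \<or> 256 * \<gamma>^4 + 960 * \<gamma>^3 + 1360 * \<gamma>^2 + 860 * \<gamma> + 205 = 0
       \<or> 256 * \<gamma>^4 + 1024 * \<gamma>^3 + 1520 * \<gamma>^2 + 992 * \<gamma> + 241 = 0"
    (is ?quartics)
proof -
  have irr: "irreducible (map_poly rat_of_int (Delta_proper n k))" if "n > 0" "k dvd n" "k \<noteq> n" for n k
  proof -
    have k: "k > 0" and r: "n div k > 0" and n: "n = k * (n div k)"
      using that by (auto intro: Nat.gr0I dest: dvd_imp_le)
    have eq: "Delta n k = Delta_proper n k" unfolding Delta_def using that(3) by (rule if_not_P)
    have "degree (Delta_proper n k) > 0"
      using degree_Delta_proper(1)[OF k r n] degree_dynatomic_pos[OF k] r by (intro Nat.gr0I) auto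
    then show ?thesis using assms(1)[OF that(1) k that(2)] unfolding eq by blast
  qed
  have proper: ?quartics
    if k: "k > 0" and r: "r > 1" and root: "poly (map_poly of_int (Delta_proper (k * r) k)) \<gamma> = 0" for k r
  proof -
    have "irreducible (map_poly rat_of_int (Delta_proper (k * r) k))"
      using k r by (intro irr) auto
    from root_of_irreducible_degree[OF this root assms(3)]
    have "totient r * degree (dynatomic k) = 8"
      using degree_Delta_proper(1)[OF k _ refl, of r] r by simp
    from proper_degree_4D[OF k this] have kr: "k = 1 \<or> k = 2" "r \<in> {5, 8, 10, 12}"
      using totient_eq_4D by blast+
    obtain \<alpha> where "\<alpha> \<in> exact_points (quad \<gamma>) k" "multiplier \<gamma> k \<alpha> \<in> prim_roots r"
      using Delta_proper_root[OF k r refl root] .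
    then show ?thesis using parabolic_quartic kr by blast
  qed
  obtain \<alpha> m s where m: "m > 0" "poly (quad_iter \<gamma> m) \<alpha> = \<alpha>"
      "\<forall>k. 0 < k \<and> k < m \<longrightarrow> poly (quad_iter \<gamma> k) \<alpha> \<noteq> \<alpha>"
    and s: "s > 0" "multiplier \<gamma> m \<alpha> ^ s = 1"
    using assms(2) unfolding parabolic_parameter_def by blast
  have \<alpha>: "\<alpha> \<in> exact_points (quad \<gamma>) m" using m by (simp add: exact_points_def poly_quad_iter)
  have \<alpha>0: "poly (dynatomic_at \<gamma> m) \<alpha> = 0" by (rule dynatomic_at_exact_root[OF m(1) \<alpha>])
  obtain r where r: "r > 0" "multiplier \<gamma> m \<alpha> \<in> prim_roots r"
    using ex_exact_period[of s "(*) (multiplier \<gamma> m \<alpha>)" 1] s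
    by (auto simp: funpow_mult_one prim_roots_iff_exact_points)
  have root: "poly (delta_at \<gamma> m) (multiplier \<gamma> m \<alpha>) = 0"
    using poly_delta_at_eq_0_iff[OF m(1)] \<alpha>0 by blast
  show ?quartics
  proof (cases "r = 1")
    case False
    then have r1: "r > 1" using r(1) by simp
    have "poly (map_poly of_int (Delta_proper (m * r) m)) \<gamma> = 0"
      unfolding Delta_proper_eq_prod[OF r(1) refl m(1)] poly_prod prod_zero_iff[OF finite_prim_roots[OF r(1)]]
      using r(2) root by (auto simp: poly_delta_val)
    then show ?thesis by (rule proper[OF m(1) r1])
  next
    case True
    then have "multiplier \<gamma> m \<alpha> = 1" using r(2) by (simp add: prim_roots_def)
    then have "poly (delta_val m 1) \<gamma> = 0" using root by (simp add: poly_delta_val)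
    let ?P = "{k. k dvd m \<and> k \<noteq> m}"
    have finP: "finite ?P" using m(1) by simp
    have fact: "poly (delta m) 1 = Delta m m * (\<Prod>k\<in>?P. Delta_proper m k)"
      by (rule delta_1_factorization[OF m(1)]) (rule irr[OF m(1)])
    have "poly (map_poly of_int (Delta m m)) \<gamma> * (\<Prod>k\<in>?P. poly (map_poly of_int (Delta_proper m k)) \<gamma>) = 0"
      using \<open>poly (delta_val m 1) \<gamma> = 0\<close>
      unfolding delta_val_1[symmetric] fact of_int_poly_hom.hom_mult of_int_poly_hom.hom_prod poly_mult poly_prod .
    then consider "poly (map_poly of_int (Delta m m)) \<gamma> = 0"
      | k where "k \<in> ?P" "poly (map_poly of_int (Delta_proper m k)) \<gamma> = 0"
      unfolding mult_eq_0_iff prod_zero_iff[OF finP] by blast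
    then show ?thesis
    proof cases
      case 1
      have nz: "Delta m m \<noteq> 0" using degree_delta_1(2)[OF m(1)] unfolding fact by auto
      have "degree (Delta m m) \<noteq> 0"
      proof
        assume "degree (Delta m m) = 0"
        then obtain a where a: "Delta m m = [:a:]" by (rule degree_eq_zeroE)
        then show False using 1 nz by simp
      qed
      then have "irreducible (map_poly rat_of_int (Delta m m))"
        using assms(1)[OF m(1) m(1) dvd_refl] by simp
      from root_of_irreducible_degree[OF this 1 assms(3)] have "degree (Delta m m) = 4" .
      moreover have "degree (dynatomic m) = 2 * degree (Delta m m) +
          (\<Sum>k\<in>?P. totient (m div k) * degree (dynatomic k))"
        by (rule degree_Delta_diagonal[OF m(1)]) (rule irr[OF m(1)])
      ultimately show ?thesis using diagonal_degree_neq_4[OF m(1)] by simp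
    next
      case (2 k)
      then have "k > 0" "m div k > 1" "m = k * (m div k)"
        using m(1) proper_divisor_le_half[of m k] by (auto elim!: dvdE)
      then show ?thesis using proper[of k "m div k"] 2(2) by simp
    qed
  qed
qed


end
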